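(* Let $f:\overline{\mathbb R}^d\to[0,\infty]$ be a non-negative, continuous and $1$-homogeneous function such that $f(x)<\infty$ for $x\in\mathbb R^d$, and let $X$ be a random vector in $\mathbb R^d$. Then $X\in\mathrm{DOA}_f(Y)$ (for some random vector $Y$) if and only if $X\in RV_\alpha(\{f=0\},\mu)$ for some $\alpha>0$ (and some $\mu$).
   Context: $\overline{\mathbb R}=[-\infty,\infty]$ carries its usual compact topology and $\overline{\mathbb R}^d$ the product topology. $1$-homogeneous means $f(\lambda x)=\lambda f(x)$ for all $\lambda>0$. Given iid random vectors $X_1,\dots,X_n$ in $\mathbb R^d$, $k(n)$ denotes the smallest index $k\in\{1,\dots,n\}$ with $f(X_k)=\max_{1\le i\le n}f(X_i)$. Domain of attraction: $X\in\mathrm{DOA}_f(Y)$ means that $X$ belongs to the $f$-implicit domain of attraction of a (necessarily) $f$-implicit max-stable random vector $Y$, that is, there exist $a_n>0$ such that $a_n^{-1}X_{k(n)}\Rightarrow Y$ in distribution as $n\to\infty$, where $X_1,\dots,X_n$ are iid copies of $X$. Here $Y$ is $f$-implicit max-stable if for every $n$ there is $b_n>0$ such that $b_n^{-1}Y_{k(n)}\stackrel{d}{=}Y$ for independent copies $Y_1,\dots,Y_n$ of $Y$, with $k(n)$ defined from the $Y_i$. Regular variation: put $D:=\{f=0\}$, a closed cone in $\overline{\mathbb R}^d$ (that is, a closed set with $\lambda D\subset D$ for all $\lambda>0$), and $\overline{\mathbb R}^d_D:=\overline{\mathbb R}^d\setminus D$ with the relative topology. Radon measures on $\overline{\mathbb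 R}^d_D$ are Borel measures finite on compacts; $\nu_n\stackrel{v}{\to}\nu$ means $\int h\,d\nu_n\to\int h\,d\nu$ for every continuous compactly supported $h:\overline{\mathbb R}^d_D\to\mathbb R$. $X\in RV_\alpha(D,\mu)$, $\alpha>0$, means that $\mu$ is a non-trivial Radon measure on $\overline{\mathbb R}^d_D$ supported on $\mathbb R^d\setminus D$ and there is a regularly varying sequence $a_n>0$ with exponent $1/\alpha$ such that $nP(a_n^{-1}X\in\cdot)\stackrel{v}{\to}\mu$ on $\overline{\mathbb R}^d_D$ as $n\to\infty$.
   Formalization: The random vector Y is additionally required to have f(Y) not almost surely constant; without this the claim is false, since Y = 0 is f-implicit max-stable and attracts every X (e.g. X = 0, f = |x|, which is not regularly varying). *)

theory Defs
  imports "HOL-Probability.Probability"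
begin

text \<open>Vectors in the compactified space are of type \<open>ereal ^ 'n\<close>, with the product topology;
  \<open>'n\<close> is an arbitrary finite index type, so \<open>d = CARD('n)\<close>.\<close>

definition to_ext :: "real ^ 'n \<Rightarrow> ereal ^ 'n" where
  "to_ext x = (\<chi> i. ereal (x $ i))"

definition ext_scale :: "real \<Rightarrow> ereal ^ 'n \<Rightarrow> ereal ^ 'n" where
  "ext_scale c x = (\<chi> i. ereal c * x $ i)"

definition homogeneous1 :: "(ereal ^ 'n \<Rightarrow> ennreal) \<Rightarrow> bool" where
  "homogeneous1 f \<longleftrightarrow> (\<forall>c>0. \<forall>x. f (ext_scale c x) = ennreal c * f x)"

definition argmax_index :: "(ereal ^ 'n \<Rightarrow> ennreal) \<Rightarrow> nat \<Rightarrow> (nat \<Rightarrow> real ^ 'n) \<Rightarrow> nat" where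
  "argmax_index f n x =
     (LEAST k. k \<in> {1..n} \<and> f (to_ext (x k)) = Max ((\<lambda>i. f (to_ext (x i))) ` {1..n}))"

text \<open>The law of \<open>c\<inverse> X\<^sub>k\<^sub>(\<^sub>n\<^sub>)\<close> for iid \<open>X\<^sub>1, \<dots>, X\<^sub>n\<close> with law \<open>P\<close>. The iid copies are realised as
  the coordinates on the \<open>n\<close>-fold product of \<open>P\<close>; only \<open>n \<ge> 1\<close> is meaningful.\<close>

definition implicit_max_law ::
  "(ereal ^ 'n \<Rightarrow> ennreal) \<Rightarrow> nat \<Rightarrow> real \<Rightarrow> (real ^ 'n) measure \<Rightarrow> (real ^ 'n) measure" where
  "implicit_max_law f n c P =
     distr (PiM {1..n} (\<lambda>_. P)) borel (\<lambda>x. x (argmax_index f n x) /\<^sub>R c)"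

text \<open>The library's weak convergence of measures is restricted to the real line.\<close>

definition weak_conv_vec :: "(nat \<Rightarrow> (real ^ 'n) measure) \<Rightarrow> (real ^ 'n) measure \<Rightarrow> bool" where
  "weak_conv_vec P Q \<longleftrightarrow>
     (\<forall>h :: real ^ 'n \<Rightarrow> real. continuous_on UNIV h \<and> bounded (range h) \<longrightarrow>
        (\<lambda>n. integral\<^sup>L (P n) h) \<longlonglongrightarrow> integral\<^sup>L Q h)"

definition implicit_max_stable ::
  "(ereal ^ 'n \<Rightarrow> ennreal) \<Rightarrow> 'b measure \<Rightarrow> ('b \<Rightarrow> real ^ 'n) \<Rightarrow> bool" where
  "implicit_max_stable f N Y \<longleftrightarrow>
     (\<forall>n\<ge>1. \<exists>b>0. implicit_max_law f n b (distr N borel Y) = distr N borel Y)"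

definition implicit_DOA ::
  "(ereal ^ 'n \<Rightarrow> ennreal) \<Rightarrow> 'a measure \<Rightarrow> ('a \<Rightarrow> real ^ 'n) \<Rightarrow>
     'b measure \<Rightarrow> ('b \<Rightarrow> real ^ 'n) \<Rightarrow> bool" where
  "implicit_DOA f M X N Y \<longleftrightarrow>
     implicit_max_stable f N Y \<and>
     (\<exists>a :: nat \<Rightarrow> real. (\<forall>n. a n > 0) \<and>
        weak_conv_vec (\<lambda>n. implicit_max_law f n (a n) (distr M borel X)) (distr N borel Y))"

definition regularly_varying_seq :: "real \<Rightarrow> (nat \<Rightarrow> real) \<Rightarrow> bool" where
  "regularly_varying_seq \<rho> a \<longleftrightarrow>
     (\<forall>c>0. (\<lambda>n. a (nat \<lfloor>c * real n\<rfloor>) / a n) \<longlonglongrightarrow> c powr \<rho>)"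

text \<open>For closed \<open>D\<close>, \<^term>\<open>restrict_space borel (- D)\<close> is the Borel space of \<open>- D\<close> in the relative
  topology, and a subset of \<open>- D\<close> is compact in the relative topology iff it is compact in
  \<open>ereal ^ 'n\<close>.\<close>

definition radon_measure_off :: "(ereal ^ 'n) set \<Rightarrow> (ereal ^ 'n) measure \<Rightarrow> bool" where
  "radon_measure_off D \<mu> \<longleftrightarrow>
     sets \<mu> = sets (restrict_space borel (- D)) \<and>
     (\<forall>K. compact K \<and> K \<subseteq> - D \<longrightarrow> emeasure \<mu> K < \<infinity>)"

definition vague_conv_off ::
  "(ereal ^ 'n) set \<Rightarrow> (nat \<Rightarrow> (ereal ^ 'n) measure) \<Rightarrow> (ereal ^ 'n) measure \<Rightarrow> bool" where
  "vague_conv_off D \<nu> \<mu> \<longleftrightarrow>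
     (\<forall>h :: ereal ^ 'n \<Rightarrow> real.
        continuous_on (- D) h \<and>
        (\<exists>K. compact K \<and> K \<subseteq> - D \<and> (\<forall>x. x \<notin> D \<and> x \<notin> K \<longrightarrow> h x = 0)) \<longrightarrow>
        (\<lambda>n. integral\<^sup>L (\<nu> n) h) \<longlonglongrightarrow> integral\<^sup>L \<mu> h)"

text \<open>A measure being supported on \<open>\<real>\<^sup>d \<setminus> D\<close> means that it puts no mass on the points of \<open>- D\<close>
  having an infinite coordinate (not that its topological support avoids these points).\<close>

definition RV ::
  "real \<Rightarrow> (ereal ^ 'n) set \<Rightarrow> (ereal ^ 'n) measure \<Rightarrow> 'a measure \<Rightarrow> ('a \<Rightarrow> real ^ 'n) \<Rightarrow> bool" where
  "RV \<alpha> D \<mu> M X \<longleftrightarrow>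
     radon_measure_off D \<mu> \<and>
     emeasure \<mu> (space \<mu>) \<noteq> 0 \<and>
     (AE x in \<mu>. x \<in> range to_ext) \<and>
     (\<exists>a :: nat \<Rightarrow> real. (\<forall>n. a n > 0) \<and> regularly_varying_seq (1 / \<alpha>) a \<and>
        vague_conv_off D
          (\<lambda>n. scale_measure (of_nat n)
             (restrict_space (distr M borel (\<lambda>\<omega>. to_ext (X \<omega> /\<^sub>R a n))) (- D)))
          \<mu>)"

end

theory Submission
  imports Defs
begin

text \<open>
  Let \<open>\<phi>\<close> be the restriction of \<open>f\<close> to \<open>\<real>\<^sup>d\<close>, \<open>P\<close> the law of \<open>X\<close> and \<open>F\<close> the distribution
  function of \<open>\<phi>(X)\<close>. The law of \<open>X\<^sub>k\<^sub>(\<^sub>n\<^sub>)\<close> has a density with respect to \<open>P\<close> that lies between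
  \<open>n F(\<phi>-)\<^sup>n\<^sup>-\<^sup>1\<close> and \<open>n F(\<phi>)\<^sup>n\<^sup>-\<^sup>1\<close>. If \<open>F(a\<^sub>n z)\<^sup>n\<close> converges to the Frechet function
  \<open>G z = exp (- c z\<^sup>-\<^sup>\<alpha>)\<close>, the convergence is uniform, so the law of \<open>X\<^sub>k\<^sub>(\<^sub>n\<^sub>) / a\<^sub>n\<close> is
  asymptotically \<open>G(\<phi>)\<close> times the measure \<open>n P(X / a\<^sub>n \<in> \<cdot>)\<close>. Hence one of the two converges if and
  only if the other does, and the limits \<open>Q\<close> and \<open>\<mu>\<close> are related by \<open>Q = G(\<phi>) \<mu>\<close>. In one direction
  max-stability of \<open>\<phi>(Y)\<close> forces its law to be Frechet, and convergence of types makes \<open>a\<close>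
  regularly varying. In the other direction regular variation of \<open>a\<close> makes \<open>\<mu>\<close> homogeneous, which
  gives \<open>\<mu>(\<phi> \<ge> z) = c z\<^sup>-\<^sup>\<alpha>\<close>, thus \<open>F(a\<^sub>n z)\<^sup>n \<longlonglongrightarrow> G z\<close>, and the max-stability of \<open>Q\<close>.
\<close>

text \<open>The obstacle is escape of mass. A compact subset of f > 0 in the extended space reaches
  points with infinite coordinates, even points with f = \<infinity>, so the vague test functions,
  restricted to finite vectors, are bounded but not compactly supported. Weak convergence tolerates
  such functions. In the converse direction, however, nothing says at the outset that the candidate
  limit law has mass one. Its mass is controlled by functions of the gauge alone: they extend
  continuously to all points at infinity, and the distribution function of the gauge of the maximum
  is an exact power. Once the mass is known to be one, compactly supported test functions suffice.

  The density is only sandwiched because ties are broken by strict inequalities against earlier and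
  weak ones against later indices; continuity of the Frechet function closes the gap. Limits with
  almost surely constant gauge have to be set apart: a constant vector is attracted by itself, and
  its gauge is max-stable without being Frechet.\<close>

section \<open>The Frechet function and limits of powers\<close>

definition frechet :: "real \<Rightarrow> real \<Rightarrow> real \<Rightarrow> real" where
  "frechet c \<alpha> z = exp (- c * z powr (- \<alpha>))"

lemma frechet_pos [simp]: "0 < frechet c \<alpha> z"
  by (simp add: frechet_def)

lemma frechet_nonzero [simp]: "frechet c \<alpha> z \<noteq> 0"
  by (simp add: frechet_def)

lemma frechet_le_1: "0 \<le> c \<Longrightarrow> frechet c \<alpha> z \<le> 1"
  by (simp add: frechet_def)

lemma frechet_mono:
  assumes "0 \<le> c" "0 < \<alpha>" "0 < z" "z \<le> z'"
  shows "frechet c \<alpha> z \<le> frechet c \<alpha> z'"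
  using assms by (auto simp: frechet_def intro!: mult_left_mono powr_mono2')

lemma frechet_strict_mono:
  assumes "0 < c" "0 < \<alpha>" "0 < z" "z < z'"
  shows "frechet c \<alpha> z < frechet c \<alpha> z'"
  using assms by (auto simp: frechet_def powr_less_mono2_neg)

lemma frechet_power:
  assumes "0 < n" "0 < \<alpha>" "0 < z"
  shows "frechet c \<alpha> z ^ n = frechet c \<alpha> (z / real n powr (1 / \<alpha>))"
  using assms by (simp add: frechet_def flip: exp_of_nat_mult)
    (simp add: powr_divide powr_powr powr_minus field_simps)

text \<open>It converts a change of the index by a factor \<open>s\<close> into a change of scale by
  \<open>s powr (1 / \<alpha>)\<close>, the growth demanded by regular variation.\<close>

lemma frechet_powr:
  assumes "0 < s" "0 < \<alpha>" "0 < z"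
  shows "frechet c \<alpha> z powr (1 / s) = frechet c \<alpha> (s powr (1 / \<alpha>) * z)"
  using assms by (simp add: frechet_def powr_def[of "exp _"])
    (simp add: powr_mult powr_powr powr_minus field_simps)

lemma frechet_surj:
  assumes "0 < c" "0 < \<alpha>" "0 < p" "p < 1"
  obtains z where "0 < z" "frechet c \<alpha> z = p"
proof
  let ?z = "(- ln p / c) powr (- 1 / \<alpha>)"
  have "0 < - ln p / c" using assms by (intro divide_pos_pos) auto
  then show "0 < ?z" by (metis powr_gt_zero order_less_irrefl)
  show "frechet c \<alpha> ?z = p"
    using assms \<open>0 < - ln p / c\<close> by (simp add: frechet_def powr_powr)
qed

lemma continuous_on_frechet: "continuous_on {0<..} (frechet c \<alpha>)"
  unfolding frechet_def by (intro continuous_intros) auto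

text \<open>Sandwiching \<open>n ^ k\<close> between consecutive powers of 2 traps both
  \<open>k * log 2 (b n)\<close> and \<open>k * \<beta> * log 2 n\<close> in one interval of length
  \<open>\<beta>\<close>. Dividing by \<open>k\<close> and letting \<open>k\<close> grow forces
  equality. The exponent is written as \<open>1 / \<alpha>\<close> because \<open>\<alpha>\<close>
  becomes the tail index.\<close>

lemma multiplicative_nat_eq_powr:
  fixes b :: "nat \<Rightarrow> real"
  assumes pos: "\<And>n. 1 \<le> n \<Longrightarrow> 0 < b n"
    and mult: "\<And>m n. 1 \<le> m \<Longrightarrow> 1 \<le> n \<Longrightarrow> b (m * n) = b m * b n"
    and mono: "\<And>m n. 1 \<le> m \<Longrightarrow> m \<le> n \<Longrightarrow> b m \<le> b n"
    and "1 < b 2"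
  obtains \<alpha> where "0 < \<alpha>" "\<And>n. 1 \<le> n \<Longrightarrow> b n = real n powr (1 / \<alpha>)"
proof -
  define \<beta> where "\<beta> = log 2 (b 2)"
  have \<beta>: "0 < \<beta>" using \<open>1 < b 2\<close> by (simp add: \<beta>_def)
  have b1: "b 1 = 1" using mult[of 1 1] pos[of 1] by simp
  have bpow: "b (n ^ k) = b n ^ k" if "1 \<le> n" for n k
  proof (induction k)
    case 0 then show ?case using b1 by simp
  next
    case (Suc k)
    have "1 \<le> n ^ k" using that by simp
    then show ?case using Suc mult[of n "n^k"] that by simp
  qed
  have key: "log 2 (b n) = \<beta> * log 2 (real n)" if n: "1 \<le> n" for n
  proof -
    define d where "d = \<bar>log 2 (b n) - \<beta> * log 2 (real n)\<bar>"
    have bound: "real k * d \<le> \<beta>" if "1 \<le> k" for k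
    proof -
      define j where "j = nat \<lfloor>real k * log 2 (real n)\<rfloor>"
      have nn: "0 \<le> real k * log 2 (real n)" using n by simp
      have j: "real j \<le> real k * log 2 (real n)" "real k * log 2 (real n) < real j + 1"
        using nn unfolding j_def by linarith+
      have l: "log 2 (real (n ^ k)) = real k * log 2 (real n)"
        using n by (simp add: log_nat_power)
      have "2 powr real j \<le> real (n ^ k)"
        using j(1) n by (subst le_log_iff[symmetric]) (auto simp del: of_nat_power simp: l)
      then have "2 ^ j \<le> n ^ k"
        by (simp add: powr_realpow) (metis of_nat_le_iff of_nat_numeral of_nat_power)
      then have 1: "b 2 ^ j \<le> b n ^ k"
        using mono[of "2^j" "n^k"] bpow[of 2 j] bpow[OF n, of k] by simp
      have "real (n ^ k) \<le> 2 powr (real (j + 1))"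
        using j(2) n by (subst log_le_iff[symmetric]) (auto simp del: of_nat_power simp: l)
      then have "n ^ k \<le> 2 ^ (j + 1)"
        by (simp only: powr_realpow zero_less_numeral) (metis of_nat_le_iff of_nat_numeral of_nat_power)
      then have 2: "b n ^ k \<le> b 2 ^ (j + 1)"
        using mono[of "n^k" "2^(j+1)"] bpow[of 2 "j+1"] bpow[OF n, of k] n by simp
      have 3: "log 2 (b 2 ^ j) \<le> log 2 (b n ^ k)"
        using 1 pos[of 2] pos[OF n] by simp
      have 4: "log 2 (b n ^ k) \<le> log 2 (b 2 ^ (j + 1))"
        using 2 pos[of 2] pos[OF n] by simp
      have 5: "real j * \<beta> \<le> real k * log 2 (b n)" "real k * log 2 (b n) \<le> (real j + 1) * \<beta>"
        using 3 4 unfolding log_nat_power[OF less_imp_le[OF pos[OF n]]]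
          log_nat_power[OF less_imp_le[OF pos[of 2, simplified]]]
        by (simp_all add: \<beta>_def algebra_simps)
      have 6: "real j * \<beta> \<le> real k * (\<beta> * log 2 (real n))" "real k * (\<beta> * log 2 (real n)) \<le> (real j + 1) * \<beta>"
        using mult_right_mono[OF j(1), of \<beta>] mult_right_mono[OF less_imp_le[OF j(2)], of \<beta>] \<beta>
        by (simp_all add: algebra_simps)
      have "\<bar>real k * log 2 (b n) - real k * (\<beta> * log 2 (real n))\<bar> \<le> \<beta>"
        using 5 6 by (simp add: algebra_simps abs_le_iff)
      moreover have "\<bar>real k * log 2 (b n) - real k * (\<beta> * log 2 (real n))\<bar> = real k * d"
        unfolding d_def by (metis abs_mult abs_of_nat right_diff_distrib)
      ultimately show ?thesis by simp
    qed
    have "d = 0"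
    proof (rule ccontr)
      assume "d \<noteq> 0"
      then have "0 < d" by (simp add: d_def)
      obtain k where k: "\<beta> / d < real k" using reals_Archimedean2 by blast
      have "0 < \<beta> / d" using \<beta> \<open>0 < d\<close> by simp
      with k have "1 \<le> k" by (cases k) auto
      from bound[OF this] k \<open>0 < d\<close> show False by (simp add: field_simps)
    qed
    then show ?thesis by (simp add: d_def)
  qed
  have "b n = real n powr (1 / (1 / \<beta>))" if n: "1 \<le> n" for n
  proof -
    have "b n = 2 powr (log 2 (b n))" using pos[OF n] by simp
    also have "\<dots> = (2 powr log 2 (real n)) powr \<beta>" by (simp add: key[OF n] powr_powr mult.commute)
    finally show ?thesis using n by simp
  qed
  with \<beta> that[of "1 / \<beta>"] show ?thesis by simp
qed

text \<open>With x = 1 - q the power lies between exp (- n x / (1 - x)) and exp (- n x), and x tends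
  to 0 because n x converges. This turns limits of rescaled tails into limits of distribution
  functions of maxima.\<close>

lemma power_tendsto_exp:
  fixes q :: "nat \<Rightarrow> real"
  assumes "\<And>n. 0 \<le> q n" "\<And>n. q n \<le> 1" "(\<lambda>n. real n * (1 - q n)) \<longlonglongrightarrow> t"
  shows "(\<lambda>n. q n ^ n) \<longlonglongrightarrow> exp (- t)"
proof -
  define x where "x n = 1 - q n" for n
  have x: "0 \<le> x n" "x n \<le> 1" "q n = 1 - x n" for n using assms(1,2)[of n] by (auto simp: x_def)
  have nx: "(\<lambda>n. real n * x n) \<longlonglongrightarrow> t" using assms(3) by (simp add: x_def)
  have "(\<lambda>n. (real n * x n) * (1 / real n)) \<longlonglongrightarrow> 0"
    using tendsto_mult[OF nx lim_1_over_n] by (simp only: mult_zero_right)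
  then have x0: "x \<longlonglongrightarrow> 0"
    by (rule Lim_transform_eventually) (use eventually_gt_at_top[of "0::nat"] in eventually_elim, simp)
  have up: "q n ^ n \<le> exp (- (real n * x n))" for n
  proof -
    have "q n ^ n \<le> exp (- x n) ^ n"
      using exp_ge_add_one_self[of "- x n"] x[of n] by (intro power_mono) auto
    then show ?thesis by (simp flip: exp_of_nat_mult)
  qed
  have low: "eventually (\<lambda>n. exp (- (real n * x n) / (1 - x n)) \<le> q n ^ n) sequentially"
  proof -
    have "eventually (\<lambda>n. x n < 1) sequentially" using x0 by (auto intro: order_tendstoD)
    then show ?thesis
    proof eventually_elim
      case (elim n)
      \<comment> \<open>The inequality 1 + y \<le> exp y at y = x / (1 - x), where 1 + y = 1 / (1 -
        x).\<close>
      have "1 / (1 - x n) \<le> exp (x n / (1 - x n))"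
        using exp_ge_add_one_self[of "x n / (1 - x n)"] elim by (simp add: field_simps)
      then have "exp (- x n / (1 - x n)) \<le> 1 - x n"
        using elim by (simp add: exp_minus field_simps)
      then have "exp (- x n / (1 - x n)) ^ n \<le> q n ^ n"
        unfolding x(3) by (intro power_mono) auto
      then show ?case by (simp flip: exp_of_nat_mult)
    qed
  qed
  have "(\<lambda>n. exp (- (real n * x n) / (1 - x n))) \<longlonglongrightarrow> exp (- t / (1 - 0))"
    by (intro tendsto_intros nx x0) auto
  moreover have "(\<lambda>n. exp (- (real n * x n))) \<longlonglongrightarrow> exp (- t)"
    by (intro tendsto_intros nx)
  ultimately show ?thesis
    using tendsto_sandwich[OF low always_eventually[OF allI[OF up]]] by simp
qed

lemma power_pred_tendsto:
  fixes q :: "nat \<Rightarrow> real"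
  assumes "\<And>n. 0 \<le> q n" "\<And>n. q n \<le> 1" "(\<lambda>n. q n ^ n) \<longlonglongrightarrow> g" "0 < g"
  shows "(\<lambda>n. q n ^ (n - 1)) \<longlonglongrightarrow> g"
proof -
  have pos: "eventually (\<lambda>n. g / 2 < q n ^ n \<and> 1 \<le> n) sequentially"
    using order_tendstoD(1)[OF assms(3), of "g/2"] assms(4) eventually_ge_at_top[of 1]
    by (auto intro: eventually_conj)
  have low: "eventually (\<lambda>n. (g/2) powr (1 / real n) \<le> q n) sequentially"
    using pos
  proof eventually_elim
    case (elim n)
    then have "q n \<noteq> 0" using assms(4) by (auto simp: power_0_left split: if_splits)
    then have "0 < q n" using assms(1)[of n] by simp
    have "(g/2) powr (1 / real n) \<le> (q n ^ n) powr (1 / real n)"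
      using elim assms(4) by (intro powr_mono2) auto
    also have "\<dots> = q n" using \<open>0 < q n\<close> elim by (simp add: powr_powr flip: powr_realpow)
    finally show ?case .
  qed
  have "(\<lambda>n. (g/2) powr (1 / real n)) \<longlonglongrightarrow> (g/2) powr 0"
    using assms(4) by (intro tendsto_intros lim_1_over_n) auto
  then have q1: "q \<longlonglongrightarrow> 1"
    using assms(2,4) by (intro tendsto_sandwich[OF low _ _ tendsto_const]) auto
  have "(\<lambda>n. q n ^ n / q n) \<longlonglongrightarrow> g / 1"
    by (intro tendsto_intros assms(3) q1) auto
  moreover have "eventually (\<lambda>n. q n ^ n / q n = q n ^ (n - 1)) sequentially"
    using pos by eventually_elim (use assms(4) in \<open>auto simp: power_eq_if power_0_left split: if_splits\<close>)
  ultimately show ?thesis by (auto intro: Lim_transform_eventually)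
qed

text \<open>Polya's theorem; \<open>l\<close> plays the role of the left limit of \<open>u\<close>.\<close>

lemma frechet_uniform_limit:
  assumes c: "0 < c" and \<alpha>: "0 < \<alpha>" and e: "0 < e"
    and lim: "\<And>z. 0 < z \<Longrightarrow> (\<lambda>n. u n z) \<longlonglongrightarrow> frechet c \<alpha> z"
    and mono: "\<And>n z z'. 0 < z \<Longrightarrow> z \<le> z' \<Longrightarrow> u n z \<le> u n z'"
    and ul: "\<And>n z z'. 0 < z \<Longrightarrow> z < z' \<Longrightarrow> u n z \<le> l n z'"
    and l0: "\<And>n z. 0 < z \<Longrightarrow> (0::real) \<le> l n z" and u1: "\<And>n z. 0 < z \<Longrightarrow> u n z \<le> 1"
  shows "eventually (\<lambda>n. \<forall>z>0. frechet c \<alpha> z - e \<le> l n z \<and> u n z \<le> frechet c \<alpha> z + e) sequentially"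
proof -
  obtain N where N: "3 / e < real N" using reals_Archimedean2 by blast
  have "0 < 3 / e" using e by simp
  then have N0: "0 < real N" using N by linarith
  have Ne: "3 / real N < e" using N N0 e by (simp add: field_simps)
  \<comment> \<open>Quantiles of the Frechet law at the levels i / N. The choice is meaningful only
    for 0 < i < N, and every use below stays in this range.\<close>
  define y where "y i = (SOME z. 0 < z \<and> frechet c \<alpha> z = real i / real N)" for i
  have y: "0 < y i" "frechet c \<alpha> (y i) = real i / real N" if "0 < i" "i < N" for i
  proof -
    have "\<exists>z. 0 < z \<and> frechet c \<alpha> z = real i / real N"
      using frechet_surj[OF c \<alpha>, of "real i / real N"] that by (metis divide_less_eq_1_pos divide_pos_pos of_nat_0_less_iff of_nat_less_iff N0)
    from someI_ex[OF this] show "0 < y i" "frechet c \<alpha> (y i) = real i / real N"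
      by (auto simp: y_def)
  qed
  have "eventually (\<lambda>n. \<forall>i\<in>{0<..<N}. dist (u n (y i)) (frechet c \<alpha> (y i)) < 1 / real N) sequentially"
    by (intro eventually_ball_finite ballI tendstoD lim) (auto simp: y N0)
  then show ?thesis
  proof eventually_elim
    case (elim n)
    have uy: "real i / real N - 1 / real N < u n (y i)" "u n (y i) < real i / real N + 1 / real N"
      if "0 < i" "i < N" for i
      using bspec[OF elim, of i] that y(2)[OF that] by (auto simp: dist_real_def)
    show ?case
    proof (intro allI impI)
      fix z :: real assume z: "0 < z"
      let ?g = "frechet c \<alpha> z"
      define i where "i = nat \<lfloor>real N * ?g\<rfloor>"
      have "0 \<le> real N * ?g" using N0 by (simp add: frechet_def)
      then have i: "real i \<le> real N * ?g" "real N * ?g < real i + 1" unfolding i_def by linarith+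
      have i': "real i / real N \<le> ?g" "?g < real i / real N + 1 / real N"
        using i N0 by (simp_all add: field_simps)
      have g1: "?g < 1" using c z by (simp add: frechet_def)
      have "real N * ?g < real N * 1" using g1 N0 by (intro mult_strict_left_mono) auto
      then have iN: "i < N" using i by (metis mult.right_neutral of_nat_less_iff order_le_less_trans)
      have lt: "frechet c \<alpha> w < frechet c \<alpha> w' \<Longrightarrow> 0 < w' \<Longrightarrow> w < w'" if "0 < w" for w w'
        using frechet_mono[of c \<alpha> w' w] c \<alpha> that by (metis less_eq_real_def linorder_not_le)
      \<comment> \<open>Three losses of 1 / N: \<open>?g\<close> exceeds i / N, the grid point is
        taken at i - 1 because \<open>ul\<close> needs a strict inequality, and convergence on the
        grid is only approximate. For i < 2 there is no such grid point, but then the bound is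
        negative.\<close>
      have "?g - 3 / real N \<le> l n z"
      proof (cases "2 \<le> i")
        case True
        have "real (i - 1) / real N < ?g" using i' True N0
          by (smt (verit) divide_strict_right_mono of_nat_less_iff Suc_1 diff_less less_le_trans zero_less_Suc zero_less_one)
        then have "y (i - 1) < z" using lt[of "y (i-1)" z] y[of "i-1"] True iN z by auto
        then have "u n (y (i - 1)) \<le> l n z" using ul y[of "i-1"] True iN by auto
        moreover have "real (i - 1) / real N - 1 / real N < u n (y (i - 1))"
          using uy[of "i-1"] True iN by auto
        moreover have "real (i - 1) / real N = real i / real N - 1 / real N"
          using True by (simp add: of_nat_diff diff_divide_distrib)
        ultimately show ?thesis using i' by (simp add: field_simps)
      next
        case False
        then have "real i / real N \<le> 1 / real N" using N0 by (simp add: divide_right_mono)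
        then have "?g < 3 / real N" using i' N0 by (simp add: field_simps)
        then show ?thesis using l0[OF z, of n] by simp
      qed
      moreover have "u n z \<le> ?g + 3 / real N"
      proof (cases "i + 1 < N")
        case True
        have "?g < real (i + 1) / real N" using i' by (simp add: add_divide_distrib)
        then have "z < y (i + 1)" using lt[OF z, of "y (i+1)"] y[of "i+1"] True by auto
        then have "u n z \<le> u n (y (i + 1))" using mono z by auto
        also have "\<dots> < real (i + 1) / real N + 1 / real N"
          using uy[of "i+1"] True by auto
        finally show ?thesis using i' N0 by (simp add: field_simps)
      next
        case False
        then have "real i + 1 = real N" using iN by (simp add: of_nat_add[symmetric] del: of_nat_add)
        then have "real i / real N + 1 / real N = 1" using N0 by (simp add: add_divide_distrib[symmetric])
        then have "1 \<le> ?g + 1 / real N" using i' by linarith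
        moreover have "1 / real N \<le> 3 / real N" using N0 by (simp add: field_simps)
        ultimately show ?thesis using u1[OF z, of n] by linarith
      qed
      ultimately show "?g - e \<le> l n z \<and> u n z \<le> ?g + e" using Ne by linarith
    qed
  qed
qed

section \<open>Max-stable distribution functions on the positive half-line\<close>

text \<open>A value strictly between 0 and 1 makes the scales \<open>b n\<close> unique, hence
  multiplicative and increasing, hence powers of n. The functional equation then fixes
  \<open>G\<close> at the points \<open>q powr (1 / \<alpha>) * z0\<close> with rational q, and
  monotonicity fills in the rest; continuity of \<open>G\<close> is a consequence.\<close>

lemma max_stable_cdf_frechet:
  fixes G :: "real \<Rightarrow> real"
  assumes mono: "\<And>z z'. 0 < z \<Longrightarrow> z \<le> z' \<Longrightarrow> G z \<le> G z'"
    and G0: "\<And>z. 0 < z \<Longrightarrow> 0 \<le> G z"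
    and stable: "\<And>n. 1 \<le> n \<Longrightarrow> \<exists>b>0. \<forall>z>0. G (b * z) ^ n = G z"
    and z0: "0 < z0" "0 < G z0" "G z0 < 1"
  obtains c \<alpha> where "0 < c" "0 < \<alpha>" "\<And>z. 0 < z \<Longrightarrow> G z = frechet c \<alpha> z"
proof -
  obtain b where b: "\<And>n. 1 \<le> n \<Longrightarrow> 0 < b n" "\<And>n z. 1 \<le> n \<Longrightarrow> 0 < z \<Longrightarrow> G (b n * z) ^ n = G z"
    using stable by metis
  let ?g = "G z0"
  have pw: "x = (y::real)" if "x ^ n = y ^ n" "0 \<le> x" "0 \<le> y" "1 \<le> n" for x y n
    using that by (metis not_one_le_zero power_eq_iff_eq_base zero_less_iff_neq_zero)
  \<comment> \<open>Invariance under one dilation r > 1 makes the monotone \<open>G\<close>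
    constant, and then stability for n = 2 gives \<open>?g ^ 2 = ?g\<close>, which a value in (0, 1)
    cannot satisfy.\<close>
  have noscale: False if r: "1 < r" and eq: "\<And>z. 0 < z \<Longrightarrow> G (r * z) = G z" for r
  proof -
    have it: "G (r ^ k * z) = G z" if "0 < z" for k z
      using that
    proof (induction k)
      case (Suc k)
      then show ?case using eq[of "r ^ k * z"] r by (simp add: mult.assoc)
    qed simp
    have cst: "G z = G z'" if "0 < z" "z \<le> z'" for z z'
    proof -
      obtain k where "z' / z < r ^ k" using real_arch_pow[OF r] by blast
      then have "z' \<le> r ^ k * z" using that by (simp add: field_simps)
      then have "G z' \<le> G z" using mono[of z' "r^k*z"] it[of z k] that by simp
      then show ?thesis using mono[OF that] by simp
    qed
    have "G (b 2 * z0) = ?g"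
      using cst[of z0 "b 2 * z0"] cst[of "b 2 * z0" z0] b(1)[of 2] z0(1) by (cases "z0 \<le> b 2 * z0") auto
    then have "?g ^ 2 = ?g" using b(2)[of 2 z0] z0 by simp
    then show False using z0 by (simp add: power2_eq_square)
  qed
  have uniq: "s = s'" if s: "0 < s" "0 < s'" "\<And>z. 0 < z \<Longrightarrow> G (s * z) = G (s' * z)" for s s'
  proof -
    have aux: "\<not> s < s'" if s: "0 < s" "0 < s'" "\<And>z. 0 < z \<Longrightarrow> G (s * z) = G (s' * z)" for s s'
    proof
      assume "s < s'"
      show False
      proof (rule noscale[of "s' / s"])
        show "1 < s' / s" using \<open>s < s'\<close> s by simp
        show "G (s' / s * z) = G z" if "0 < z" for z using s(3)[of "z / s"] s(1) that by (simp add: field_simps)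
      qed
    qed
    show ?thesis using aux[of s s'] aux[of s' s] s by (metis linorder_neqE_linordered_idom)
  qed
  have bmult: "b (m * n) = b m * b n" if "1 \<le> m" "1 \<le> n" for m n
  proof (rule uniq)
    have mn: "1 \<le> m * n" using that by (metis mult_le_mono mult_1)
    show "0 < b (m * n)" "0 < b m * b n" using b(1) that mn by auto
    fix z :: real assume z: "0 < z"
    have "G (b m * (b n * z)) ^ m = G (b n * z)" using b z that by simp
    then have "(G (b m * b n * z) ^ m) ^ n = G z" using b(2)[of n z] z that by (simp add: mult.assoc)
    then have eq: "G (b (m * n) * z) ^ (m * n) = G (b m * b n * z) ^ (m * n)"
      by (simp only: b(2)[OF mn z] power_mult[of "G (b m * b n * z)"])
    show "G (b (m * n) * z) = G (b m * b n * z)"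
      by (rule pw[OF eq _ _ mn]; intro G0 mult_pos_pos z \<open>0 < b (m * n)\<close> b(1) that)
  qed
  have root: "G (b n * z0) = ?g powr (1 / real n)" if "1 \<le> n" for n
  proof (rule pw[of _ n])
    show "G (b n * z0) ^ n = (?g powr (1 / real n)) ^ n"
      using b(2)[OF that z0(1)] z0 that by (simp add: powr_powr flip: powr_realpow)
  qed (use that z0 b(1)[OF that] G0 in auto)
  \<comment> \<open>\<open>G (b n * z0)\<close> is the n-th root of a number in (0, 1), which
    strictly increases with n.\<close>
  have bmono: "b m < b n" if "1 \<le> m" "m < n" for m n
  proof (rule ccontr)
    assume "\<not> b m < b n"
    then have "G (b n * z0) \<le> G (b m * z0)" using mono b(1)[of n] z0(1) that by simp
    then have "?g powr (1 / real n) \<le> ?g powr (1 / real m)" using root[of m] root[of n] that by simp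
    moreover have "1 / real n < 1 / real m" using that by (simp add: field_simps)
    ultimately show False using z0 by (smt (verit) powr_less_mono')
  qed
  have "b 1 = 1" using bmult[of 1 1] b(1)[of 1] by simp
  then have "1 < b 2" using bmono[of 1 2] by simp
  moreover have "b m \<le> b n" if "1 \<le> m" "m \<le> n" for m n using bmono[of m n] that by (cases "m = n") auto
  ultimately obtain \<alpha> where \<alpha>: "0 < \<alpha>" "\<And>n. 1 \<le> n \<Longrightarrow> b n = real n powr (1 / \<alpha>)"
    using multiplicative_nat_eq_powr[of b] b(1) bmult by metis
  define H where "H = - ln ?g"
  have H: "0 < H" using z0 by (simp add: H_def)
  \<comment> \<open>Scaling \<open>z0\<close> down by \<open>b n\<close> raises \<open>?g\<close> to
    the n-th power, and scaling up by \<open>b m\<close> takes the m-th root.\<close>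
  have rat: "G ((real m / real n) powr (1 / \<alpha>) * z0) = exp (- H / (real m / real n))"
    if "1 \<le> m" "1 \<le> n" for m n
  proof (rule pw[of _ m])
    have "G (z0 / b n) = ?g ^ n" using b[OF \<open>1 \<le> n\<close>] z0(1) b(2)[OF \<open>1 \<le> n\<close>, of "z0 / b n"] by simp
    moreover have "(real m / real n) powr (1 / \<alpha>) * z0 = b m * (z0 / b n)"
      using that \<alpha> by (simp add: powr_divide)
    moreover have "G (b m * (z0 / b n)) ^ m = G (z0 / b n)"
      by (rule b(2)[OF \<open>1 \<le> m\<close>]) (intro divide_pos_pos z0(1) b(1)[OF \<open>1 \<le> n\<close>])
    moreover have "exp (- H / (real m / real n)) ^ m = ?g ^ n"
      using that z0 by (simp add: H_def powr_def flip: exp_of_nat_mult powr_realpow)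
    ultimately show "G ((real m / real n) powr (1 / \<alpha>) * z0) ^ m = exp (- H / (real m / real n)) ^ m"
      by simp
    show "0 \<le> G ((real m / real n) powr (1 / \<alpha>) * z0)" using that z0 by (intro G0) auto
  qed (use that in auto)
  have ratq: "G (q powr (1 / \<alpha>) * z0) = exp (- H / q)" if "q \<in> \<rat>" "0 < q" for q
  proof -
    obtain m n where "n \<noteq> 0" "\<bar>q\<bar> = real m / real n" using Rats_abs_nat_div_natE[OF \<open>q \<in> \<rat>\<close>] by metis
    then show ?thesis using rat[of m n] that by (cases "m = 0") auto
  qed
  have "G z = frechet (H * z0 powr \<alpha>) \<alpha> z" if z: "0 < z" for z
  proof -
    \<comment> \<open>The parameter of the point z on the curve
      \<open>t powr (1 / \<alpha>) * z0\<close>; H / t then equals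
      \<open>H * z0 powr \<alpha> * z powr (- \<alpha>)\<close>, which is where the Frechet constant
      comes from.\<close>
    define t where "t = (z / z0) powr \<alpha>"
    have t: "0 < t" using z z0 by (simp add: t_def)
    have zt: "z = t powr (1 / \<alpha>) * z0" using z z0 \<alpha> by (simp add: t_def powr_powr)
    have lo: "exp (- H / q) \<le> G z" if "q \<in> \<rat>" "0 < q" "q < t" for q
    proof -
      have "q powr (1/\<alpha>) * z0 \<le> z" using that z0 \<alpha> unfolding zt by (auto intro!: powr_mono2)
      then show ?thesis using ratq[OF that(1,2)] mono[of "q powr (1/\<alpha>) * z0" z] that(2) z0 by simp
    qed
    have hi: "G z \<le> exp (- H / q)" if "q \<in> \<rat>" "t < q" for q
    proof -
      have "z \<le> q powr (1/\<alpha>) * z0" using that z0 \<alpha> t unfolding zt by (auto intro!: powr_mono2)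
      then show ?thesis using ratq[OF that(1)] mono[OF z] that(2) t by fastforce
    qed
    have cont: "isCont (\<lambda>q. exp (- H / q)) t" using t by (intro continuous_intros) auto
    have "G z = exp (- H / t)"
    proof (rule ccontr)
      assume neq: "G z \<noteq> exp (- H / t)"
      define d where "d = \<bar>G z - exp (- H / t)\<bar>"
      have "0 < d" using neq by (simp add: d_def)
      then obtain s where s: "0 < s" "\<And>q. \<bar>q - t\<bar> < s \<Longrightarrow> \<bar>exp (- H / q) - exp (- H / t)\<bar> < d"
        using cont unfolding continuous_at_eps_delta by (metis dist_real_def)
      obtain q where q: "q \<in> \<rat>" "max (t - s) 0 < q" "q < t"
        using Rats_dense_in_real[of "max (t - s) 0" t] s t by auto
      obtain q' where q': "q' \<in> \<rat>" "t < q'" "q' < t + s"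
        using Rats_dense_in_real[of t "t + s"] s by auto
      have "exp (- H / q) \<le> G z" "G z \<le> exp (- H / q')" using lo[of q] hi[of q'] q q' by auto
      moreover have "\<bar>exp (- H / q) - exp (- H / t)\<bar> < d" "\<bar>exp (- H / q') - exp (- H / t)\<bar> < d"
        using s(2)[of q] s(2)[of q'] q q' by auto
      ultimately show False unfolding d_def by linarith
    qed
    then show ?thesis using z z0 by (simp add: frechet_def t_def powr_divide powr_minus field_simps)
  qed
  then show ?thesis using that[of "H * z0 powr \<alpha>" \<alpha>] H z0 \<alpha> by simp
qed

section \<open>Regularly varying norming sequences\<close>

text \<open>Regular variation compares the indices n and floor (s n). These facts allow a limit to
  be taken along floor (s n) and converted back to n; the quotient n / floor (s n) is the exponent
  or factor of that conversion.\<close>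

lemma nat_floor_mult_sequence:
  fixes s :: real
  assumes s: "0 < s"
  shows "filterlim (\<lambda>n. nat \<lfloor>s * real n\<rfloor>) at_top sequentially"
    and "eventually (\<lambda>n. 0 < nat \<lfloor>s * real n\<rfloor> \<and> 0 < n) sequentially"
    and "(\<lambda>n. real n / real (nat \<lfloor>s * real n\<rfloor>)) \<longlonglongrightarrow> 1 / s"
proof -
  define m where "m n = nat \<lfloor>s * real n\<rfloor>" for n
  have m_le: "real (m n) \<le> s * real n" "s * real n - 1 < real (m n)" for n
  proof -
    have "0 \<le> s * real n" using s by simp
    then show "real (m n) \<le> s * real n" "s * real n - 1 < real (m n)" unfolding m_def by linarith+
  qed
  have "filterlim (\<lambda>n. - 1 + s * real n) at_top sequentially"
    by (intro filterlim_tendsto_add_at_top[OF tendsto_const] filterlim_tendsto_pos_mult_at_top[OF tendsto_const s]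
        filterlim_real_sequentially)
  then have "filterlim (\<lambda>n. s * real n - 1) at_top sequentially" by simp
  then have "filterlim (\<lambda>n. real (m n)) at_top sequentially"
    by (rule filterlim_at_top_mono) (auto intro: less_imp_le m_le always_eventually)
  then have mtop: "filterlim m at_top sequentially"
    by (simp add: filterlim_sequentially_iff_filterlim_real)
  have ev0: "eventually (\<lambda>n. 0 < m n \<and> 0 < n) sequentially"
    using filterlim_at_top[THEN iffD1, OF mtop, THEN spec, of 1] eventually_gt_at_top[of "0::nat"]
    by eventually_elim auto
  have ratio: "(\<lambda>n. real n / real (m n)) \<longlonglongrightarrow> 1 / s"
  proof -
    have "(\<lambda>n. real (m n) / real n) \<longlonglongrightarrow> s"
    proof (rule tendsto_sandwich)
      show "eventually (\<lambda>n. s - 1 / real n \<le> real (m n) / real n) sequentially"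
        using eventually_gt_at_top[of 0] by eventually_elim (use m_le in \<open>simp add: pos_le_divide_eq left_diff_distrib less_imp_le\<close>)
      show "eventually (\<lambda>n. real (m n) / real n \<le> s) sequentially"
        using eventually_gt_at_top[of 0] by eventually_elim (use m_le in \<open>simp add: field_simps\<close>)
      show "(\<lambda>n. s - 1 / real n) \<longlonglongrightarrow> s" using tendsto_diff[OF tendsto_const lim_1_over_n, of s] by simp
    qed auto
    from tendsto_divide[OF tendsto_const this, of 1] s show ?thesis by (simp add: divide_simps)
  qed
  show "filterlim (\<lambda>n. nat \<lfloor>s * real n\<rfloor>) at_top sequentially"
    "eventually (\<lambda>n. 0 < nat \<lfloor>s * real n\<rfloor> \<and> 0 < n) sequentially"
    "(\<lambda>n. real n / real (nat \<lfloor>s * real n\<rfloor>)) \<longlonglongrightarrow> 1 / s"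
    using mtop ev0 ratio unfolding m_def by auto
qed

text \<open>Convergence of types: the limit of \<open>F (a n * z) ^ n\<close> forces the growth of \<open>a\<close>.\<close>

lemma regularly_varying_of_max_limit:
  assumes c: "0 < c" and \<alpha>: "0 < \<alpha>" and a: "\<And>n. 0 < a n"
    and mono: "\<And>z z'. z \<le> z' \<Longrightarrow> F z \<le> F z'" and F: "\<And>z. 0 \<le> F z"
    and lim: "\<And>z. 0 < z \<Longrightarrow> (\<lambda>n. F (a n * z) ^ n) \<longlonglongrightarrow> frechet c \<alpha> z"
  shows "regularly_varying_seq (1 / \<alpha>) a"
  unfolding regularly_varying_seq_def
proof (intro allI impI)
  fix s :: real assume s: "0 < s"
  define m where "m n = nat \<lfloor>s * real n\<rfloor>" for n
  let ?r = "s powr (1 / \<alpha>)"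
  have mtop: "filterlim m at_top sequentially" and ev0: "eventually (\<lambda>n. 0 < m n \<and> 0 < n) sequentially"
    and ratio: "(\<lambda>n. real n / real (m n)) \<longlonglongrightarrow> 1 / s"
    unfolding m_def by (rule nat_floor_mult_sequence[OF s])+
  \<comment> \<open>The limit along \<open>m n\<close> is raised to the power n / m n, which
    replaces the exponent \<open>m n\<close> by n and tends to 1 / s.\<close>
  have conv: "(\<lambda>n. F (a (m n) * z) ^ n) \<longlonglongrightarrow> frechet c \<alpha> (?r * z)" if z: "0 < z" for z
  proof -
    have 1: "(\<lambda>n. F (a (m n) * z) ^ m n) \<longlonglongrightarrow> frechet c \<alpha> z"
      using filterlim_compose[OF lim[OF z] mtop] by simp
    have 2: "(\<lambda>n. (F (a (m n) * z) ^ m n) powr (real n / real (m n))) \<longlonglongrightarrow> frechet c \<alpha> z powr (1 / s)"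
      using frechet_pos[of c \<alpha> z] by (intro tendsto_powr 1 ratio) auto
    have "eventually (\<lambda>n. (F (a (m n) * z) ^ m n) powr (real n / real (m n)) = F (a (m n) * z) ^ n) sequentially"
      using ev0
    proof eventually_elim
      case (elim n)
      show ?case
      proof (cases "F (a (m n) * z) = 0")
        case True then show ?thesis using elim by (simp add: power_0_left)
      next
        case False
        then have "0 < F (a (m n) * z)" using F[of "a (m n) * z"] by simp
        then show ?thesis using elim by (simp add: powr_powr flip: powr_realpow)
      qed
    qed
    from Lim_transform_eventually[OF 2 this] show ?thesis unfolding frechet_powr[OF s \<alpha> z] .
  qed
  show "(\<lambda>n. a (nat \<lfloor>s * real n\<rfloor>) / a n) \<longlonglongrightarrow> ?r"
    unfolding m_def[symmetric]
  proof (rule order_tendstoI)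
    have rp: "0 < ?r" using s by simp
    fix y :: real
    {
      assume y: "y < ?r"
      \<comment> \<open>\<open>y\<close> may be nonpositive, whereas the limits are known at
        positive arguments only.\<close>
      define w where "w = max y (?r / 2)"
      have w: "0 < w" "w < ?r" "y \<le> w" using y rp by (auto simp: w_def max_def)
      have "frechet c \<alpha> (w * 1) < frechet c \<alpha> (?r * 1)" using w c \<alpha> by (auto intro: frechet_strict_mono)
      \<comment> \<open>\<open>p\<close> separates the limits of \<open>F (a n * w) ^ n\<close> and
        \<open>F (a (m n)) ^ n\<close>. Were the ratio at most \<open>w\<close>, monotonicity would
        order the two powers the other way round.\<close>
      then obtain p where p: "frechet c \<alpha> (w * 1) < p" "p < frechet c \<alpha> (?r * 1)" using dense by blast
      have "eventually (\<lambda>n. F (a n * w) ^ n < p) sequentially"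
        using order_tendstoD(2)[OF lim[OF w(1)]] p by simp
      moreover have "eventually (\<lambda>n. p < F (a (m n) * 1) ^ n) sequentially"
        using order_tendstoD(1)[OF conv, of 1] p by simp
      ultimately show "eventually (\<lambda>n. y < a (m n) / a n) sequentially"
      proof eventually_elim
        case (elim n)
        show ?case
        proof (rule ccontr)
          assume "\<not> y < a (m n) / a n"
          then have "a (m n) / a n \<le> w" using w by linarith
          then have "a (m n) * 1 \<le> a n * w" using a[of n] by (simp add: field_simps)
          from power_mono[OF mono[OF this] F, of n] elim show False by simp
        qed
      qed
    }
    {
      assume y: "?r < y"
      have "frechet c \<alpha> (?r * 1) < frechet c \<alpha> y" using y rp c \<alpha> by (auto intro: frechet_strict_mono)
      then obtain p where p: "frechet c \<alpha> (?r * 1) < p" "p < frechet c \<alpha> y" using dense by blast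
      have "eventually (\<lambda>n. p < F (a n * y) ^ n) sequentially"
        using order_tendstoD(1)[OF lim, of y] p y rp by simp
      moreover have "eventually (\<lambda>n. F (a (m n) * 1) ^ n < p) sequentially"
        using order_tendstoD(2)[OF conv, of 1] p by simp
      ultimately show "eventually (\<lambda>n. a (m n) / a n < y) sequentially"
      proof eventually_elim
        case (elim n)
        show ?case
        proof (rule ccontr)
          assume "\<not> a (m n) / a n < y"
          then have "a n * y \<le> a (m n) * 1" using a[of n] by (simp add: field_simps)
          from power_mono[OF mono[OF this] F, of n] elim show False by simp
        qed
      qed
    }
  qed
qed

section \<open>The gauge on finite vectors and the index of the maximum\<close>

lemma continuous_on_to_ext: "continuous_on S to_ext"
  unfolding to_ext_def by (intro continuous_intros)

lemma measurable_to_ext [measurable]: "to_ext \<in> borel_measurable borel"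
  by (intro borel_measurable_continuous_onI continuous_on_to_ext)

lemma borel_measurable_pred_le:
  fixes u v :: "'a \<Rightarrow> real"
  shows "u \<in> borel_measurable N \<Longrightarrow> v \<in> borel_measurable N \<Longrightarrow> Measurable.pred N (\<lambda>x. u x \<le> v x)"
  by simp

locale homogeneous_gauge =
  fixes f :: "ereal ^ 'n \<Rightarrow> ennreal"
  assumes cont: "continuous_on UNIV f" and hom: "homogeneous1 f"
    and fin: "\<And>x. f (to_ext x) < \<infinity>"
begin

definition \<phi> :: "real ^ 'n \<Rightarrow> real" where "\<phi> x = enn2real (f (to_ext x))"

lemma f_to_ext: "f (to_ext x) = ennreal (\<phi> x)"
  using fin[of x] by (simp add: \<phi>_def)

lemma \<phi>_nonneg [simp]: "0 \<le> \<phi> x"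
  by (simp add: \<phi>_def)

lemma continuous_\<phi>: "continuous_on S \<phi>"
proof -
  have "continuous_on UNIV \<phi>"
    unfolding continuous_on_def \<phi>_def
  proof (intro ballI tendsto_enn2real)
    fix x :: "real ^ 'n"
    have "continuous_on UNIV (\<lambda>x. f (to_ext x))"
      by (rule continuous_on_compose2[OF cont continuous_on_to_ext]) auto
    then show "((\<lambda>x. f (to_ext x)) \<longlongrightarrow> ennreal (enn2real (f (to_ext x)))) (at x within UNIV)"
      using fin[of x] by (simp add: continuous_on_def)
  qed simp
  then show ?thesis by (rule continuous_on_subset) auto
qed

lemma measurable_\<phi> [measurable]: "\<phi> \<in> borel_measurable borel"
  by (intro borel_measurable_continuous_onI continuous_\<phi>)

lemma \<phi>_scale: "0 < c \<Longrightarrow> \<phi> (c *\<^sub>R x) = c * \<phi> x"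
proof -
  assume c: "0 < c"
  have "to_ext (c *\<^sub>R x) = ext_scale c (to_ext x)"
    by (simp add: to_ext_def ext_scale_def vec_eq_iff)
  then show ?thesis
    using hom c by (simp add: \<phi>_def homogeneous1_def enn2real_mult)
qed

lemma \<phi>_divide: "0 < c \<Longrightarrow> \<phi> (x /\<^sub>R c) = \<phi> x / c"
  using \<phi>_scale[of "inverse c" x] by (simp add: divide_inverse mult.commute)

text \<open>Given \<open>x k\<close>, selection of \<open>k\<close> is a separate condition on each
  other coordinate, strict for earlier indices because ties go to the smallest one. This product
  form makes the law of the maximum computable.\<close>

lemma argmax_index_eq_iff:
  assumes n: "1 \<le> n" and k: "k \<in> {1..n}"
  shows "argmax_index f n x = k \<longleftrightarrow>
    (\<forall>i\<in>{1..n} - {k}. if i < k then \<phi> (x i) < \<phi> (x k) else \<phi> (x i) \<le> \<phi> (x k))"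
proof -
  let ?F = "\<lambda>i. f (to_ext (x i))"
  let ?M = "Max (?F ` {1..n})"
  have fle: "?F i \<le> ?F j \<longleftrightarrow> \<phi> (x i) \<le> \<phi> (x j)" "?F i < ?F j \<longleftrightarrow> \<phi> (x i) < \<phi> (x j)" for i j
    by (simp_all add: f_to_ext ennreal_less_iff)
  have Mle: "?F i \<le> ?M" if "i \<in> {1..n}" for i using that by auto
  have "?M \<in> ?F ` {1..n}" using n by (intro Max_in) auto
  then have ex: "\<exists>k. k \<in> {1..n} \<and> ?F k = ?M" by auto
  show ?thesis
  proof
    assume a: "argmax_index f n x = k"
    have k': "k \<in> {1..n} \<and> ?F k = ?M"
      using LeastI_ex[OF ex] a by (simp add: argmax_index_def)
    have ne: "?F i \<noteq> ?M" if "i < k" "i \<in> {1..n}" for i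
      using not_less_Least[of i "\<lambda>k. k \<in> {1..n} \<and> ?F k = ?M"] a that by (auto simp: argmax_index_def)
    show "\<forall>i\<in>{1..n} - {k}. if i < k then \<phi> (x i) < \<phi> (x k) else \<phi> (x i) \<le> \<phi> (x k)"
    proof
      fix i assume i: "i \<in> {1..n} - {k}"
      have "?F i \<le> ?F k" using Mle[of i] k' i by simp
      moreover have "?F i < ?F k" if "i < k" using ne[OF that] i k' Mle[of i] by (simp add: order_less_le)
      ultimately show "if i < k then \<phi> (x i) < \<phi> (x k) else \<phi> (x i) \<le> \<phi> (x k)"
        by (auto simp: fle)
    qed
  next
    assume a: "\<forall>i\<in>{1..n} - {k}. if i < k then \<phi> (x i) < \<phi> (x k) else \<phi> (x i) \<le> \<phi> (x k)"
    have le: "?F i \<le> ?F k" if "i \<in> {1..n}" for i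
    proof (cases "i = k")
      case False
      then have "if i < k then \<phi> (x i) < \<phi> (x k) else \<phi> (x i) \<le> \<phi> (x k)" using a that by blast
      then show ?thesis unfolding fle by (simp split: if_splits)
    qed simp
    have M: "?F k = ?M" using k le by (intro Max_eqI[symmetric]) auto
    show "argmax_index f n x = k"
      unfolding argmax_index_def
    proof (rule Least_equality)
      show "k \<in> {1..n} \<and> ?F k = ?M" using k M by simp
      fix j assume j: "j \<in> {1..n} \<and> ?F j = ?M"
      show "k \<le> j"
      proof (rule ccontr)
        assume "\<not> k \<le> j"
        moreover have "if j < k then \<phi> (x j) < \<phi> (x k) else \<phi> (x j) \<le> \<phi> (x k)"
          using a j calculation by blast
        ultimately have "?F j < ?F k" by (simp add: fle)
        then show False using j M by simp
      qed
    qed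
  qed
qed

lemma argmax_index_mem: "1 \<le> n \<Longrightarrow> argmax_index f n x \<in> {1..n}"
proof -
  assume n: "1 \<le> n"
  let ?F = "\<lambda>i. f (to_ext (x i))"
  have "Max (?F ` {1..n}) \<in> ?F ` {1..n}" using n by (intro Max_in) auto
  then have "\<exists>k. k \<in> {1..n} \<and> ?F k = Max (?F ` {1..n})" by auto
  from LeastI_ex[OF this] show ?thesis by (simp add: argmax_index_def)
qed

lemma \<phi>_argmax_le_iff:
  assumes n: "1 \<le> n"
  shows "\<phi> (x (argmax_index f n x)) \<le> z \<longleftrightarrow> (\<forall>i\<in>{1..n}. \<phi> (x i) \<le> z)"
proof -
  let ?k = "argmax_index f n x"
  have k: "?k \<in> {1..n}" using argmax_index_mem[OF n] .
  have *: "if i < ?k then \<phi> (x i) < \<phi> (x ?k) else \<phi> (x i) \<le> \<phi> (x ?k)" if "i \<in> {1..n}" "i \<noteq> ?k" for i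
    using argmax_index_eq_iff[OF n k, THEN iffD1, OF refl] that by blast
  have "\<phi> (x i) \<le> \<phi> (x ?k)" if "i \<in> {1..n}" for i
    using *[OF that] by (cases "i = ?k"; cases "i < ?k") (simp_all only: if_True if_False simp_thms order_less_imp_le order_refl)
  then show ?thesis using k by (intro iffI ballI) (erule order_trans[rotated], simp, erule bspec)
qed

text \<open>A coordinate with a variable index is a finite sum of coordinates, each cut off by the
  event that its index is selected; these events are finite intersections of comparisons of
  gauges.\<close>

lemma measurable_argmax:
  fixes P :: "(real ^ 'n) measure"
  assumes P [measurable_cong]: "sets P = sets borel" and n: "1 \<le> n"
  shows "(\<lambda>x. x (argmax_index f n x)) \<in> PiM {1..n} (\<lambda>_. P) \<rightarrow>\<^sub>M borel"
proof -
  let ?Q = "\<lambda>k x. (\<forall>i\<in>{1..n} - {k}. if i < k then \<phi> (x i) < \<phi> (x k) else \<phi> (x i) \<le> \<phi> (x k))"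
  have cmp: "(\<lambda>x. x i) \<in> PiM {1..n} (\<lambda>_. P) \<rightarrow>\<^sub>M borel" if "i \<in> {1..n}" for i
    using measurable_component_singleton[OF that, of "\<lambda>_. P"] measurable_cong_sets[OF refl P] by blast
  have Q: "Measurable.pred (PiM {1..n} (\<lambda>_. P)) (?Q k)" if k: "k \<in> {1..n}" for k
  proof (rule pred_intros_finite)
    fix i assume "i \<in> {1..n} - {k}"
    then have [measurable]: "(\<lambda>x. x i) \<in> PiM {1..n} (\<lambda>_. P) \<rightarrow>\<^sub>M borel" using cmp by auto
    have [measurable]: "(\<lambda>x. x k) \<in> PiM {1..n} (\<lambda>_. P) \<rightarrow>\<^sub>M borel" using cmp k by auto
    have "Measurable.pred (PiM {1..n} (\<lambda>_. P)) (\<lambda>x. \<phi> (x i) < \<phi> (x k))"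
      "Measurable.pred (PiM {1..n} (\<lambda>_. P)) (\<lambda>x. \<phi> (x i) \<le> \<phi> (x k))"
      by (intro borel_measurable_pred_less borel_measurable_pred_le measurable_compose[OF _ measurable_\<phi>]; fact)+
    then show "Measurable.pred (PiM {1..n} (\<lambda>_. P))
       (\<lambda>x. if i < k then \<phi> (x i) < \<phi> (x k) else \<phi> (x i) \<le> \<phi> (x k))"
      by (cases "i < k") (simp_all only: if_True if_False simp_thms)
  qed simp
  have eq: "x (argmax_index f n x) = (\<Sum>k\<in>{1..n}. if ?Q k x then x k else 0)" for x
  proof -
    let ?k = "argmax_index f n x"
    have k: "?k \<in> {1..n}" using argmax_index_mem[OF n] .
    have "(\<Sum>j\<in>{1..n}. if ?Q j x then x j else 0) = (\<Sum>j\<in>{1..n}. if j = ?k then x j else 0)"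
    proof (rule sum.cong[OF refl])
      fix j assume "j \<in> {1..n}"
      from argmax_index_eq_iff[OF n this, of x]
      show "(if ?Q j x then x j else 0) = (if j = ?k then x j else 0)"
        by (simp only: eq_commute[of j])
    qed
    then show ?thesis using k by (simp add: sum.delta)
  qed
  have meas: "(\<lambda>x. if ?Q k x then x k else 0) \<in> borel_measurable (PiM {1..n} (\<lambda>_. P))" if k: "k \<in> {1..n}" for k
    by (rule measurable_If[OF cmp[OF k] borel_measurable_const]) (use Q[OF k] in \<open>simp only: pred_def\<close>)
  have eq': "(\<lambda>x. x (argmax_index f n x)) = (\<lambda>x. \<Sum>k\<in>{1..n}. if ?Q k x then x k else 0)"
    by (rule ext) (rule eq)
  show ?thesis
    unfolding eq' by (rule borel_measurable_sum) (rule meas)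
qed

text \<open>The density of the selected vector with respect to \<open>P\<close> at a point of gauge
  \<open>z\<close>. The k-th summand is the probability that the other n - 1 copies let index
  \<open>k\<close> win: k - 1 of them must stay strictly below \<open>z\<close>, the n - k later
  ones may tie.\<close>

definition max_weight :: "(real ^ 'n) measure \<Rightarrow> nat \<Rightarrow> real \<Rightarrow> real" where
  "max_weight P n z = (\<Sum>k\<in>{1..n}. measure P {x. \<phi> x < z} ^ (k - 1) * measure P {x. \<phi> x \<le> z} ^ (n - k))"

lemma max_weight_nonneg: "0 \<le> max_weight P n z"
  by (simp add: max_weight_def sum_nonneg)

end

section \<open>The exact law of the maximum\<close>

locale gauge_law = homogeneous_gauge f + prob_space P
  for f :: "ereal ^ 'n \<Rightarrow> ennreal" and P :: "(real ^ 'n) measure" +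
  assumes sets_P [measurable_cong, simp]: "sets P = sets borel"
begin

lemma space_P [simp]: "space P = UNIV"
  using sets_eq_imp_space_eq[OF sets_P] by simp

lemma prob_le_mono: "z \<le> z' \<Longrightarrow> prob {x. \<phi> x \<le> z} \<le> prob {x. \<phi> x \<le> z'}"
  by (intro finite_measure_mono) auto

lemma prob_less_le: "prob {x. \<phi> x < z} \<le> prob {x. \<phi> x \<le> z}"
  by (intro finite_measure_mono) auto

lemma prob_le_less: "z < z' \<Longrightarrow> prob {x. \<phi> x \<le> z} \<le> prob {x. \<phi> x < z'}"
  by (intro finite_measure_mono) auto

lemma measurable_prob_gauge [measurable]:
  "(\<lambda>y. prob {x. \<phi> x < \<phi> y}) \<in> borel_measurable borel"
  "(\<lambda>y. prob {x. \<phi> x \<le> \<phi> y}) \<in> borel_measurable borel"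
proof -
  have "(\<lambda>z. prob {x. \<phi> x < z}) \<in> borel_measurable borel" "(\<lambda>z. prob {x. \<phi> x \<le> z}) \<in> borel_measurable borel"
    by (intro borel_measurable_mono; auto simp: mono_def intro!: finite_measure_mono)+
  from this[THEN measurable_compose[OF measurable_\<phi>]]
  show "(\<lambda>y. prob {x. \<phi> x < \<phi> y}) \<in> borel_measurable borel"
    "(\<lambda>y. prob {x. \<phi> x \<le> \<phi> y}) \<in> borel_measurable borel" by auto
qed

lemma measurable_max_weight [measurable]: "(\<lambda>y. max_weight P n (\<phi> y)) \<in> borel_measurable borel"
  unfolding max_weight_def by measurable

text \<open>The sample space is split by the winning index, and for each index the other coordinates
  are integrated out. Exactly one index wins at every sample point, so atoms of the law of the gauge
  cause no double counting.\<close>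

lemma argmax_law_eq_density:
  assumes n: "1 \<le> n"
  shows "distr (PiM {1..n} (\<lambda>_. P)) borel (\<lambda>x. x (argmax_index f n x))
    = density P (\<lambda>y. ennreal (max_weight P n (\<phi> y)))"
proof (rule measure_eqI)
  let ?\<Pi> = "PiM {1..n} (\<lambda>_. P)"
  note marg = measurable_argmax[OF sets_P n]
  interpret PP: finite_product_prob_space "\<lambda>_. P" "{1..n}" by standard simp
  show "sets (distr ?\<Pi> borel (\<lambda>x. x (argmax_index f n x))) = sets (density P (\<lambda>y. ennreal (max_weight P n (\<phi> y))))"
    by simp
  fix A assume "A \<in> sets (distr ?\<Pi> borel (\<lambda>x. x (argmax_index f n x)))"
  then have A [measurable]: "A \<in> sets borel" by simp
  \<comment> \<open>The values allowed to competitor \<open>i\<close> when index \<open>k\<close>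
    wins with the value \<open>y\<close>.\<close>
  define B where "B k i y = {x. if i < k then \<phi> x < \<phi> y else \<phi> x \<le> \<phi> y}" for k i :: nat and y
  have B [measurable]: "B k i y \<in> sets borel" for k i y unfolding B_def by (cases "i < k") auto
  have dec: "indicator A (x (argmax_index f n x)) =
     (\<Sum>k\<in>{1..n}. indicator A (x k) * (\<Prod>i\<in>{1..n} - {k}. indicator (B k i (x k)) (x i)) :: ennreal)" for x
  proof -
    let ?k = "argmax_index f n x"
    have k: "?k \<in> {1..n}" using argmax_index_mem[OF n] .
    have pr: "(\<Prod>i\<in>{1..n} - {j}. indicator (B j i (x j)) (x i)) = (if j = ?k then 1 else 0 :: ennreal)"
      if "j \<in> {1..n}" for j
    proof -
      have "j = ?k \<longleftrightarrow> (\<forall>i\<in>{1..n} - {j}. x i \<in> B j i (x j))"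
        using argmax_index_eq_iff[OF n that, of x] unfolding B_def by (auto cong: if_cong)
      then show ?thesis by (auto simp: indicator_def intro!: prod.neutral)
    qed
    have "(\<Sum>j\<in>{1..n}. indicator A (x j) * (\<Prod>i\<in>{1..n} - {j}. indicator (B j i (x j)) (x i)) :: ennreal)
      = (\<Sum>j\<in>{1..n}. if j = ?k then indicator A (x j) else 0)"
      by (intro sum.cong refl) (simp only: pr, simp)
    then show ?thesis using k by (simp add: sum.delta)
  qed
  have meas: "(\<lambda>x. indicator A (x k) * (\<Prod>i\<in>{1..n} - {k}. indicator (B k i (x k)) (x i)) :: ennreal)
      \<in> borel_measurable ?\<Pi>" if k: "k \<in> {1..n}" for k
  proof (intro borel_measurable_times_ennreal borel_measurable_prod_ennreal)
    have [measurable]: "(\<lambda>x. x k) \<in> ?\<Pi> \<rightarrow>\<^sub>M borel"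
      using measurable_component_singleton[OF k, of "\<lambda>_. P"] measurable_cong_sets[OF refl sets_P] by blast
    show "(\<lambda>x. indicator A (x k)) \<in> borel_measurable ?\<Pi>" by measurable
    fix i assume "i \<in> {1..n} - {k}"
    then have i: "i \<in> {1..n}" by simp
    have [measurable]: "(\<lambda>x. x i) \<in> ?\<Pi> \<rightarrow>\<^sub>M borel"
      using measurable_component_singleton[OF i, of "\<lambda>_. P"] measurable_cong_sets[OF refl sets_P] by blast
    have "(\<lambda>x. indicator (B k i (x k)) (x i) :: ennreal) =
      (\<lambda>x. if (if i < k then \<phi> (x i) < \<phi> (x k) else \<phi> (x i) \<le> \<phi> (x k)) then 1 else 0)"
      by (auto simp: B_def indicator_def)
    moreover have "Measurable.pred ?\<Pi> (\<lambda>x. \<phi> (x i) < \<phi> (x k))" "Measurable.pred ?\<Pi> (\<lambda>x. \<phi> (x i) \<le> \<phi> (x k))"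
      by (intro borel_measurable_pred_less borel_measurable_pred_le measurable_compose[OF _ measurable_\<phi>]; fact)+
    then have "Measurable.pred ?\<Pi> (\<lambda>x. if i < k then \<phi> (x i) < \<phi> (x k) else \<phi> (x i) \<le> \<phi> (x k))"
      by (cases "i < k") (simp_all only: if_True if_False simp_thms)
    ultimately show "(\<lambda>x. indicator (B k i (x k)) (x i) :: ennreal) \<in> borel_measurable ?\<Pi>"
      by (simp only:) (intro measurable_If borel_measurable_const; simp add: pred_def)
  qed
  have inner: "(\<integral>\<^sup>+x. indicator A (x k) * (\<Prod>i\<in>{1..n} - {k}. indicator (B k i (x k)) (x i)) \<partial>?\<Pi>)
     = (\<integral>\<^sup>+y. indicator A y * ennreal (prob {x. \<phi> x < \<phi> y} ^ (k - 1) * prob {x. \<phi> x \<le> \<phi> y} ^ (n - k)) \<partial>P)"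
    if k: "k \<in> {1..n}" for k
  proof -
    let ?I = "{1..n} - {k}"
    have ins: "insert k ?I = {1..n}" using k by auto
    have "(\<integral>\<^sup>+x. indicator A (x k) * (\<Prod>i\<in>?I. indicator (B k i (x k)) (x i)) \<partial>?\<Pi>)
      = (\<integral>\<^sup>+y. (\<integral>\<^sup>+x. indicator A ((x(k := y)) k) *
          (\<Prod>i\<in>?I. indicator (B k i ((x(k := y)) k)) ((x(k := y)) i)) \<partial>PiM ?I (\<lambda>_. P)) \<partial>P)"
      using PP.product_nn_integral_insert_rev[of ?I k "\<lambda>x. indicator A (x k) * (\<Prod>i\<in>?I. indicator (B k i (x k)) (x i))"]
        meas[OF k] unfolding ins by simp
    also have "\<dots> = (\<integral>\<^sup>+y. indicator A y * (\<integral>\<^sup>+x. (\<Prod>i\<in>?I. indicator (B k i y) (x i)) \<partial>PiM ?I (\<lambda>_. P)) \<partial>P)"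
    proof (intro nn_integral_cong)
      fix y
      have "(\<integral>\<^sup>+x. indicator A ((x(k := y)) k) *
          (\<Prod>i\<in>?I. indicator (B k i ((x(k := y)) k)) ((x(k := y)) i)) \<partial>PiM ?I (\<lambda>_. P))
        = (\<integral>\<^sup>+x. indicator A y * (\<Prod>i\<in>?I. indicator (B k i y) (x i)) \<partial>PiM ?I (\<lambda>_. P))"
        by (intro nn_integral_cong arg_cong2[where f="(*)"] prod.cong) auto
      also have "\<dots> = indicator A y * (\<integral>\<^sup>+x. (\<Prod>i\<in>?I. indicator (B k i y) (x i)) \<partial>PiM ?I (\<lambda>_. P))"
        by (intro nn_integral_cmult borel_measurable_prod_ennreal) measurable
      finally show "(\<integral>\<^sup>+x. indicator A ((x(k := y)) k) *
          (\<Prod>i\<in>?I. indicator (B k i ((x(k := y)) k)) ((x(k := y)) i)) \<partial>PiM ?I (\<lambda>_. P))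
        = indicator A y * (\<integral>\<^sup>+x. (\<Prod>i\<in>?I. indicator (B k i y) (x i)) \<partial>PiM ?I (\<lambda>_. P))" .
    qed
    also have "\<dots> = (\<integral>\<^sup>+y. indicator A y * (\<Prod>i\<in>?I. emeasure P (B k i y)) \<partial>P)"
      by (intro nn_integral_cong arg_cong2[where f="(*)"] refl)
        (subst PP.product_nn_integral_prod, auto)
    also have "\<dots> = (\<integral>\<^sup>+y. indicator A y * ennreal (prob {x. \<phi> x < \<phi> y} ^ (k - 1) * prob {x. \<phi> x \<le> \<phi> y} ^ (n - k)) \<partial>P)"
    proof (intro nn_integral_cong arg_cong2[where f="(*)"] refl)
      fix y
      have "(\<Prod>i\<in>?I. emeasure P (B k i y)) = (\<Prod>i\<in>{1..<k} \<union> {k<..n}. ennreal (if i < k then prob {x. \<phi> x < \<phi> y} else prob {x. \<phi> x \<le> \<phi> y}))"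
        by (intro prod.cong) (use k in \<open>auto simp: B_def emeasure_eq_measure\<close>)
      also have "\<dots> = (\<Prod>i\<in>{1..<k}. ennreal (prob {x. \<phi> x < \<phi> y})) * (\<Prod>i\<in>{k<..n}. ennreal (prob {x. \<phi> x \<le> \<phi> y}))"
        by (subst prod.union_disjoint) auto
      also have "\<dots> = ennreal (prob {x. \<phi> x < \<phi> y} ^ (k - 1) * prob {x. \<phi> x \<le> \<phi> y} ^ (n - k))"
        by (simp add: ennreal_power ennreal_mult)
      finally show "(\<Prod>i\<in>?I. emeasure P (B k i y)) = ennreal (prob {x. \<phi> x < \<phi> y} ^ (k - 1) * prob {x. \<phi> x \<le> \<phi> y} ^ (n - k))" .
    qed
    finally show ?thesis .
  qed
  have "emeasure (distr ?\<Pi> borel (\<lambda>x. x (argmax_index f n x))) A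
    = (\<integral>\<^sup>+x. indicator A (x (argmax_index f n x)) \<partial>?\<Pi>)"
    using marg by (simp add: nn_integral_distr flip: nn_integral_indicator)
  also have "\<dots> = (\<Sum>k\<in>{1..n}. \<integral>\<^sup>+x. indicator A (x k) * (\<Prod>i\<in>{1..n} - {k}. indicator (B k i (x k)) (x i)) \<partial>?\<Pi>)"
    by (subst nn_integral_cong[OF dec]) (intro nn_integral_sum meas)
  also have "\<dots> = (\<Sum>k\<in>{1..n}. \<integral>\<^sup>+y. indicator A y * ennreal (prob {x. \<phi> x < \<phi> y} ^ (k - 1) * prob {x. \<phi> x \<le> \<phi> y} ^ (n - k)) \<partial>P)"
    by (intro sum.cong refl inner)
  also have "\<dots> = (\<integral>\<^sup>+y. (\<Sum>k\<in>{1..n}. indicator A y * ennreal (prob {x. \<phi> x < \<phi> y} ^ (k - 1) * prob {x. \<phi> x \<le> \<phi> y} ^ (n - k))) \<partial>P)"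
    by (intro nn_integral_sum[symmetric]) measurable
  also have "\<dots> = (\<integral>\<^sup>+y. ennreal (max_weight P n (\<phi> y)) * indicator A y \<partial>P)"
    by (intro nn_integral_cong)
      (simp add: max_weight_def sum_distrib_left[symmetric] sum_ennreal mult.commute)
  also have "\<dots> = emeasure (density P (\<lambda>y. ennreal (max_weight P n (\<phi> y)))) A"
    by (subst emeasure_density) auto
  finally show "emeasure (distr ?\<Pi> borel (\<lambda>x. x (argmax_index f n x))) A
     = emeasure (density P (\<lambda>y. ennreal (max_weight P n (\<phi> y)))) A" .
qed

lemma implicit_max_law_eq:
  assumes n: "1 \<le> n"
  shows "implicit_max_law f n c P = distr (density P (\<lambda>y. ennreal (max_weight P n (\<phi> y)))) borel (\<lambda>y. y /\<^sub>R c)"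
  unfolding argmax_law_eq_density[OF n, symmetric] implicit_max_law_def
  by (subst distr_distr[OF borel_measurable_scaleR[OF borel_measurable_const measurable_ident_sets[OF refl]] measurable_argmax[OF sets_P n]])
    (simp add: comp_def)

lemma prob_space_implicit_max_law:
  assumes n: "1 \<le> n"
  shows "prob_space (implicit_max_law f n c P)"
proof -
  interpret PP: finite_product_prob_space "\<lambda>_. P" "{1..n}" by standard simp
  show ?thesis unfolding implicit_max_law_def
    by (intro PP.prob_space_distr borel_measurable_scaleR[OF borel_measurable_const measurable_argmax[OF sets_P n]])
qed

lemma integral_implicit_max_law:
  fixes h :: "real ^ 'n \<Rightarrow> real"
  assumes n: "1 \<le> n" and h [measurable]: "h \<in> borel_measurable borel"
  shows "integral\<^sup>L (implicit_max_law f n c P) h = (\<integral>y. max_weight P n (\<phi> y) * h (y /\<^sub>R c) \<partial>P)"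
proof -
  have "integral\<^sup>L (implicit_max_law f n c P) h
      = (\<integral>y. h (y /\<^sub>R c) \<partial>density P (\<lambda>y. ennreal (max_weight P n (\<phi> y))))"
    unfolding implicit_max_law_eq[OF n] by (rule integral_distr) (simp_all add: h)
  also have "\<dots> = (\<integral>y. max_weight P n (\<phi> y) *\<^sub>R h (y /\<^sub>R c) \<partial>P)"
    by (rule integral_density) (simp_all add: max_weight_nonneg)
  finally show ?thesis by simp
qed

text \<open>The gauge of the selected vector is the maximum of the gauges, so independence gives a
  pure power. This closed form links the problem to one-dimensional extreme value theory and later
  supplies the mass of the limit law.\<close>

lemma measure_implicit_max_law_le:
  assumes n: "1 \<le> n" and c: "0 < c"
  shows "measure (implicit_max_law f n c P) {x. \<phi> x \<le> z} = prob {x. \<phi> x \<le> c * z} ^ n"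
proof -
  interpret PP: finite_product_prob_space "\<lambda>_. P" "{1..n}" by standard simp
  note marg = measurable_argmax[OF sets_P n]
  have sc: "\<phi> (x /\<^sub>R c) \<le> z \<longleftrightarrow> \<phi> x \<le> c * z" for x
    by (subst \<phi>_divide[OF c]) (use c in \<open>simp add: field_simps\<close>)
  have "measure (implicit_max_law f n c P) {x. \<phi> x \<le> z}
     = measure (PiM {1..n} (\<lambda>_. P)) {x\<in>space (PiM {1..n} (\<lambda>_. P)). \<phi> (x (argmax_index f n x) /\<^sub>R c) \<le> z}"
    unfolding implicit_max_law_def
    by (subst measure_distr[OF borel_measurable_scaleR[OF borel_measurable_const marg]])
      (auto simp: vimage_def Int_def conj_commute)
  also have "{x\<in>space (PiM {1..n} (\<lambda>_. P)). \<phi> (x (argmax_index f n x) /\<^sub>R c) \<le> z} = PiE {1..n} (\<lambda>_. {x. \<phi> x \<le> c * z})"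
    unfolding sc \<phi>_argmax_le_iff[OF n] by (auto simp: space_PiM PiE_iff extensional_def)
  also have "measure (PiM {1..n} (\<lambda>_. P)) \<dots> = prob {x. \<phi> x \<le> c * z} ^ n"
    by (subst PP.finite_measure_PiM_emb) auto
  finally show ?thesis .
qed

end

section \<open>Test functions supported off the zero set of the gauge\<close>

definition clamp01 :: "real \<Rightarrow> real" where "clamp01 t = max 0 (min 1 t)"

lemma clamp01_simps [simp]:
  "0 \<le> clamp01 t" "clamp01 t \<le> 1" "t \<le> 0 \<Longrightarrow> clamp01 t = 0" "1 \<le> t \<Longrightarrow> clamp01 t = 1"
  by (auto simp: clamp01_def)

lemma continuous_on_clamp01 [continuous_intros]:
  "continuous_on S g \<Longrightarrow> continuous_on S (\<lambda>x. clamp01 (g x))"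
  unfolding clamp01_def by (intro continuous_intros)

context homogeneous_gauge
begin

text \<open>The class \<open>bs\<close> contains the restrictions to \<open>\<real>\<^sup>d\<close> of the test functions on the
  compactification; the smaller class \<open>cc\<close> determines measures on \<open>\<phi> > 0\<close>.\<close>

definition bs :: "(real ^ 'n \<Rightarrow> real) set" where
  "bs = {h. continuous_on UNIV h \<and> bounded (range h) \<and> (\<exists>\<epsilon>>0. \<forall>x. h x \<noteq> 0 \<longrightarrow> \<epsilon> \<le> \<phi> x)}"

definition cc :: "(real ^ 'n \<Rightarrow> real) set" where
  "cc = {h. continuous_on UNIV h \<and> (\<exists>K. compact K \<and> K \<subseteq> {x. 0 < \<phi> x} \<and> (\<forall>x. x \<notin> K \<longrightarrow> h x = 0))}"

lemma ccI:
  "continuous_on UNIV h \<Longrightarrow> compact K \<Longrightarrow> K \<subseteq> {x. 0 < \<phi> x} \<Longrightarrow> (\<And>x. x \<notin> K \<Longrightarrow> h x = 0) \<Longrightarrow> h \<in> cc"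
  unfolding cc_def by blast

lemma bs_bound: "h \<in> bs \<Longrightarrow> \<exists>B>0. \<forall>x. \<bar>h x\<bar> \<le> B"
  unfolding bs_def bounded_pos by auto

lemma bs_measurable: "h \<in> bs \<Longrightarrow> h \<in> borel_measurable borel"
  unfolding bs_def by (auto intro: borel_measurable_continuous_onI)

lemma open_\<phi>_pos: "open {x. 0 < \<phi> x}"
  by (intro open_Collect_less continuous_intros continuous_\<phi>)

lemma closed_\<phi>_ge: "closed {x. \<epsilon> \<le> \<phi> x}"
  by (intro closed_Collect_le continuous_intros continuous_\<phi>)

lemma cc_subset_bs: "cc \<subseteq> bs"
proof
  fix h assume "h \<in> cc"
  then obtain K where h: "continuous_on UNIV h" and K: "compact K" "K \<subseteq> {x. 0 < \<phi> x}" "\<And>x. x \<notin> K \<Longrightarrow> h x = 0"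
    unfolding cc_def by auto
  show "h \<in> bs"
  proof (cases "K = {}")
    case True
    then have "h = (\<lambda>_. 0)" using K by auto
    then show ?thesis by (auto simp: bs_def intro!: exI[of _ 1])
  next
    case False
    obtain x0 where x0: "x0 \<in> K" "\<And>y. y \<in> K \<Longrightarrow> \<phi> x0 \<le> \<phi> y"
      using continuous_attains_inf[OF K(1) False continuous_\<phi>] by blast
    have "bounded (h ` K)"
      by (intro compact_imp_bounded compact_continuous_image K continuous_on_subset[OF h]) auto
    then have "bounded (insert 0 (h ` K))" by simp
    then have "bounded (range h)" by (rule bounded_subset) (use K in auto)
    moreover have "\<forall>x. h x \<noteq> 0 \<longrightarrow> \<phi> x0 \<le> \<phi> x" using x0 K by blast
    moreover have "0 < \<phi> x0" using x0 K by auto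
    ultimately show ?thesis using h by (auto simp: bs_def)
  qed
qed

lemma bs_abs: "h \<in> bs \<Longrightarrow> (\<lambda>x. \<bar>h x\<bar>) \<in> bs"
  unfolding bs_def bounded_pos by (auto intro: continuous_intros)

lemma cc_abs: "h \<in> cc \<Longrightarrow> (\<lambda>x. \<bar>h x\<bar>) \<in> cc"
  unfolding cc_def by (auto intro: continuous_intros)

text \<open>The factor \<open>g\<close>, for instance a reciprocal Frechet weight, may explode as
  \<phi> tends to 0. Two open sets cover the space: \<phi> > 0, where both factors are continuous,
  and the complement of \<open>C\<close>, where the product is 0.\<close>

lemma continuous_on_vanishing_mult:
  fixes h g :: "real ^ 'n \<Rightarrow> real"
  assumes h: "continuous_on UNIV h" and C: "closed C" "C \<subseteq> {x. 0 < \<phi> x}" "\<And>x. x \<notin> C \<Longrightarrow> h x = 0"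
    and g: "continuous_on {x. 0 < \<phi> x} g"
  shows "continuous_on UNIV (\<lambda>x. h x * g x)"
proof -
  have 1: "continuous_on {x. 0 < \<phi> x} (\<lambda>x. h x * g x)"
    by (intro continuous_intros g continuous_on_subset[OF h]) auto
  have 2: "continuous_on (- C) (\<lambda>x. h x * g x)"
    by (rule continuous_on_eq[of _ "\<lambda>_. 0"]) (auto simp: C)
  have "continuous_on ({x. 0 < \<phi> x} \<union> - C) (\<lambda>x. h x * g x)"
    using C by (intro continuous_on_open_Un 1 2 open_\<phi>_pos) (auto simp: open_closed)
  moreover have "{x. 0 < \<phi> x} \<union> - C = UNIV" using C by auto
  ultimately show ?thesis by simp
qed

lemma cc_mult:
  assumes "h \<in> cc" and g: "continuous_on {x. 0 < \<phi> x} g"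
  shows "(\<lambda>x. h x * g x) \<in> cc"
proof -
  obtain K where h: "continuous_on UNIV h" and K: "compact K" "K \<subseteq> {x. 0 < \<phi> x}" "\<And>x. x \<notin> K \<Longrightarrow> h x = 0"
    using assms(1) unfolding cc_def by auto
  have "continuous_on UNIV (\<lambda>x. h x * g x)"
    by (rule continuous_on_vanishing_mult[OF h compact_imp_closed[OF K(1)] K(2,3) g])
  with K show ?thesis unfolding cc_def by auto
qed

lemma bs_mult:
  assumes "h \<in> bs" and g: "continuous_on {x. 0 < \<phi> x} g"
    and b: "\<And>\<epsilon>. 0 < \<epsilon> \<Longrightarrow> \<exists>B>0. \<forall>x. \<epsilon> \<le> \<phi> x \<longrightarrow> \<bar>g x\<bar> \<le> B"
  shows "(\<lambda>x. h x * g x) \<in> bs"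
proof -
  obtain \<epsilon> where h: "continuous_on UNIV h" and \<epsilon>: "0 < \<epsilon>" "\<And>x. h x \<noteq> 0 \<Longrightarrow> \<epsilon> \<le> \<phi> x"
    using assms(1) unfolding bs_def by auto
  obtain A where A: "0 < A" "\<And>x. \<bar>h x\<bar> \<le> A" using bs_bound[OF assms(1)] by auto
  obtain B where B: "0 < B" "\<And>x. \<epsilon> \<le> \<phi> x \<Longrightarrow> \<bar>g x\<bar> \<le> B" using b[OF \<epsilon>(1)] by auto
  have "continuous_on UNIV (\<lambda>x. h x * g x)"
    by (rule continuous_on_vanishing_mult[OF h closed_\<phi>_ge[of \<epsilon>] _ _ g]) (use \<epsilon> in auto)
  moreover have "\<bar>h x * g x\<bar> \<le> A * B" for x
  proof (cases "h x = 0")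
    case False
    then show ?thesis unfolding abs_mult by (intro mult_mono A B \<epsilon>) (use A in auto)
  qed (use A B in auto)
  then have "bounded (range (\<lambda>x. h x * g x))" unfolding bounded_iff by auto
  ultimately show ?thesis using \<epsilon> unfolding bs_def by (auto intro!: exI[of _ \<epsilon>])
qed

lemma cc_bump:
  assumes "0 < \<epsilon>"
  obtains \<psi> where "\<psi> \<in> cc" "\<And>x. 0 \<le> \<psi> x" "\<And>x. \<psi> x \<le> 1" "\<And>x. \<epsilon> \<le> \<phi> x \<Longrightarrow> norm x \<le> R \<Longrightarrow> \<psi> x = 1"
proof
  let ?\<psi> = "\<lambda>x. clamp01 (2 * \<phi> x / \<epsilon> - 1) * clamp01 (R + 1 - norm x)"
  \<comment> \<open>The first factor rises from 0 to 1 between the levels \<epsilon> / 2 and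
    \<epsilon> of \<phi>, the second falls from 1 to 0 between the norms R and R + 1.\<close>
  let ?K = "{x. \<epsilon> / 2 \<le> \<phi> x} \<inter> cball 0 (R + 1)"
  have K: "compact ?K" by (intro closed_Int_compact closed_\<phi>_ge compact_cball)
  have "?\<psi> x = 0" if "x \<notin> ?K" for x
  proof (cases "\<epsilon> / 2 \<le> \<phi> x")
    case True
    then have "clamp01 (R + 1 - norm x) = 0" using that by (intro clamp01_simps) auto
    then show ?thesis by simp
  next
    case False
    then have "clamp01 (2 * \<phi> x / \<epsilon> - 1) = 0" using assms by (intro clamp01_simps) (simp add: field_simps)
    then show ?thesis by simp
  qed
  moreover have "continuous_on UNIV ?\<psi>" using assms by (intro continuous_intros continuous_\<phi>) auto
  moreover have "?K \<subseteq> {x. 0 < \<phi> x}" using assms by auto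
  ultimately show "?\<psi> \<in> cc" using K by (intro ccI)
  show "0 \<le> ?\<psi> x" "?\<psi> x \<le> 1" for x by (auto intro: mult_le_one)
  show "?\<psi> x = 1" if "\<epsilon> \<le> \<phi> x" "norm x \<le> R" for x
  proof -
    have "clamp01 (2 * \<phi> x / \<epsilon> - 1) = 1" using assms that by (intro clamp01_simps) (simp add: field_simps)
    moreover have "clamp01 (R + 1 - norm x) = 1" using that by (intro clamp01_simps) auto
    ultimately show ?thesis by simp
  qed
qed

lemma cc_scale:
  assumes "h \<in> cc" "0 < r"
  shows "(\<lambda>x. h (x /\<^sub>R r)) \<in> cc"
proof -
  obtain K where h: "continuous_on UNIV h" and K: "compact K" "K \<subseteq> {x. 0 < \<phi> x}" "\<And>x. x \<notin> K \<Longrightarrow> h x = 0"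
    using assms(1) unfolding cc_def by auto
  have "continuous_on UNIV (\<lambda>x. h (x /\<^sub>R r))"
    by (rule continuous_on_compose2[OF h]) (auto intro: continuous_intros)
  moreover have "compact ((\<lambda>x. r *\<^sub>R x) ` K)" by (intro compact_scaling K)
  moreover have "(\<lambda>x. r *\<^sub>R x) ` K \<subseteq> {x. 0 < \<phi> x}" using K(2) assms(2) by (auto simp: \<phi>_scale)
  moreover have "h (x /\<^sub>R r) = 0" if "x \<notin> (\<lambda>x. r *\<^sub>R x) ` K" for x
  proof (rule K(3))
    show "x /\<^sub>R r \<notin> K"
    proof
      assume "x /\<^sub>R r \<in> K"
      then have "r *\<^sub>R (x /\<^sub>R r) \<in> (\<lambda>x. r *\<^sub>R x) ` K" by blast
      then show False using that assms(2) by simp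
    qed
  qed
  ultimately show ?thesis unfolding cc_def by blast
qed

text \<open>The measures n P(X / a n \<in> .) have unbounded total mass, so uniform closeness of h(x
  / r) and h(x / \<rho>) would not make their integrals close. The error has to be dominated by a
  small multiple of one fixed function in \<open>cc\<close>, whose integrals stay bounded. Uniform
  continuity on a compact set of pairs (r, x) provides this.\<close>

lemma cc_scale_uniform:
  assumes "h \<in> cc" "0 < \<rho>"
  obtains \<psi> where "\<psi> \<in> cc" "\<And>x. 0 \<le> \<psi> x"
    "\<And>e. 0 < e \<Longrightarrow> \<exists>d>0. \<forall>r. \<bar>r - \<rho>\<bar> < d \<longrightarrow> (\<forall>x. \<bar>h (x /\<^sub>R r) - h (x /\<^sub>R \<rho>)\<bar> \<le> e * \<psi> x)"
proof -
  obtain K where h: "continuous_on UNIV h" and K: "compact K" "K \<subseteq> {x. 0 < \<phi> x}" "\<And>x. x \<notin> K \<Longrightarrow> h x = 0"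
    using assms(1) unfolding cc_def by auto
  obtain \<epsilon> where \<epsilon>: "0 < \<epsilon>" "\<And>x. h x \<noteq> 0 \<Longrightarrow> \<epsilon> \<le> \<phi> x"
    using assms(1) cc_subset_bs unfolding bs_def by blast
  obtain R where R: "0 < R" "\<And>x. x \<in> K \<Longrightarrow> norm x \<le> R" using compact_imp_bounded[OF K(1)] unfolding bounded_pos by auto
  let ?R = "2 * \<rho> * R"
  \<comment> \<open>While r stays in this interval, all points x with h(x / r) nonzero lie in one
    region: \<phi> x is at least \<epsilon> \<rho> / 2 and the norm at most 2 \<rho> R.\<close>
  let ?I = "{\<rho> / 2..2 * \<rho>}"
  have supp: "\<epsilon> * \<rho> / 2 \<le> \<phi> x \<and> norm x \<le> ?R" if "r \<in> ?I" "h (x /\<^sub>R r) \<noteq> 0" for r x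
  proof -
    have r: "0 < r" using that assms(2) by auto
    have "\<epsilon> \<le> \<phi> x / r" using \<epsilon>(2)[OF that(2)] \<phi>_divide[OF r] by simp
    then have "\<epsilon> * r \<le> \<phi> x" using r by (simp add: field_simps)
    moreover have "\<epsilon> * (\<rho> / 2) \<le> \<epsilon> * r" using that \<epsilon> by (intro mult_left_mono) auto
    moreover have "norm (x /\<^sub>R r) \<le> R" using K(3) R(2) that(2) by blast
    then have "norm x \<le> r * R" using r by (simp add: field_simps)
    moreover have "r * R \<le> ?R" using that R by (intro mult_right_mono) auto
    ultimately show ?thesis by simp
  qed
  have "0 < \<epsilon> * \<rho> / 2" using \<epsilon> assms by simp
  then obtain \<psi> where \<psi>: "\<psi> \<in> cc" "\<And>x. 0 \<le> \<psi> x" "\<And>x. \<epsilon> * \<rho> / 2 \<le> \<phi> x \<Longrightarrow> norm x \<le> ?R \<Longrightarrow> \<psi> x = 1"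
    using cc_bump[of "\<epsilon> * \<rho> / 2" ?R] by metis
  have "continuous_on (?I \<times> cball 0 ?R) (\<lambda>p. h (snd p /\<^sub>R fst p))"
    by (rule continuous_on_compose2[OF h]) (use assms in \<open>auto intro!: continuous_intros\<close>)
  then have uc: "uniformly_continuous_on (?I \<times> cball 0 ?R) (\<lambda>p. h (snd p /\<^sub>R fst p))"
    by (intro compact_uniformly_continuous compact_Times) auto
  show ?thesis
  proof (rule that[OF \<psi>(1,2)])
    fix e :: real assume e: "0 < e"
    obtain d where d: "0 < d" "\<And>p q. p \<in> ?I \<times> cball 0 ?R \<Longrightarrow> q \<in> ?I \<times> cball 0 ?R \<Longrightarrow> dist q p < d \<Longrightarrow>
        dist (h (snd q /\<^sub>R fst q)) (h (snd p /\<^sub>R fst p)) < e"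
      using uc e unfolding uniformly_continuous_on_def by metis
    show "\<exists>d>0. \<forall>r. \<bar>r - \<rho>\<bar> < d \<longrightarrow> (\<forall>x. \<bar>h (x /\<^sub>R r) - h (x /\<^sub>R \<rho>)\<bar> \<le> e * \<psi> x)"
    proof (intro exI[of _ "min d (\<rho> / 2)"] conjI allI impI)
      show "0 < min d (\<rho> / 2)" using d assms by simp
      fix r x assume r: "\<bar>r - \<rho>\<bar> < min d (\<rho> / 2)"
      have "\<bar>r - \<rho>\<bar> < \<rho> / 2" using r by simp
      then have rI: "r \<in> ?I" "\<rho> \<in> ?I" using assms(2) unfolding abs_less_iff by auto
      show "\<bar>h (x /\<^sub>R r) - h (x /\<^sub>R \<rho>)\<bar> \<le> e * \<psi> x"
      proof (cases "h (x /\<^sub>R r) = 0 \<and> h (x /\<^sub>R \<rho>) = 0")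
        case True
        then show ?thesis using e \<psi>(2)[of x] by simp
      next
        case False
        then have s: "\<epsilon> * \<rho> / 2 \<le> \<phi> x" "norm x \<le> ?R" using supp[of r x] supp[of \<rho> x] rI by auto
        have "dist (h (x /\<^sub>R r)) (h (x /\<^sub>R \<rho>)) < e"
          using d(2)[of "(\<rho>, x)" "(r, x)"] rI s r by (simp add: dist_Pair_Pair dist_real_def)
        then show ?thesis using \<psi>(3)[OF s] by (simp add: dist_real_def)
      qed
    qed
  qed
qed

lemma cc_exhaustion:
  obtains \<psi> where "\<And>m. \<psi> m \<in> cc" "\<And>m x. 0 \<le> \<psi> m x" "\<And>m x. \<psi> m x \<le> 1"
    "\<And>x. 0 < \<phi> x \<Longrightarrow> (\<lambda>m. \<psi> m x) \<longlonglongrightarrow> 1"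
proof -
  have "\<forall>m. \<exists>\<psi>. \<psi> \<in> cc \<and> (\<forall>x. 0 \<le> \<psi> x \<and> \<psi> x \<le> 1) \<and> (\<forall>x. 1 / real (Suc m) \<le> \<phi> x \<longrightarrow> norm x \<le> real m \<longrightarrow> \<psi> x = 1)"
  proof
    fix m show "\<exists>\<psi>. \<psi> \<in> cc \<and> (\<forall>x. 0 \<le> \<psi> x \<and> \<psi> x \<le> 1) \<and> (\<forall>x. 1 / real (Suc m) \<le> \<phi> x \<longrightarrow> norm x \<le> real m \<longrightarrow> \<psi> x = 1)"
      using cc_bump[of "1 / real (Suc m)" "real m"] by (metis of_nat_0_less_iff zero_less_Suc zero_less_divide_1_iff)
  qed
  then obtain \<psi> where \<psi>: "\<And>m. \<psi> m \<in> cc" "\<And>m x. 0 \<le> \<psi> m x" "\<And>m x. \<psi> m x \<le> 1"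
    "\<And>m x. 1 / real (Suc m) \<le> \<phi> x \<Longrightarrow> norm x \<le> real m \<Longrightarrow> \<psi> m x = 1" by metis
  show ?thesis
  proof (rule that[OF \<psi>(1-3)])
    fix x assume x: "0 < \<phi> x"
    obtain m0 where m0: "1 / real (Suc m0) < \<phi> x" using x nat_approx_posE by blast
    obtain m1 where m1: "norm x \<le> real m1" using real_arch_simple by blast
    show "(\<lambda>m. \<psi> m x) \<longlonglongrightarrow> 1"
    proof (rule tendsto_eventually, rule eventually_sequentiallyI[of "max m0 m1"])
      fix m assume m: "max m0 m1 \<le> m"
      have "1 / real (Suc m) \<le> 1 / real (Suc m0)" using m by (intro divide_left_mono) auto
      then show "\<psi> m x = 1" using m0 m1 m by (intro \<psi>(4)) auto
    qed
  qed
qed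

text \<open>Because the limit has mass one on \<phi> > 0, no mass can escape: some
  \<open>\<psi> m\<close> in \<open>cc\<close> captures nearly all of \<open>Q\<close>, and
  convergence of its integrals makes it capture nearly all of \<open>P n\<close> for large n.
  Cutting \<open>g\<close> off by \<open>\<psi> m\<close> therefore costs little on either
  side.\<close>

lemma weak_conv_vec_ccI:
  fixes Q :: "(real ^ 'n) measure"
  assumes P: "eventually (\<lambda>n. prob_space (P n)) sequentially" "\<And>n. sets (P n) = sets borel"
    and Q: "prob_space Q" "sets Q = sets borel" "AE x in Q. 0 < \<phi> x"
    and lim: "\<And>h. h \<in> cc \<Longrightarrow> (\<lambda>n. integral\<^sup>L (P n) h) \<longlonglongrightarrow> integral\<^sup>L Q h"
  shows "weak_conv_vec P Q"
  unfolding weak_conv_vec_def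
proof (intro allI impI)
  fix g :: "real ^ 'n \<Rightarrow> real" assume "continuous_on UNIV g \<and> bounded (range g)"
  then have g: "continuous_on UNIV g" and "bounded (range g)" by auto
  then obtain B where B: "0 < B" "\<And>x. \<bar>g x\<bar> \<le> B" unfolding bounded_pos by auto
  interpret Q: prob_space Q by fact
  have gm: "g \<in> borel_measurable borel" by (intro borel_measurable_continuous_onI g)
  obtain \<psi> where \<psi>: "\<And>m. \<psi> m \<in> cc" "\<And>m x. 0 \<le> \<psi> m x" "\<And>m x. \<psi> m x \<le> 1"
    "\<And>x. 0 < \<phi> x \<Longrightarrow> (\<lambda>m. \<psi> m x) \<longlonglongrightarrow> 1" using cc_exhaustion by metis
  have \<psi>m: "\<psi> m \<in> borel_measurable borel" for m using \<psi>(1) cc_subset_bs bs_measurable by blast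
  have est: "\<bar>integral\<^sup>L M g - integral\<^sup>L M (\<lambda>x. \<psi> m x * g x)\<bar> \<le> B * (1 - integral\<^sup>L M (\<psi> m))"
    if "prob_space M" and [measurable_cong]: "sets M = sets borel" for M m
  proof -
    interpret M: prob_space M by fact
    note [measurable] = gm \<psi>m
    have ig: "integrable M g" by (rule M.integrable_const_bound[of _ B]) (auto simp: B)
    have ix: "integrable M (\<psi> m)" by (rule M.integrable_const_bound[of _ 1]) (auto simp: \<psi>)
    have ixg: "integrable M (\<lambda>x. \<psi> m x * g x)"
    proof (rule M.integrable_const_bound[of _ B], rule AE_I2)
      fix x show "norm (\<psi> m x * g x) \<le> B"
        using mult_mono[of "\<psi> m x" 1 "\<bar>g x\<bar>" B] \<psi> B by (simp add: abs_mult)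
    qed measurable
    have "\<bar>integral\<^sup>L M g - integral\<^sup>L M (\<lambda>x. \<psi> m x * g x)\<bar> = \<bar>\<integral>x. (1 - \<psi> m x) * g x \<partial>M\<bar>"
      by (subst Bochner_Integration.integral_diff[symmetric, OF ig ixg]) (simp add: algebra_simps)
    also have "\<dots> \<le> (\<integral>x. \<bar>(1 - \<psi> m x) * g x\<bar> \<partial>M)" by (rule integral_abs_bound)
    also have "\<dots> \<le> (\<integral>x. B * (1 - \<psi> m x) \<partial>M)"
    proof (rule integral_mono)
      have "integrable M (\<lambda>x. g x - \<psi> m x * g x)" using ig ixg by simp
      then show "integrable M (\<lambda>x. \<bar>(1 - \<psi> m x) * g x\<bar>)" by (intro integrable_abs) (simp add: algebra_simps)
      show "integrable M (\<lambda>x. B * (1 - \<psi> m x))" using ix by simp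
      show "\<bar>(1 - \<psi> m x) * g x\<bar> \<le> B * (1 - \<psi> m x)" for x
        using mult_left_mono[OF B(2)[of x], of "1 - \<psi> m x"] \<psi>(3)[of m x] by (simp add: abs_mult mult.commute)
    qed
    also have "\<dots> = B * (1 - integral\<^sup>L M (\<psi> m))" using ix by (simp add: M.prob_space)
    finally show ?thesis .
  qed
  have "(\<lambda>m. integral\<^sup>L Q (\<psi> m)) \<longlonglongrightarrow> (\<integral>x. 1 \<partial>Q)"
  proof (rule integral_dominated_convergence[of _ _ _ "\<lambda>_. 1"])
    show "AE x in Q. (\<lambda>m. \<psi> m x) \<longlonglongrightarrow> 1" using Q(3)
      by eventually_elim (rule \<psi>(4))
    show "\<And>m. \<psi> m \<in> borel_measurable Q" using \<psi>m measurable_cong_sets[OF Q(2) refl] by blast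
  qed (use \<psi> in auto)
  then have Qlim: "(\<lambda>m. integral\<^sup>L Q (\<psi> m)) \<longlonglongrightarrow> 1" by (simp add: Q.prob_space)
  show "(\<lambda>n. integral\<^sup>L (P n) g) \<longlonglongrightarrow> integral\<^sup>L Q g"
  proof (rule tendstoI)
    fix e :: real assume e: "0 < e"
    have "eventually (\<lambda>m. dist (integral\<^sup>L Q (\<psi> m)) 1 < e / (4 * B)) sequentially"
      using e B by (intro tendstoD[OF Qlim]) auto
    then obtain m where m: "\<bar>integral\<^sup>L Q (\<psi> m) - 1\<bar> < e / (4 * B)"
      unfolding eventually_sequentially dist_real_def by blast
    have m': "B * (1 - integral\<^sup>L Q (\<psi> m)) < e / 4"
    proof -
      have "1 - integral\<^sup>L Q (\<psi> m) < e / (4 * B)" using m by (simp add: abs_less_iff)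
      then show ?thesis using B by (simp add: field_simps)
    qed
    have "(\<lambda>x. \<psi> m x * g x) \<in> cc" by (intro cc_mult \<psi> continuous_on_subset[OF g]) auto
    then have 1: "eventually (\<lambda>n. dist (integral\<^sup>L (P n) (\<lambda>x. \<psi> m x * g x)) (integral\<^sup>L Q (\<lambda>x. \<psi> m x * g x)) < e / 4) sequentially"
      using e by (intro tendstoD lim) auto
    have 2: "eventually (\<lambda>n. B * (1 - integral\<^sup>L (P n) (\<psi> m)) < e / 4) sequentially"
      using order_tendstoD(2)[OF tendsto_mult[OF tendsto_const[of B] tendsto_diff[OF tendsto_const[of 1] lim[OF \<psi>(1)[of m]]]] m'] by simp
    show "eventually (\<lambda>n. dist (integral\<^sup>L (P n) g) (integral\<^sup>L Q g) < e) sequentially"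
      using 1 2 P(1)
    proof eventually_elim
      case (elim n)
      have "\<bar>integral\<^sup>L (P n) g - integral\<^sup>L (P n) (\<lambda>x. \<psi> m x * g x)\<bar> < e / 4"
        using est[OF elim(3) P(2), of m] elim(2) by linarith
      moreover have "\<bar>integral\<^sup>L Q g - integral\<^sup>L Q (\<lambda>x. \<psi> m x * g x)\<bar> < e / 4"
        using est[OF Q(1,2), of m] m' by linarith
      ultimately show ?case using elim(1) e unfolding dist_real_def by linarith
    qed
  qed
qed

end

text \<open>Indicators of closed sets are pointwise limits of truncated distance functions, and the
  closed sets form an intersection-stable generator of the Borel sets.\<close>

lemma prob_space_eqI_bounded_continuous:
  fixes P Q :: "'b::metric_space measure"
  assumes P: "prob_space P" "sets P = sets borel" and Q: "prob_space Q" "sets Q = sets borel"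
    and eq: "\<And>g::'b \<Rightarrow> real. continuous_on UNIV g \<Longrightarrow> bounded (range g) \<Longrightarrow> integral\<^sup>L P g = integral\<^sup>L Q g"
  shows "P = Q"
proof -
  interpret P: prob_space P by fact
  interpret Q: prob_space Q by fact
  have closed_eq: "emeasure P C = emeasure Q C" if C: "closed C" for C
  proof (cases "C = {}")
    case False
    define g where "g m x = clamp01 (1 - real m * infdist x C)" for m x
    have gc: "continuous_on UNIV (g m)" for m unfolding g_def by (intro continuous_intros)
    have gm: "g m \<in> borel_measurable borel" for m by (intro borel_measurable_continuous_onI gc)
    have gb: "bounded (range (g m))" for m
      unfolding bounded_iff g_def by (rule exI[of _ 1]) auto
    have glim: "(\<lambda>m. g m x) \<longlonglongrightarrow> indicator C x" for x
    proof (cases "x \<in> C")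
      case True then show ?thesis by (simp add: g_def)
    next
      case False
      then have "0 < infdist x C" using \<open>C \<noteq> {}\<close> C by (metis in_closed_iff_infdist_zero infdist_nonneg less_eq_real_def)
      then obtain m0 where m0: "1 / infdist x C < real m0" using reals_Archimedean2 by blast
      have "g m x = 0" if "m0 \<le> m" for m
      proof -
        have "1 / infdist x C \<le> real m" using m0 that by linarith
        then have "1 \<le> real m * infdist x C" using \<open>0 < infdist x C\<close> by (simp add: field_simps)
        then show ?thesis by (simp add: g_def)
      qed
      then show ?thesis using False by (intro tendsto_eventually eventually_sequentiallyI[of m0]) auto
    qed
    have lim: "(\<lambda>m. integral\<^sup>L M (g m)) \<longlonglongrightarrow> measure M C" if "prob_space M" "sets M = sets borel" for M
    proof -
      interpret M: prob_space M by fact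
      have "(\<lambda>m. integral\<^sup>L M (g m)) \<longlonglongrightarrow> integral\<^sup>L M (indicator C)"
      proof (rule integral_dominated_convergence[of _ _ _ "\<lambda>_. 1"])
        show "\<And>m. g m \<in> borel_measurable M" using gm measurable_cong_sets[OF that(2) refl] by blast
        show "(indicator C :: _ \<Rightarrow> real) \<in> borel_measurable M"
          using C that by (intro borel_measurable_indicator) auto
      qed (use C that glim in \<open>auto simp: g_def\<close>)
      then show ?thesis using C that by simp
    qed
    have "measure P C = measure Q C"
      using LIMSEQ_unique[OF lim[OF P] lim[OF Q, folded eq[OF gc gb]]] .
    then show ?thesis by (simp add: P.emeasure_eq_measure Q.emeasure_eq_measure)
  qed simp
  show ?thesis
  proof (rule measure_eqI_generator_eq[where E="{C. closed C}" and \<Omega>=UNIV and A="\<lambda>_. UNIV"])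
    show "Int_stable {C::'b set. closed C}" by (auto simp: Int_stable_def)
    show "sets P = sigma_sets UNIV {C. closed C}" "sets Q = sigma_sets UNIV {C. closed C}"
      using P(2) Q(2) unfolding borel_eq_closed by (auto simp: borel_eq_closed)
  qed (use closed_eq in auto)
qed

context homogeneous_gauge
begin

text \<open>A constant sequence turns the convergence criterion into a uniqueness criterion. Only
  \<open>Q\<close> is assumed to live on \<phi> > 0; for \<open>P\<close> this follows.\<close>

lemma prob_space_eqI_cc:
  fixes P Q :: "(real ^ 'n) measure"
  assumes P: "prob_space P" "sets P = sets borel" and Q: "prob_space Q" "sets Q = sets borel" "AE x in Q. 0 < \<phi> x"
    and eq: "\<And>h. h \<in> cc \<Longrightarrow> integral\<^sup>L P h = integral\<^sup>L Q h"
  shows "P = Q"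
proof (rule prob_space_eqI_bounded_continuous[OF P Q(1,2)])
  fix g :: "real ^ 'n \<Rightarrow> real" assume g: "continuous_on UNIV g" "bounded (range g)"
  have "weak_conv_vec (\<lambda>_. P) Q"
    by (rule weak_conv_vec_ccI[OF _ _ Q]) (auto simp: P eq)
  then show "integral\<^sup>L P g = integral\<^sup>L Q g"
    using g unfolding weak_conv_vec_def by (auto dest: LIMSEQ_unique[OF tendsto_const])
qed

text \<open>A portmanteau argument with piecewise linear functions of \<phi> squeezed between the
  indicators of \<phi> \<le> s and \<phi> \<le> t. Continuity of \<open>G\<close> allows one level
  to be z and the other to be as close to z as needed.\<close>

lemma weak_conv_vec_gauge_cdf:
  fixes Q :: "(real ^ 'n) measure"
  assumes P: "eventually (\<lambda>n. prob_space (P n)) sequentially" "\<And>n. sets (P n) = sets borel"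
    and Q: "prob_space Q" "sets Q = sets borel" and w: "weak_conv_vec P Q"
    and G: "\<And>z. 0 < z \<Longrightarrow> measure Q {x. \<phi> x \<le> z} = G z" "continuous_on {0<..} G" and z: "0 < z"
  shows "(\<lambda>n. measure (P n) {x. \<phi> x \<le> z}) \<longlonglongrightarrow> G z"
proof -
  define g where "g s t x = clamp01 ((t - \<phi> x) / (t - s))" for s t x
  have g: "continuous_on UNIV (g s t)" "bounded (range (g s t))" if "s < t" for s t
    using that by (auto simp: g_def[abs_def] bounded_iff intro!: continuous_intros continuous_\<phi> exI[of _ 1])
  have bounds: "measure M {x. \<phi> x \<le> s} \<le> integral\<^sup>L M (g s t)" "integral\<^sup>L M (g s t) \<le> measure M {x. \<phi> x \<le> t}"
    if M: "prob_space M" "sets M = sets borel" and st: "s < t" for M s t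
  proof -
    interpret M: prob_space M by fact
    have gm: "g s t \<in> borel_measurable M"
      using borel_measurable_continuous_onI[OF g(1)[OF st]] measurable_cong_sets[OF M(2) refl] by blast
    have gi: "integrable M (g s t)" by (rule M.integrable_const_bound[of _ 1, OF _ gm]) (simp add: g_def)
    have sets: "{x. \<phi> x \<le> r} \<in> sets M" for r unfolding M(2) by measurable
    have ii: "integrable M (indicator {x. \<phi> x \<le> r} :: _ \<Rightarrow> real)" for r using sets by (intro integrable_real_indicator) (auto simp: M.emeasure_eq_measure)
    have "integral\<^sup>L M (indicator {x. \<phi> x \<le> s}) \<le> integral\<^sup>L M (g s t)"
      by (rule integral_mono[OF ii gi]) (use st in \<open>auto simp: g_def indicator_def\<close>)
    then show "measure M {x. \<phi> x \<le> s} \<le> integral\<^sup>L M (g s t)" using sets by simp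
    have "integral\<^sup>L M (g s t) \<le> integral\<^sup>L M (indicator {x. \<phi> x \<le> t})"
      by (rule integral_mono[OF gi ii]) (use st in \<open>auto simp: g_def indicator_def divide_nonpos_pos\<close>)
    then show "integral\<^sup>L M (g s t) \<le> measure M {x. \<phi> x \<le> t}" using sets by simp
  qed
  have lim: "(\<lambda>n. integral\<^sup>L (P n) (g s t)) \<longlonglongrightarrow> integral\<^sup>L Q (g s t)" if "s < t" for s t
    using w g[OF that] unfolding weak_conv_vec_def by blast
  have "open {0::real<..}" by simp
  then have cont: "isCont G z" using G(2) z by (simp add: continuous_on_eq_continuous_at)
  then have lr: "(G \<longlongrightarrow> G z) (at_left z)" "(G \<longlongrightarrow> G z) (at_right z)"
    unfolding isCont_def filterlim_at_split by auto
  show ?thesis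
  proof (rule order_tendstoI)
    fix y assume y: "y < G z"
    have "eventually (\<lambda>s. y < G s) (at_left z)"
      by (rule order_tendstoD(1)[OF lr(1) y])
    moreover have "eventually (\<lambda>s. 0 < s \<and> s < z) (at_left z)"
      using eventually_at_left_real[OF z] by eventually_elim auto
    ultimately obtain s where s: "y < G s" "0 < s" "s < z"
      using eventually_conj eventually_happens[of _ "at_left z"] by (metis (no_types, lifting) trivial_limit_at_left_real)
    have "y < integral\<^sup>L Q (g s z)" using bounds(1)[OF Q s(3)] G(1)[OF s(2)] s(1) by simp
    from order_tendstoD(1)[OF lim[OF s(3)] this] P(1)
    show "eventually (\<lambda>n. y < measure (P n) {x. \<phi> x \<le> z}) sequentially"
      by eventually_elim (use bounds(2)[OF _ P(2) s(3)] in fastforce)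
  next
    fix y assume y: "G z < y"
    have "eventually (\<lambda>s. G s < y) (at_right z)"
      by (rule order_tendstoD(2)[OF lr(2) y])
    moreover have "eventually (\<lambda>s. z < s) (at_right z)"
      by (simp add: eventually_at_right_less)
    ultimately obtain s where s: "G s < y" "z < s"
      using eventually_conj eventually_happens[of _ "at_right z"] by (metis (no_types, lifting) trivial_limit_at_right_real)
    have "integral\<^sup>L Q (g z s) < y" using bounds(2)[OF Q s(2)] G(1)[of s] s z by simp
    from order_tendstoD(2)[OF lim[OF s(2)] this] P(1)
    show "eventually (\<lambda>n. measure (P n) {x. \<phi> x \<le> z} < y) sequentially"
      by eventually_elim (use bounds(1)[OF _ P(2) s(2)] in fastforce)
  qed
qed

end

section \<open>Asymptotics of the law of the maximum\<close>

context gauge_law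
begin

text \<open>Each of the n summands lies between the (n - 1)-st powers of the left limit and of the
  value of the distribution function. Polya's theorem controls both ends uniformly in
  \<open>z\<close>.\<close>

lemma max_weight_uniform_limit:
  assumes c: "0 < c" and \<alpha>: "0 < \<alpha>" and a: "\<And>n. 0 < a n" and e: "0 < e"
    and lim: "\<And>z. 0 < z \<Longrightarrow> (\<lambda>n. prob {x. \<phi> x \<le> a n * z} ^ n) \<longlonglongrightarrow> frechet c \<alpha> z"
  shows "eventually (\<lambda>n. \<forall>z>0. \<bar>max_weight P n (a n * z) - real n * frechet c \<alpha> z\<bar> \<le> real n * e) sequentially"
proof -
  let ?F = "\<lambda>z. prob {x. \<phi> x \<le> z}" and ?L = "\<lambda>z. prob {x. \<phi> x < z}"
  have "eventually (\<lambda>n. \<forall>z>0. frechet c \<alpha> z - e \<le> ?L (a n * z) ^ (n - 1) \<and> ?F (a n * z) ^ (n - 1) \<le> frechet c \<alpha> z + e) sequentially"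
  proof (rule frechet_uniform_limit[OF c \<alpha> e])
    show "(\<lambda>n. ?F (a n * z) ^ (n - 1)) \<longlonglongrightarrow> frechet c \<alpha> z" if "0 < z" for z
      by (rule power_pred_tendsto[OF _ _ lim[OF that] frechet_pos]) auto
    show "?F (a n * z) ^ (n - 1) \<le> ?F (a n * z') ^ (n - 1)" if "z \<le> z'" for n z z'
      using that a[of n] by (intro power_mono prob_le_mono) auto
    show "?F (a n * z) ^ (n - 1) \<le> ?L (a n * z') ^ (n - 1)" if "z < z'" for n z z'
      using that a[of n] by (intro power_mono prob_le_less) auto
  qed (auto intro: power_le_one)
  then show ?thesis using eventually_ge_at_top[of 1]
  proof eventually_elim
    case (elim n)
    show ?case
    proof (intro allI impI)
      fix z :: real assume z: "0 < z"
      let ?l = "?L (a n * z)" and ?u = "?F (a n * z)"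
      have lu: "0 \<le> ?l" "?l \<le> ?u" by (auto intro: prob_less_le)
      have s: "?l ^ (n - 1) \<le> ?l ^ (k - 1) * ?u ^ (n - k)" "?l ^ (k - 1) * ?u ^ (n - k) \<le> ?u ^ (n - 1)" if "k \<in> {1..n}" for k
      proof -
        have nk: "n - 1 = (k - 1) + (n - k)" using that by auto
        show "?l ^ (n - 1) \<le> ?l ^ (k - 1) * ?u ^ (n - k)" unfolding nk power_add
          using lu by (intro mult_left_mono power_mono) auto
        show "?l ^ (k - 1) * ?u ^ (n - k) \<le> ?u ^ (n - 1)" unfolding nk power_add
          using lu by (intro mult_right_mono power_mono) auto
      qed
      have "real n * ?l ^ (n - 1) \<le> max_weight P n (a n * z)"
        using sum_bounded_below[of "{1..n}" "?l ^ (n - 1)", OF s(1)] by (simp add: max_weight_def)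
      moreover have "max_weight P n (a n * z) \<le> real n * ?u ^ (n - 1)"
        using sum_bounded_above[of "{1..n}" _ "?u ^ (n - 1)", OF s(2)] by (simp add: max_weight_def)
      moreover have "real n * (frechet c \<alpha> z - e) \<le> real n * ?l ^ (n - 1)"
        "real n * ?u ^ (n - 1) \<le> real n * (frechet c \<alpha> z + e)"
        using elim z by (auto intro!: mult_left_mono)
      ultimately show "\<bar>max_weight P n (a n * z) - real n * frechet c \<alpha> z\<bar> \<le> real n * e"
        unfolding abs_le_iff by (simp add: algebra_simps)
    qed
  qed
qed

text \<open>The uniform bound on the density is integrated against |h|. The error is left relative
  to the mass n E|h(X / a n)|: no bound on this mass is available yet, and the present estimate is
  used to obtain one.\<close>

lemma implicit_max_law_approx:
  assumes c: "0 < c" and \<alpha>: "0 < \<alpha>" and a: "\<And>n. 0 < a n" and h: "h \<in> bs" and e: "0 < e"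
    and lim: "\<And>z. 0 < z \<Longrightarrow> (\<lambda>n. prob {x. \<phi> x \<le> a n * z} ^ n) \<longlonglongrightarrow> frechet c \<alpha> z"
  shows "eventually (\<lambda>n. \<bar>integral\<^sup>L (implicit_max_law f n (a n) P) h
      - real n * (\<integral>x. h (x /\<^sub>R a n) * frechet c \<alpha> (\<phi> (x /\<^sub>R a n)) \<partial>P)\<bar>
      \<le> e * (real n * (\<integral>x. \<bar>h (x /\<^sub>R a n)\<bar> \<partial>P))) sequentially"
proof -
  have ev: "eventually (\<lambda>n. \<forall>z>0. \<bar>max_weight P n (a n * z) - real n * frechet c \<alpha> z\<bar> \<le> real n * e) sequentially"
    by (rule max_weight_uniform_limit[OF c \<alpha> a e lim])
  show ?thesis
    using ev eventually_ge_at_top[of 1]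
  proof eventually_elim
    case (elim n)
    have hm [measurable]: "h \<in> borel_measurable borel" using bs_measurable[OF h] .
    obtain B where B: "0 < B" "\<And>x. \<bar>h x\<bar> \<le> B" using bs_bound[OF h] by auto
    obtain \<epsilon> where \<epsilon>: "0 < \<epsilon>" "\<And>x. h x \<noteq> 0 \<Longrightarrow> \<epsilon> \<le> \<phi> x" using h unfolding bs_def by auto
    have [measurable]: "(\<lambda>z. frechet c \<alpha> z) \<in> borel_measurable borel" unfolding frechet_def by measurable
    let ?W = "\<lambda>x. max_weight P n (\<phi> x)" and ?h = "\<lambda>x. h (x /\<^sub>R a n)"
    \<comment> \<open>A crude bound that serves integrability only.\<close>
    have W: "\<bar>?W x\<bar> \<le> real n" for x
    proof -
      have "?W x \<le> (\<Sum>k\<in>{1..n}. 1)" unfolding max_weight_def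
        by (intro sum_mono mult_le_one power_le_one zero_le_power) auto
      then show ?thesis using max_weight_nonneg[of P n] by simp
    qed
    have pt: "\<bar>?W x * ?h x - real n * (?h x * frechet c \<alpha> (\<phi> (x /\<^sub>R a n)))\<bar> \<le> e * real n * \<bar>?h x\<bar>" for x
    proof (cases "?h x = 0")
      case False
      have z: "0 < \<phi> (x /\<^sub>R a n)" using \<epsilon>(1) \<epsilon>(2)[OF False] by linarith
      have eq: "a n * \<phi> (x /\<^sub>R a n) = \<phi> x" using a[of n] by (simp only: \<phi>_divide) simp
      have "\<bar>?W x - real n * frechet c \<alpha> (\<phi> (x /\<^sub>R a n))\<bar> \<le> real n * e"
        using elim(1) z by (metis eq)
      then have "\<bar>?W x - real n * frechet c \<alpha> (\<phi> (x /\<^sub>R a n))\<bar> * \<bar>?h x\<bar> \<le> real n * e * \<bar>?h x\<bar>"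
        by (intro mult_right_mono) auto
      then show ?thesis unfolding abs_mult[symmetric] by (simp add: algebra_simps)
    qed simp
    have i1: "integrable P (\<lambda>x. ?W x * ?h x)"
    proof (rule integrable_const_bound[of _ "real n * B"], rule AE_I2)
      fix x show "norm (?W x * ?h x) \<le> real n * B"
        unfolding real_norm_def abs_mult by (intro mult_mono W B) auto
    qed measurable
    have i2: "integrable P (\<lambda>x. ?h x * frechet c \<alpha> (\<phi> (x /\<^sub>R a n)))"
    proof (rule integrable_const_bound[of _ "B * 1"], rule AE_I2)
      fix x show "norm (?h x * frechet c \<alpha> (\<phi> (x /\<^sub>R a n))) \<le> B * 1"
        unfolding real_norm_def abs_mult using c frechet_pos[of c \<alpha>] frechet_le_1[of c \<alpha>] B(1)
        by (intro mult_mono B) (auto simp: less_imp_le)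
    qed measurable
    have i3: "integrable P ?h" by (rule integrable_const_bound[of _ B]) (auto simp: B)
    have "\<bar>integral\<^sup>L (implicit_max_law f n (a n) P) h - real n * (\<integral>x. ?h x * frechet c \<alpha> (\<phi> (x /\<^sub>R a n)) \<partial>P)\<bar>
      = \<bar>\<integral>x. ?W x * ?h x - real n * (?h x * frechet c \<alpha> (\<phi> (x /\<^sub>R a n))) \<partial>P\<bar>"
      using i1 i2 by (simp add: integral_implicit_max_law[OF elim(2) hm])
    also have "\<dots> \<le> (\<integral>x. \<bar>?W x * ?h x - real n * (?h x * frechet c \<alpha> (\<phi> (x /\<^sub>R a n)))\<bar> \<partial>P)"
      by (rule integral_abs_bound)
    also have "\<dots> \<le> (\<integral>x. e * real n * \<bar>?h x\<bar> \<partial>P)"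
      by (rule integral_mono) (use i1 i2 i3 pt in auto)
    also have "\<dots> = e * (real n * (\<integral>x. \<bar>?h x\<bar> \<partial>P))" by simp
    finally show ?case .
  qed
qed

end

section \<open>Compactified vectors and integrals over them\<close>

text \<open>The type class of Hausdorff spaces is not instantiated for finite vectors over a non-metric
  type, hence the detour through the function space.\<close>

lemma compact_imp_closed_vec:
  fixes K :: "('a::t2_space ^ 'n) set"
  assumes "compact K"
  shows "closed K"
proof -
  have c: "continuous_on UNIV (vec_nth :: 'a ^ 'n \<Rightarrow> 'n \<Rightarrow> 'a)"
    by (rule continuous_on_coordinatewise_then_product) (intro continuous_intros)
  have "compact (vec_nth ` K)"
    by (intro compact_continuous_image continuous_on_subset[OF c] assms) auto
  moreover have H: "Hausdorff_space (euclidean :: 'a topology)"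
    unfolding Hausdorff_space_def by (auto simp: disjnt_def dest!: hausdorff)
  then have "Hausdorff_space (euclidean :: ('n \<Rightarrow> 'a) topology)"
    by (subst euclidean_product_topology[symmetric])
      (unfold Hausdorff_space_product_topology, intro disjI2 ballI H)
  ultimately have "closed (vec_nth ` K)"
    using compactin_imp_closedin by (metis closed_closedin compactin_euclidean_iff)
  then have "closed (vec_nth -` (vec_nth ` K))"
    by (intro closed_vimage c)
  moreover have "vec_nth -` (vec_nth ` K) = K" by (auto simp: vec_nth_inject)
  ultimately show ?thesis by simp
qed

text \<open>Tychonoff's theorem on the function space, transported along
  \<open>vec_lambda\<close>.\<close>

lemma compact_UNIV_ext: "compact (UNIV :: (ereal ^ 'n) set)"
proof -
  have "compactin (product_topology (\<lambda>_::'n. euclidean :: ereal topology) UNIV) (PiE UNIV (\<lambda>_. UNIV))"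
    by (subst compactin_PiE) (simp add: compact_complete_linorder compact_UNIV)
  then have "compact (UNIV :: ('n \<Rightarrow> ereal) set)"
    unfolding euclidean_product_topology by (simp add: PiE_UNIV_domain)
  then have "compact (vec_lambda ` (UNIV :: ('n \<Rightarrow> ereal) set))"
    by (intro compact_continuous_image)
      (auto intro!: continuous_on_vec_lambda continuous_on_product_coordinates)
  moreover have "range vec_lambda = (UNIV :: (ereal ^ 'n) set)"
    by (metis surj_def vec_nth_inverse)
  ultimately show ?thesis by simp
qed

lemma closed_imp_compact_ext: "closed (C :: (ereal ^ 'n) set) \<Longrightarrow> compact C"
  using closed_Int_compact[OF _ compact_UNIV_ext, of C] by simp

text \<open>A left inverse of \<open>to_ext\<close>. Infinite coordinates become 0, so the values
  off the range of \<open>to_ext\<close> carry no meaning.\<close>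

definition of_ext :: "ereal ^ 'n \<Rightarrow> real ^ 'n" where "of_ext y = (\<chi> i. real_of_ereal (y $ i))"

lemma of_ext_to_ext [simp]: "of_ext (to_ext x) = x"
  by (simp add: of_ext_def to_ext_def vec_eq_iff)

lemma range_to_ext: "range to_ext = (\<Inter>i. {y. \<bar>y $ i\<bar> \<noteq> \<infinity>})"
proof (intro set_eqI iffI)
  fix y :: "ereal ^ 'n" assume "y \<in> (\<Inter>i. {y. \<bar>y $ i\<bar> \<noteq> \<infinity>})"
  then have "y = to_ext (of_ext y)" by (auto simp: to_ext_def of_ext_def vec_eq_iff ereal_real)
  then show "y \<in> range to_ext" by blast
qed (auto simp: to_ext_def)

text \<open>Finiteness is an open condition on each of finitely many coordinates. Hence compactly
  supported functions of finite vectors extend by zero, and the finite vectors form a Borel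
  set.\<close>

lemma open_range_to_ext: "open (range to_ext :: (ereal ^ 'n) set)"
proof -
  have "open {y :: ereal ^ 'n. \<bar>y $ i\<bar> \<noteq> \<infinity>}" for i
  proof -
    have "open ((\<lambda>y :: ereal ^ 'n. y $ i) -` range ereal)"
      by (intro open_vimage open_ereal continuous_intros) auto
    moreover have "(\<lambda>y :: ereal ^ 'n. y $ i) -` range ereal = {y. \<bar>y $ i\<bar> \<noteq> \<infinity>}"
      by auto
    ultimately show ?thesis by simp
  qed
  then show ?thesis unfolding range_to_ext by (intro open_INT) auto
qed

lemma continuous_on_of_ext: "continuous_on (range (to_ext :: real ^ 'n \<Rightarrow> _)) of_ext"
  unfolding of_ext_def
proof (intro continuous_on_vec_lambda)
  fix i :: 'n
  show "continuous_on (range to_ext) (\<lambda>y. real_of_ereal (y $ i))"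
    by (rule continuous_on_compose2[OF continuous_on_real])
      (auto intro!: continuous_intros simp: to_ext_def)
qed

lemma scale_measure_eq_density: "scale_measure r M = density M (\<lambda>_. r)"
  by (rule measure_eqI) (auto simp: emeasure_density_const)

lemma integral_scale_measure:
  fixes g :: "'a \<Rightarrow> real"
  assumes "g \<in> borel_measurable M"
  shows "integral\<^sup>L (scale_measure (of_nat n) M) g = real n * integral\<^sup>L M g"
proof -
  have "integral\<^sup>L (scale_measure (of_nat n) M) g = integral\<^sup>L (density M (\<lambda>_. ennreal (real n))) g"
    by (simp add: scale_measure_eq_density ennreal_of_nat_eq_real_of_nat)
  also have "\<dots> = (\<integral>x. real n *\<^sub>R g x \<partial>M)" by (rule integral_density) (use assms in auto)
  finally show ?thesis by simp
qed

context homogeneous_gauge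
begin

abbreviation Z :: "(ereal ^ 'n) set" where "Z \<equiv> {x. f x = 0}"

lemma measurable_f [measurable]: "f \<in> borel_measurable borel"
  by (intro borel_measurable_continuous_onI cont)

lemma closed_Z: "closed Z"
  by (intro closed_Collect_eq cont continuous_on_const)

lemma Z_borel [measurable]: "Z \<in> sets borel" "- Z \<in> sets borel"
  using closed_Z by (auto intro: borel_closed)

lemma to_ext_in_Z: "to_ext x \<in> Z \<longleftrightarrow> \<phi> x = 0"
  by (simp add: f_to_ext)

text \<open>The hypothesis on test functions in \<open>vague_conv_off\<close> for the zero set of
  \<open>f\<close>, named so that it can be folded there.\<close>

definition test_off :: "(ereal ^ 'n \<Rightarrow> real) \<Rightarrow> bool" where
  "test_off k \<longleftrightarrow> continuous_on (- Z) k \<and>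
     (\<exists>K. compact K \<and> K \<subseteq> - Z \<and> (\<forall>x. x \<notin> Z \<and> x \<notin> K \<longrightarrow> k x = 0))"

lemma compact_f_pos_bound:
  assumes "compact K" "K \<subseteq> - Z"
  obtains \<epsilon> where "0 < \<epsilon>" "\<And>x. x \<in> K \<Longrightarrow> ennreal \<epsilon> \<le> f x"
proof (cases "K = {}")
  case True then show ?thesis using that[of 1] by simp
next
  case False
  obtain y0 where y0: "y0 \<in> K" "\<And>y. y \<in> K \<Longrightarrow> f y0 \<le> f y"
    using continuous_attains_inf[OF assms(1) False continuous_on_subset[OF cont]] by blast
  have "0 < f y0" using y0(1) assms(2) by (auto simp: zero_less_iff_neq_zero)
  then obtain \<epsilon> where "0 < \<epsilon>" "ennreal \<epsilon> \<le> f y0"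
    by (metis ennreal_less_zero_iff ennreal_cases dense order_less_imp_le ennreal_neq_top not_less_iff_gr_or_eq order_less_le_trans top_greatest)
  then show ?thesis using that[of \<epsilon>] y0 by (meson order_trans)
qed

text \<open>The values of \<open>k\<close> on \<open>Z\<close> are unconstrained and are replaced by
  0; the result is continuous everywhere because \<open>K\<close> is closed and disjoint from
  \<open>Z\<close>. Boundedness comes from compactness of the whole extended space, since the
  support among the finite vectors may be unbounded.\<close>

lemma test_off_extend:
  assumes "test_off k"
  defines "k0 \<equiv> \<lambda>y. indicator (- Z) y *\<^sub>R k y"
  shows "continuous_on UNIV k0" "(\<lambda>x. k0 (to_ext x)) \<in> bs"
proof -
  obtain K where k: "continuous_on (- Z) k" and K: "compact K" "K \<subseteq> - Z" "\<And>x. x \<notin> Z \<Longrightarrow> x \<notin> K \<Longrightarrow> k x = 0"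
    using assms(1) unfolding test_off_def by blast
  have k0: "y \<notin> K \<Longrightarrow> k0 y = 0" for y using K(3) by (auto simp: k0_def indicator_def)
  have "continuous_on (- Z \<union> - K) k0"
  proof (rule continuous_on_open_Un)
    show "continuous_on (- Z) k0" by (rule continuous_on_eq[OF k]) (auto simp: k0_def)
    show "continuous_on (- K) k0" by (rule continuous_on_eq[of _ "\<lambda>_. 0"]) (auto simp: k0)
    show "open (- Z)" "open (- K)" using closed_Z compact_imp_closed_vec[OF K(1)] by (auto simp: open_Compl)
  qed
  moreover have "- Z \<union> - K = UNIV" using K(2) by auto
  ultimately show c: "continuous_on UNIV k0" by simp
  obtain \<epsilon> where \<epsilon>: "0 < \<epsilon>" "\<And>x. x \<in> K \<Longrightarrow> ennreal \<epsilon> \<le> f x" using compact_f_pos_bound[OF K(1,2)] by metis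
  have "bounded (range k0)" by (intro compact_imp_bounded compact_continuous_image c compact_UNIV_ext)
  then have "bounded (range (\<lambda>x. k0 (to_ext x)))" by (rule bounded_subset) auto
  moreover have "continuous_on UNIV (\<lambda>x. k0 (to_ext x))"
    by (rule continuous_on_compose2[OF c continuous_on_to_ext]) auto
  moreover have "\<epsilon> \<le> \<phi> x" if "k0 (to_ext x) \<noteq> 0" for x
    using \<epsilon>(2)[of "to_ext x"] k0[of "to_ext x"] that by (auto simp: f_to_ext)
  ultimately show "(\<lambda>x. k0 (to_ext x)) \<in> bs" using \<epsilon>(1) unfolding bs_def by blast
qed

lemma measurable_test_off_extend:
  "test_off k \<Longrightarrow> (\<lambda>y. indicator (- Z) y *\<^sub>R k y) \<in> borel_measurable borel"
  by (intro borel_measurable_continuous_onI test_off_extend)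

lemma integral_restrict_ext:
  fixes N :: "(real ^ 'n) measure"
  assumes "sets N = sets borel" "test_off k" and t: "t \<in> borel_measurable borel"
  shows "integral\<^sup>L (restrict_space (distr N borel (\<lambda>x. to_ext (t x))) (- Z)) k
    = (\<integral>x. indicator (- Z) (to_ext (t x)) *\<^sub>R k (to_ext (t x)) \<partial>N)"
proof -
  have "(\<lambda>x. to_ext (t x)) \<in> N \<rightarrow>\<^sub>M borel"
    using measurable_compose[OF t measurable_to_ext] measurable_cong_sets[OF assms(1) refl] by blast
  from integral_distr[OF this measurable_test_off_extend[OF assms(2)]]
  show ?thesis by (subst integral_restrict_space) auto
qed

end

context gauge_law
begin

definition rescaled_ext :: "nat \<Rightarrow> real \<Rightarrow> (ereal ^ 'n) measure" where
  "rescaled_ext n a = scale_measure (of_nat n) (restrict_space (distr P borel (\<lambda>x. to_ext (x /\<^sub>R a))) (- Z))"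

lemma integral_rescaled_ext:
  assumes k: "test_off k"
  shows "integral\<^sup>L (rescaled_ext n a) k
    = real n * (\<integral>x. indicator (- Z) (to_ext (x /\<^sub>R a)) *\<^sub>R k (to_ext (x /\<^sub>R a)) \<partial>P)"
proof -
  have "continuous_on (- Z) k" using k by (simp add: test_off_def)
  then have "k \<in> borel_measurable (restrict_space borel (- Z))"
    by (rule borel_measurable_continuous_on_restrict)
  then have "k \<in> borel_measurable (restrict_space (distr P borel (\<lambda>x. to_ext (x /\<^sub>R a))) (- Z))"
    by (subst measurable_cong_sets[OF sets_restrict_space_cong refl]) auto
  then show ?thesis
    unfolding rescaled_ext_def by (simp only: integral_scale_measure integral_restrict_ext[OF sets_P k]
        borel_measurable_scaleR[OF borel_measurable_const measurable_ident_sets[OF refl]])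
qed

end

section \<open>The gauge of a max-stable law\<close>

context homogeneous_gauge
begin

lemma measurable_frechet_\<phi> [measurable]: "(\<lambda>x. frechet c \<alpha> (\<phi> x)) \<in> borel_measurable borel"
  unfolding frechet_def by measurable

lemma continuous_on_frechet_\<phi>: "continuous_on {x. 0 < \<phi> x} (\<lambda>x. frechet c \<alpha> (\<phi> x))"
  by (rule continuous_on_compose2[OF continuous_on_frechet continuous_\<phi>]) auto

text \<open>Division undoes the Frechet weight in the limit law. The reciprocal weight is large only
  near \<phi> = 0, which the support of \<open>h\<close> avoids.\<close>

lemma bs_divide_frechet:
  assumes h: "h \<in> bs" and c: "0 < c" "0 < \<alpha>"
  shows "(\<lambda>x. h x / frechet c \<alpha> (\<phi> x)) \<in> bs"
proof -
  have "(\<lambda>x. h x * (1 / frechet c \<alpha> (\<phi> x))) \<in> bs"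
  proof (rule bs_mult[OF h])
    show "continuous_on {x. 0 < \<phi> x} (\<lambda>x. 1 / frechet c \<alpha> (\<phi> x))"
      by (intro continuous_intros continuous_on_frechet_\<phi>) auto
    fix \<epsilon> :: real assume \<epsilon>: "0 < \<epsilon>"
    have "\<bar>1 / frechet c \<alpha> (\<phi> x)\<bar> \<le> 1 / frechet c \<alpha> \<epsilon>" if "\<epsilon> \<le> \<phi> x" for x
      using frechet_mono[OF _ c(2) \<epsilon> that, of c] c frechet_pos[of c \<alpha>] by (auto intro!: divide_left_mono mult_pos_pos)
    then show "\<exists>B>0. \<forall>x. \<epsilon> \<le> \<phi> x \<longrightarrow> \<bar>1 / frechet c \<alpha> (\<phi> x)\<bar> \<le> B"
      using frechet_pos[of c \<alpha> \<epsilon>] by (intro exI[of _ "1 / frechet c \<alpha> \<epsilon>"]) auto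
  qed
  then show ?thesis by simp
qed

text \<open>If the distribution function of \<phi> took only the values 0 and 1 on the positive
  axis, \<phi> would be almost surely constant, which \<open>nondeg\<close> excludes. Otherwise
  there is an intermediate value, and the functional equation has only Frechet solutions.\<close>

lemma stable_gauge_law_frechet:
  fixes Q :: "(real ^ 'n) measure"
  assumes Q: "prob_space Q" "sets Q = sets borel"
    and stable: "\<And>n. 1 \<le> n \<Longrightarrow> \<exists>b>0. implicit_max_law f n b Q = Q"
    and nondeg: "\<not> (\<exists>c. AE x in Q. f (to_ext x) = c)"
  obtains c \<alpha> where "0 < c" "0 < \<alpha>" "\<And>z. 0 < z \<Longrightarrow> measure Q {x. \<phi> x \<le> z} = frechet c \<alpha> z"
    "AE x in Q. 0 < \<phi> x"
proof -
  interpret gauge_law f Q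
    by (intro gauge_law.intro gauge_law_axioms.intro homogeneous_gauge_axioms Q)
  let ?G = "\<lambda>z. prob {x. \<phi> x \<le> z}"
  have AE_le: "AE x in Q. \<phi> x \<le> z" if "?G z = 1" for z
  proof -
    have "{x. \<phi> x \<le> z} \<in> events" by measurable
    then show ?thesis using prob_eq_1[of "{x. \<phi> x \<le> z}"] that by simp
  qed
  have AE_gt: "AE x in Q. z < \<phi> x" if "?G z = 0" for z
  proof -
    have "{x. \<phi> x \<le> z} \<in> events" by measurable
    then have "AE x in Q. x \<notin> {x. \<phi> x \<le> z}" using prob_eq_0[of "{x. \<phi> x \<le> z}"] that by simp
    then show ?thesis by eventually_elim auto
  qed
  have "\<exists>z0>0. 0 < ?G z0 \<and> ?G z0 < 1"
  proof (rule ccontr)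
    assume "\<not> (\<exists>z0>0. 0 < ?G z0 \<and> ?G z0 < 1)"
    then have dich: "?G z = 0 \<or> ?G z = 1" if "0 < z" for z
    proof -
      have "\<not> (0 < ?G z \<and> ?G z < 1)" using \<open>\<not> (\<exists>z0>0. 0 < ?G z0 \<and> ?G z0 < 1)\<close> that by blast
      then show ?thesis using prob_le_1[of "{x. \<phi> x \<le> z}"] measure_nonneg[of Q "{x. \<phi> x \<le> z}"] by linarith
    qed
    define S where "S = {z. 0 < z \<and> ?G z = 1}"
    have "S \<noteq> {}"
    proof
      assume "S = {}"
      then have "?G (real (Suc m)) = 0" for m using dich[of "real (Suc m)"] by (auto simp: S_def)
      then have "AE x in Q. \<forall>m. real (Suc m) < \<phi> x" unfolding AE_all_countable by (intro allI AE_gt)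
      then have "AE x in Q. False"
      proof eventually_elim
        case (elim x)
        obtain m where "\<phi> x \<le> real m" using real_arch_simple by blast
        then show ?case using spec[OF elim, of m] by simp
      qed
      then show False by simp
    qed
    have bdd: "bdd_below S" unfolding S_def by (intro bdd_belowI[of _ 0]) auto
    \<comment> \<open>The only possible place of a jump. It may be 0, and the dichotomy holds at
      positive arguments only, hence the guard in the lower bounds below.\<close>
    define s where "s = Inf S"
    have s0: "0 \<le> s" unfolding s_def by (intro cInf_greatest \<open>S \<noteq> {}\<close>) (auto simp: S_def)
    have up: "?G z = 1" if "s < z" for z
    proof -
      have "\<exists>w\<in>S. w < z" using cInf_lessD[OF \<open>S \<noteq> {}\<close> that[unfolded s_def]] .
      then obtain w where w: "w \<in> S" "w < z" by blast
      have "1 \<le> ?G z" using prob_le_mono[of w z] w by (simp add: S_def)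
      then show ?thesis using prob_le_1[of "{x. \<phi> x \<le> z}"] by linarith
    qed
    have low: "?G z = 0" if "0 < z" "z < s" for z
    proof (rule ccontr)
      assume "?G z \<noteq> 0"
      then have "z \<in> S" using dich that by (auto simp: S_def)
      then show False using cInf_lower[OF _ bdd, of z] that by (simp add: s_def)
    qed
    have "AE x in Q. \<forall>m. \<phi> x \<le> s + 1 / real (Suc m)" unfolding AE_all_countable by (intro allI AE_le up) simp
    moreover have "AE x in Q. \<forall>m. 0 < s - 1 / real (Suc m) \<longrightarrow> s - 1 / real (Suc m) < \<phi> x"
      unfolding AE_all_countable
    proof
      fix m show "AE x in Q. 0 < s - 1 / real (Suc m) \<longrightarrow> s - 1 / real (Suc m) < \<phi> x"
        using AE_gt[OF low, of "s - 1 / real (Suc m)"] by (cases "0 < s - 1 / real (Suc m)") auto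
    qed
    ultimately have "AE x in Q. f (to_ext x) = ennreal s"
    proof eventually_elim
      case (elim x)
      have "\<not> s < \<phi> x"
      proof
        assume "s < \<phi> x"
        then obtain m where "1 / real (Suc m) < \<phi> x - s" using nat_approx_posE[of "\<phi> x - s"] by auto
        then show False using spec[OF elim(1), of m] by linarith
      qed
      moreover have "\<not> \<phi> x < s"
      proof
        assume "\<phi> x < s"
        then obtain m where m: "1 / real (Suc m) < s - \<phi> x" using nat_approx_posE[of "s - \<phi> x"] by auto
        then have "0 < s - 1 / real (Suc m)" using \<phi>_nonneg[of x] by linarith
        then show False using spec[OF elim(2), of m] m by linarith
      qed
      ultimately show ?case by (simp add: f_to_ext)
    qed
    then show False using nondeg by blast
  qed
  then obtain z0 where z0: "0 < z0" "0 < ?G z0" "?G z0 < 1" by blast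
  have st: "\<exists>b>0. \<forall>z>0. ?G (b * z) ^ n = ?G z" if "1 \<le> n" for n
    using stable[OF that] measure_implicit_max_law_le[OF that] by metis
  obtain c \<alpha> where c: "0 < c" "0 < \<alpha>" "\<And>z. 0 < z \<Longrightarrow> ?G z = frechet c \<alpha> z"
    by (rule max_stable_cdf_frechet[of ?G, OF prob_le_mono _ st z0]) auto
  \<comment> \<open>A positive mass at 0 would bound \<open>frechet c \<alpha> z\<close> away from 0
    for all z > 0.\<close>
  have "?G 0 = 0"
  proof (rule ccontr)
    assume "?G 0 \<noteq> 0"
    then have g0: "0 < ?G 0" using measure_nonneg[of Q "{x. \<phi> x \<le> 0}"] by linarith
    define p where "p = ?G 0 / 2"
    have "0 < p" "p < 1" "p < ?G 0" using g0 prob_le_1[of "{x. \<phi> x \<le> 0}"] unfolding p_def by linarith+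
    then obtain z where "0 < z" "frechet c \<alpha> z = p" using frechet_surj[OF c(1,2)] by metis
    then show False using prob_le_mono[of 0 z] c(3)[of z] \<open>p < ?G 0\<close> by simp
  qed
  then have "AE x in Q. 0 < \<phi> x" by (rule AE_gt)
  with c that show ?thesis by blast
qed

end

section \<open>From the domain of attraction to regular variation\<close>

context gauge_law
begin

text \<open>Absorption: let N be the rescaled mean of |g| and m the Frechet weight at the lowest
  level \<epsilon> of the support. The approximation with error m / 2 gives m N \<le> B + (m / 2) N,
  because the law of the maximum is a probability and |g| is at most B. Hence N \<le> 2 B /
  m.\<close>

lemma rescaled_mean_bounded:
  assumes c: "0 < c" "0 < \<alpha>" and a: "\<And>n. 0 < a n" and g: "g \<in> bs"
    and lim: "\<And>z. 0 < z \<Longrightarrow> (\<lambda>n. prob {x. \<phi> x \<le> a n * z} ^ n) \<longlonglongrightarrow> frechet c \<alpha> z"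
  shows "\<exists>C>0. eventually (\<lambda>n. real n * (\<integral>x. \<bar>g (x /\<^sub>R a n)\<bar> \<partial>P) \<le> C) sequentially"
proof -
  obtain B where B: "0 < B" "\<And>x. \<bar>g x\<bar> \<le> B" using bs_bound[OF g] by auto
  obtain \<epsilon> where \<epsilon>: "0 < \<epsilon>" "\<And>x. g x \<noteq> 0 \<Longrightarrow> \<epsilon> \<le> \<phi> x" using g unfolding bs_def by auto
  define m where "m = frechet c \<alpha> \<epsilon>"
  have m: "0 < m" by (simp add: m_def frechet_pos)
  note [measurable] = bs_measurable[OF g]
  have ev: "eventually (\<lambda>n. \<bar>integral\<^sup>L (implicit_max_law f n (a n) P) (\<lambda>x. \<bar>g x\<bar>)
      - real n * (\<integral>x. \<bar>g (x /\<^sub>R a n)\<bar> * frechet c \<alpha> (\<phi> (x /\<^sub>R a n)) \<partial>P)\<bar>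
      \<le> m / 2 * (real n * (\<integral>x. \<bar>\<bar>g (x /\<^sub>R a n)\<bar>\<bar> \<partial>P))) sequentially"
    by (rule implicit_max_law_approx[OF c a bs_abs[OF g] _ lim]) (use m in auto)
  have "eventually (\<lambda>n. real n * (\<integral>x. \<bar>g (x /\<^sub>R a n)\<bar> \<partial>P) \<le> 2 * B / m) sequentially"
    using ev eventually_ge_at_top[of 1]
  proof eventually_elim
    case (elim n)
    let ?N = "real n * (\<integral>x. \<bar>g (x /\<^sub>R a n)\<bar> \<partial>P)"
    interpret I: prob_space "implicit_max_law f n (a n) P" by (rule prob_space_implicit_max_law[OF elim(2)])
    have [measurable_cong]: "sets (implicit_max_law f n (a n) P) = sets borel" by (simp add: implicit_max_law_def)
    have i1: "integrable P (\<lambda>x. \<bar>g (x /\<^sub>R a n)\<bar>)" by (rule integrable_const_bound[of _ B]) (auto simp: B)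
    have i2: "integrable P (\<lambda>x. \<bar>g (x /\<^sub>R a n)\<bar> * frechet c \<alpha> (\<phi> (x /\<^sub>R a n)))"
    proof (rule integrable_const_bound[of _ "B * 1"], rule AE_I2)
      fix x show "norm (\<bar>g (x /\<^sub>R a n)\<bar> * frechet c \<alpha> (\<phi> (x /\<^sub>R a n))) \<le> B * 1"
        unfolding real_norm_def abs_mult using c frechet_pos[of c \<alpha>] frechet_le_1[of c \<alpha>] B(1)
        by (intro mult_mono) (auto simp: less_imp_le B)
    qed measurable
    have "integral\<^sup>L (implicit_max_law f n (a n) P) (\<lambda>x. \<bar>g x\<bar>) \<le> (\<integral>x. B \<partial>implicit_max_law f n (a n) P)"
      by (rule integral_mono) (auto simp: B intro!: I.integrable_const_bound[of _ B])
    then have pB: "integral\<^sup>L (implicit_max_law f n (a n) P) (\<lambda>x. \<bar>g x\<bar>) \<le> B" by (simp add: I.prob_space)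
    have "(\<integral>x. m * \<bar>g (x /\<^sub>R a n)\<bar> \<partial>P) \<le> (\<integral>x. \<bar>g (x /\<^sub>R a n)\<bar> * frechet c \<alpha> (\<phi> (x /\<^sub>R a n)) \<partial>P)"
    proof (rule integral_mono[OF _ i2])
      fix x show "m * \<bar>g (x /\<^sub>R a n)\<bar> \<le> \<bar>g (x /\<^sub>R a n)\<bar> * frechet c \<alpha> (\<phi> (x /\<^sub>R a n))"
      proof (cases "g (x /\<^sub>R a n) = 0")
        case False
        have "m \<le> frechet c \<alpha> (\<phi> (x /\<^sub>R a n))" unfolding m_def
          using frechet_mono[OF _ c(2) \<epsilon>(1) \<epsilon>(2)[OF False], of c] c by simp
        then show ?thesis by (subst mult.commute) (intro mult_left_mono, auto)
      qed simp
    qed (use i1 in simp)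
    then have "real n * (m * (\<integral>x. \<bar>g (x /\<^sub>R a n)\<bar> \<partial>P)) \<le> real n * (\<integral>x. \<bar>g (x /\<^sub>R a n)\<bar> * frechet c \<alpha> (\<phi> (x /\<^sub>R a n)) \<partial>P)"
      by (intro mult_left_mono) auto
    then have "m * ?N \<le> real n * (\<integral>x. \<bar>g (x /\<^sub>R a n)\<bar> * frechet c \<alpha> (\<phi> (x /\<^sub>R a n)) \<partial>P)"
      by (simp only: mult.left_commute)
    moreover have "\<dots> \<le> integral\<^sup>L (implicit_max_law f n (a n) P) (\<lambda>x. \<bar>g x\<bar>) + m / 2 * ?N"
      using elim(1) unfolding abs_idempotent by linarith
    ultimately have "m * ?N \<le> B + m / 2 * ?N" using pB by linarith
    then show ?case using m by (simp add: field_simps)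
  qed
  then show ?thesis using B m by (intro exI[of _ "2 * B / m"]) auto
qed

text \<open>With bounded rescaled means the relative error of the approximation becomes an absolute
  one.\<close>

lemma implicit_max_law_limit:
  assumes c: "0 < c" "0 < \<alpha>" and a: "\<And>n. 0 < a n" and h: "h \<in> bs"
    and lim: "\<And>z. 0 < z \<Longrightarrow> (\<lambda>n. prob {x. \<phi> x \<le> a n * z} ^ n) \<longlonglongrightarrow> frechet c \<alpha> z"
    and C: "eventually (\<lambda>n. real n * (\<integral>x. \<bar>h (x /\<^sub>R a n)\<bar> \<partial>P) \<le> C) sequentially"
  shows "(\<lambda>n. integral\<^sup>L (implicit_max_law f n (a n) P) h
      - real n * (\<integral>x. h (x /\<^sub>R a n) * frechet c \<alpha> (\<phi> (x /\<^sub>R a n)) \<partial>P)) \<longlonglongrightarrow> 0"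
proof (rule tendstoI)
  fix e :: real assume e: "0 < e"
  define d where "d = e / (2 * (\<bar>C\<bar> + 1))"
  have d: "0 < d" using e by (simp add: d_def)
  have ev: "eventually (\<lambda>n. \<bar>integral\<^sup>L (implicit_max_law f n (a n) P) h
      - real n * (\<integral>x. h (x /\<^sub>R a n) * frechet c \<alpha> (\<phi> (x /\<^sub>R a n)) \<partial>P)\<bar>
      \<le> d * (real n * (\<integral>x. \<bar>h (x /\<^sub>R a n)\<bar> \<partial>P))) sequentially"
    by (rule implicit_max_law_approx[OF c a h d lim])
  have dC: "d * \<bar>C\<bar> < e"
  proof -
    have "d * \<bar>C\<bar> \<le> d * (\<bar>C\<bar> + 1)" using d by (intro mult_left_mono) auto
    also have "\<dots> = e / 2" by (simp add: d_def field_simps)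
    finally show ?thesis using e by linarith
  qed
  show "eventually (\<lambda>n. dist (integral\<^sup>L (implicit_max_law f n (a n) P) h
      - real n * (\<integral>x. h (x /\<^sub>R a n) * frechet c \<alpha> (\<phi> (x /\<^sub>R a n)) \<partial>P)) 0 < e) sequentially"
    using ev C
  proof eventually_elim
    case (elim n)
    have "d * (real n * (\<integral>x. \<bar>h (x /\<^sub>R a n)\<bar> \<partial>P)) \<le> d * \<bar>C\<bar>" using elim(2) d by (intro mult_left_mono) auto
    then show ?case using elim(1) dC by (simp add: dist_real_def)
  qed
qed

text \<open>The laws of the maximum are tested with \<open>h\<close> divided by the Frechet weight,
  which cancels the weight in their asymptotic form. This quotient is bounded and continuous
  although not compactly supported, and weak convergence asks for no more.\<close>

lemma DOA_imp_RV:
  fixes Q :: "(real ^ 'n) measure"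
  assumes a: "\<And>n. 0 < a n" and Q: "prob_space Q" "sets Q = sets borel"
    and w: "weak_conv_vec (\<lambda>n. implicit_max_law f n (a n) P) Q"
    and stable: "\<And>n. 1 \<le> n \<Longrightarrow> \<exists>b>0. implicit_max_law f n b Q = Q"
    and nondeg: "\<not> (\<exists>c. AE x in Q. f (to_ext x) = c)"
  obtains \<alpha> \<mu> where "0 < \<alpha>" "radon_measure_off Z \<mu>" "emeasure \<mu> (space \<mu>) \<noteq> 0"
    "AE x in \<mu>. x \<in> range to_ext" "regularly_varying_seq (1 / \<alpha>) a"
    "vague_conv_off Z (\<lambda>n. rescaled_ext n (a n)) \<mu>"
proof -
  interpret Q: prob_space Q by fact
  obtain c \<alpha> where c: "0 < c" "0 < \<alpha>" and G: "\<And>z. 0 < z \<Longrightarrow> measure Q {x. \<phi> x \<le> z} = frechet c \<alpha> z"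
    and AEpos: "AE x in Q. 0 < \<phi> x"
    using stable_gauge_law_frechet[OF Q stable nondeg] by blast
  have Pev: "eventually (\<lambda>n. prob_space (implicit_max_law f n (a n) P)) sequentially"
    using eventually_ge_at_top[of 1] by eventually_elim (rule prob_space_implicit_max_law)
  have Psets: "sets (implicit_max_law f n (a n) P) = sets borel" for n by (simp add: implicit_max_law_def)
  have lim: "(\<lambda>n. prob {x. \<phi> x \<le> a n * z} ^ n) \<longlonglongrightarrow> frechet c \<alpha> z" if z: "0 < z" for z
  proof -
    have "(\<lambda>n. measure (implicit_max_law f n (a n) P) {x. \<phi> x \<le> z}) \<longlonglongrightarrow> frechet c \<alpha> z"
      by (rule weak_conv_vec_gauge_cdf[OF Pev Psets Q w G continuous_on_frechet z])
    then show ?thesis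
      by (rule Lim_transform_eventually)
        (use eventually_ge_at_top[of 1] in eventually_elim, simp add: measure_implicit_max_law_le a)
  qed
  have rv: "regularly_varying_seq (1 / \<alpha>) a"
    by (rule regularly_varying_of_max_limit[OF c a prob_le_mono _ lim]) auto
  \<comment> \<open>The limit measure before its transport to the extended space. Its density is
    unbounded near \<phi> = 0, so finiteness is claimed only where \<phi> is bounded below.\<close>
  define Q' where "Q' = density Q (\<lambda>x. ennreal (1 / frechet c \<alpha> (\<phi> x)))"
  have sQ': "sets Q' = sets borel" by (simp add: Q'_def Q)
  have sp: "space Q = UNIV" "space Q' = UNIV" using sets_eq_imp_space_eq[OF Q(2)] by (auto simp: Q'_def)
  note [measurable_cong] = Q(2) sQ'
  have te [measurable]: "to_ext \<in> Q' \<rightarrow>\<^sub>M borel" by measurable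
  define \<mu> where "\<mu> = restrict_space (distr Q' borel to_ext) (- Z)"
  have sets\<mu>: "sets \<mu> = sets (restrict_space borel (- Z))"
    unfolding \<mu>_def by (intro sets_restrict_space_cong) simp
  have em: "emeasure \<mu> A = (\<integral>\<^sup>+x. ennreal (1 / frechet c \<alpha> (\<phi> x)) * indicator A (to_ext x) \<partial>Q)"
    if A: "A \<in> sets borel" "A \<subseteq> - Z" for A
  proof -
    have "emeasure \<mu> A = emeasure Q' (to_ext -` A)"
      unfolding \<mu>_def using A Z_borel by (subst emeasure_restrict_space) (auto simp: emeasure_distr sp)
    also have "\<dots> = (\<integral>\<^sup>+x. ennreal (1 / frechet c \<alpha> (\<phi> x)) * indicator (to_ext -` A) x \<partial>Q)"
      unfolding Q'_def by (rule emeasure_density) (use A measurable_sets[OF te A(1)] sp sQ' in \<open>auto simp: Q\<close>)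
    finally show ?thesis by (simp add: indicator_def)
  qed
  have "radon_measure_off Z \<mu>"
    unfolding radon_measure_off_def
  proof (intro conjI allI impI sets\<mu>)
    fix K assume K: "compact K \<and> K \<subseteq> - Z"
    obtain \<epsilon> where \<epsilon>: "0 < \<epsilon>" "\<And>x. x \<in> K \<Longrightarrow> ennreal \<epsilon> \<le> f x" using compact_f_pos_bound K by metis
    have "emeasure \<mu> K \<le> (\<integral>\<^sup>+x. ennreal (1 / frechet c \<alpha> \<epsilon>) \<partial>Q)"
    proof (subst em)
      show "K \<in> sets borel" "K \<subseteq> - Z" using K compact_imp_closed_vec by (auto intro: borel_closed)
      show "(\<integral>\<^sup>+x. ennreal (1 / frechet c \<alpha> (\<phi> x)) * indicator K (to_ext x) \<partial>Q) \<le> (\<integral>\<^sup>+x. ennreal (1 / frechet c \<alpha> \<epsilon>) \<partial>Q)"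
      proof (rule nn_integral_mono)
        fix x show "ennreal (1 / frechet c \<alpha> (\<phi> x)) * indicator K (to_ext x) \<le> ennreal (1 / frechet c \<alpha> \<epsilon>)"
        proof (cases "to_ext x \<in> K")
          case True
          then have "\<epsilon> \<le> \<phi> x" using \<epsilon>(2)[OF True] by (simp add: f_to_ext)
          then show ?thesis using True frechet_mono[OF _ c(2) \<epsilon>(1), of c "\<phi> x"] c frechet_pos[of c \<alpha>]
            by (auto intro!: ennreal_leI divide_left_mono mult_pos_pos)
        qed simp
      qed
    qed
    also have "\<dots> < \<infinity>" by (simp add: Q.emeasure_space_1 ennreal_mult_less_top)
    finally show "emeasure \<mu> K < \<infinity>" .
  qed
  moreover have "emeasure \<mu> (space \<mu>) \<noteq> 0"
  proof -
    have "space \<mu> = - Z" using sets_eq_imp_space_eq[OF sets\<mu>] by (simp add: space_restrict_space)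
    then have "emeasure \<mu> (space \<mu>) = (\<integral>\<^sup>+x. ennreal (1 / frechet c \<alpha> (\<phi> x)) * indicator (- Z) (to_ext x) \<partial>Q)"
      using em[of "- Z"] Z_borel by simp
    \<comment> \<open>The reciprocal weight is at least 1 and \<open>Q\<close> is a probability
      carried by \<phi> > 0.\<close>
    also have "\<dots> \<ge> (\<integral>\<^sup>+x. 1 \<partial>Q)"
    proof (rule nn_integral_mono_AE)
      show "AE x in Q. 1 \<le> ennreal (1 / frechet c \<alpha> (\<phi> x)) * indicator (- Z) (to_ext x)"
        using AEpos
      proof eventually_elim
        case (elim x)
        have "1 \<le> 1 / frechet c \<alpha> (\<phi> x)" using frechet_le_1[of c \<alpha> "\<phi> x"] c frechet_pos[of c \<alpha> "\<phi> x"] by simp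
        then have "ennreal 1 \<le> ennreal (1 / frechet c \<alpha> (\<phi> x))" by (rule ennreal_leI)
        then show ?case using elim to_ext_in_Z[of x] by simp
      qed
    qed
    finally show ?thesis by (auto simp: Q.emeasure_space_1)
  qed
  moreover have "AE x in \<mu>. x \<in> range to_ext"
  proof -
    have "AE x in distr Q' borel to_ext. x \<in> range to_ext"
      by (subst AE_distr_iff[OF te]) (use borel_open[OF open_range_to_ext] in auto)
    then show ?thesis unfolding \<mu>_def using Z_borel by (subst AE_restrict_space_iff) auto
  qed
  moreover have "vague_conv_off Z (\<lambda>n. rescaled_ext n (a n)) \<mu>"
    unfolding vague_conv_off_def test_off_def[symmetric]
  proof (intro allI impI)
    fix k assume k: "test_off k"
    define h where "h x = indicator (- Z) (to_ext x) *\<^sub>R k (to_ext x)" for x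
    have h: "h \<in> bs" using test_off_extend(2)[OF k] unfolding h_def .
    have [measurable]: "h \<in> borel_measurable borel" by (rule bs_measurable[OF h])
    define g where "g x = h x / frechet c \<alpha> (\<phi> x)" for x
    have g: "g \<in> bs" unfolding g_def by (rule bs_divide_frechet[OF h c])
    have gh: "g x * frechet c \<alpha> (\<phi> x) = h x" for x using frechet_pos[of c \<alpha> "\<phi> x"] by (simp add: g_def)
    have "integral\<^sup>L \<mu> k = (\<integral>x. h x \<partial>Q')"
      unfolding \<mu>_def h_def using integral_restrict_ext[OF sQ' k measurable_ident_sets[OF refl]] by simp
    also have "\<dots> = (\<integral>x. (1 / frechet c \<alpha> (\<phi> x)) *\<^sub>R h x \<partial>Q)"
      unfolding Q'_def by (rule integral_density) (auto simp: frechet_pos less_imp_le)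
    also have "\<dots> = integral\<^sup>L Q g" by (simp add: g_def[abs_def])
    finally have \<mu>k: "integral\<^sup>L \<mu> k = integral\<^sup>L Q g" .
    have nk: "integral\<^sup>L (rescaled_ext n (a n)) k
        = real n * (\<integral>x. g (x /\<^sub>R a n) * frechet c \<alpha> (\<phi> (x /\<^sub>R a n)) \<partial>P)" for n
      unfolding integral_rescaled_ext[OF k] gh by (simp add: h_def)
    obtain C where C: "eventually (\<lambda>n. real n * (\<integral>x. \<bar>g (x /\<^sub>R a n)\<bar> \<partial>P) \<le> C) sequentially"
      using rescaled_mean_bounded[OF c a g lim] by blast
    have 1: "(\<lambda>n. integral\<^sup>L (implicit_max_law f n (a n) P) g - integral\<^sup>L (rescaled_ext n (a n)) k) \<longlonglongrightarrow> 0"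
      unfolding nk by (rule implicit_max_law_limit[OF c a g lim C])
    have 2: "(\<lambda>n. integral\<^sup>L (implicit_max_law f n (a n) P) g) \<longlonglongrightarrow> integral\<^sup>L Q g"
      using w g unfolding weak_conv_vec_def bs_def by blast
    show "(\<lambda>n. integral\<^sup>L (rescaled_ext n (a n)) k) \<longlonglongrightarrow> integral\<^sup>L \<mu> k"
      using tendsto_diff[OF 2 1] unfolding \<mu>k by simp
  qed
  ultimately show ?thesis using that[OF c(2) _ _ _ rv] by blast
qed

end

section \<open>Functions of the gauge as test functions\<close>

lemma isCont_frechet: "0 < z \<Longrightarrow> isCont (frechet c \<alpha>) z"
  using continuous_on_frechet[of c \<alpha>] by (simp add: continuous_on_eq_continuous_at)

context homogeneous_gauge
begin

text \<open>Functions of the gauge are parametrised by its inverse \<open>r = 1 / \<phi>\<close>, so that continuity at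
  \<open>r = 0\<close> expresses continuity at the points of the compactification where \<open>f = \<infinity>\<close>.\<close>

definition radial :: "(real \<Rightarrow> real) \<Rightarrow> real ^ 'n \<Rightarrow> real" where
  "radial v x = (if \<phi> x = 0 then 0 else v (1 / \<phi> x))"

text \<open>As a function of \<phi> it rises from 0 at the level 1 / s to 1 at the level 1 / t, so
  \<open>s\<close> and \<open>t\<close> with t < s are inverse levels.\<close>

definition ramp :: "real \<Rightarrow> real \<Rightarrow> real \<Rightarrow> real" where
  "ramp s t r = clamp01 ((s - r) / (s - t))"

lemma continuous_on_ramp: "t < s \<Longrightarrow> continuous_on S (ramp s t)"
  unfolding ramp_def by (intro continuous_intros) auto

lemma ramp_simps [simp]: "0 \<le> ramp s t r" "ramp s t r \<le> 1"
  "t < s \<Longrightarrow> s \<le> r \<Longrightarrow> ramp s t r = 0" "t < s \<Longrightarrow> r \<le> t \<Longrightarrow> ramp s t r = 1"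
  by (auto simp: ramp_def divide_nonpos_pos)

lemma radial_ramp_bounds:
  assumes "0 < t" "t < s"
  shows "indicator {x. 1 / t \<le> \<phi> x} x \<le> radial (ramp s t) x"
    and "radial (ramp s t) x \<le> indicator {x. 1 / s < \<phi> x} x"
proof -
  have p: "0 < \<phi> x" if "1 / t \<le> \<phi> x" using assms that by (meson less_le_trans zero_less_divide_1_iff)
  show "indicator {x. 1 / t \<le> \<phi> x} x \<le> radial (ramp s t) x"
  proof (cases "1 / t \<le> \<phi> x")
    case True
    then have "1 / \<phi> x \<le> t" using p assms by (simp add: field_simps)
    then show ?thesis using p[OF True] assms by (simp add: radial_def)
  qed (simp add: radial_def)
  show "radial (ramp s t) x \<le> indicator {x. 1 / s < \<phi> x} x"
  proof (cases "1 / s < \<phi> x \<or> \<phi> x = 0")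
    case True then show ?thesis using assms by (auto simp: radial_def indicator_def)
  next
    case False
    then have "0 < \<phi> x" using \<phi>_nonneg[of x] by linarith
    then have "s \<le> 1 / \<phi> x" using False assms by (simp add: field_simps)
    then show ?thesis using assms by (simp add: radial_def)
  qed
qed

text \<open>Extension by zero is continuous because the finite vectors form an open set and the
  image of the compact support is closed.\<close>

lemma cc_test_off:
  assumes "h \<in> cc"
  obtains k where "test_off k" "\<And>x. indicator (- Z) (to_ext x) *\<^sub>R k (to_ext x) = h x"
proof -
  obtain K where h: "continuous_on UNIV h" and K: "compact K" "K \<subseteq> {x. 0 < \<phi> x}" "\<And>x. x \<notin> K \<Longrightarrow> h x = 0"
    using assms unfolding cc_def by auto
  define k where "k y = (if y \<in> range to_ext then h (of_ext y) else 0)" for y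
  have K': "compact (to_ext ` K)" by (intro compact_continuous_image continuous_on_to_ext K)
  have K'Z: "to_ext ` K \<subseteq> - Z" using K(2) by (auto simp: f_to_ext)
  have k0: "k y = 0" if "y \<notin> to_ext ` K" for y using that by (auto simp: k_def intro!: K(3))
  have "continuous_on (range to_ext \<union> - (to_ext ` K)) k"
  proof (rule continuous_on_open_Un)
    show "continuous_on (range to_ext) k"
      by (rule continuous_on_eq[OF continuous_on_compose2[OF h continuous_on_of_ext]]) (auto simp: k_def)
    show "continuous_on (- (to_ext ` K)) k" by (rule continuous_on_eq[of _ "\<lambda>_. 0"]) (auto simp: k0)
    show "open (range to_ext)" by (rule open_range_to_ext)
    show "open (- (to_ext ` K))" using compact_imp_closed_vec[OF K'] by (simp add: open_Compl)
  qed
  moreover have "range to_ext \<union> - (to_ext ` K) = UNIV" by auto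
  ultimately have "continuous_on UNIV k" by simp
  then have "test_off k" unfolding test_off_def using K' K'Z k0 continuous_on_subset by blast
  moreover have "indicator (- Z) (to_ext x) *\<^sub>R k (to_ext x) = h x" for x
    using K by (cases "x \<in> K") (auto simp: k_def indicator_def f_to_ext)
  ultimately show ?thesis using that by blast
qed

text \<open>\<open>v\<close> composed with 1 / f is continuous off \<open>Z\<close>, also where f =
  \<infinity> and 1 / f = 0. It vanishes unless f \<ge> 1 / s, a closed and hence compact set of the
  extended space. Thus the unbounded tail sets of \<phi> come within reach of vague
  convergence.\<close>

lemma radial_test_off:
  assumes v: "continuous_on {0..} v" "\<And>r. s \<le> r \<Longrightarrow> v r = 0" and s: "0 < s"
  obtains k where "test_off k" "\<And>x. indicator (- Z) (to_ext x) *\<^sub>R k (to_ext x) = radial v x"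
proof
  let ?k = "\<lambda>y. v (enn2real (inverse (f y)))"
  have "continuous_on (- Z) (\<lambda>y. enn2real (inverse (f y)))"
    unfolding continuous_on_def
  proof (intro ballI tendsto_enn2real)
    fix y assume y: "y \<in> - Z"
    have "continuous_on (- Z) (\<lambda>y. inverse (f y))"
      by (intro continuous_on_inverse_ennreal continuous_on_subset[OF cont]) auto
    moreover have "inverse (f y) < top" using y by (simp add: less_top[symmetric])
    ultimately show "((\<lambda>y. inverse (f y)) \<longlongrightarrow> ennreal (enn2real (inverse (f y)))) (at y within - Z)"
      using y by (simp add: continuous_on_def)
  qed simp
  then have "continuous_on (- Z) ?k" by (rule continuous_on_compose2[OF v(1)]) auto
  moreover have "compact {y. ennreal (1 / s) \<le> f y}"
    by (intro closed_imp_compact_ext closed_Collect_le cont continuous_on_const)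
  moreover have "{y. ennreal (1 / s) \<le> f y} \<subseteq> - Z" using s by auto
  moreover have "?k y = 0" if "y \<notin> Z" "y \<notin> {y. ennreal (1 / s) \<le> f y}" for y
  proof -
    have lt: "f y < ennreal (1 / s)" using that by simp
    then obtain u where u: "f y = ennreal u" "0 \<le> u" by (cases "f y") auto
    have "0 < u" using u that by (cases "u = 0") auto
    moreover have "u < 1 / s" using lt u by (simp add: ennreal_less_iff)
    ultimately have "s \<le> 1 / u" using s by (simp add: field_simps)
    then show ?thesis using u \<open>0 < u\<close> v(2) by (simp add: inverse_ennreal inverse_eq_divide)
  qed
  ultimately show "test_off ?k" unfolding test_off_def by blast
  show "indicator (- Z) (to_ext x) *\<^sub>R ?k (to_ext x) = radial v x" for x
  proof (cases "\<phi> x = 0")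
    case False
    then have "0 < \<phi> x" using \<phi>_nonneg[of x] by linarith
    then show ?thesis using False by (simp add: radial_def f_to_ext inverse_ennreal inverse_eq_divide)
  qed (simp add: radial_def f_to_ext)
qed

lemma radial_bs:
  assumes "continuous_on {0..} v" "\<And>r. s \<le> r \<Longrightarrow> v r = 0" "0 < s"
  shows "radial v \<in> bs"
proof -
  obtain k where k: "test_off k" "\<And>x. indicator (- Z) (to_ext x) *\<^sub>R k (to_ext x) = radial v x"
    using radial_test_off[of v s] assms by metis
  show ?thesis using test_off_extend(2)[OF k(1)] unfolding k(2) .
qed

lemma radial_ramp_bs: "0 < t \<Longrightarrow> t < s \<Longrightarrow> radial (ramp s t) \<in> bs"
  by (rule radial_bs[of _ s]) (auto simp: continuous_on_ramp)

text \<open>In the variable r = 1 / \<phi> the Frechet weight is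
  \<open>exp (- c * r powr \<alpha>)\<close>, continuous up to r = 0 for positive
  \<open>\<alpha>\<close>. Weighted gauge functions therefore remain admissible.\<close>

lemma radial_mult_frechet:
  "radial v x * frechet c \<alpha> (\<phi> x) = radial (\<lambda>r. v r * exp (- c * r powr \<alpha>)) x"
  by (simp add: radial_def frechet_def powr_minus powr_divide inverse_eq_divide)

end

section \<open>Homogeneity and tails of the limit measure\<close>

text \<open>Regular variation restated on finite vectors, where \<open>m\<close> stands for the
  image of the limit measure. Two families of test functions are kept: \<open>cc\<close>, which
  determines measures on \<phi> > 0, and functions of the gauge, which still see mass that moves to
  infinity.\<close>

locale vague_limit = gauge_law f P for f :: "ereal ^ 'n \<Rightarrow> ennreal" and P +
  fixes a :: "nat \<Rightarrow> real" and \<alpha> :: real and m :: "(real ^ 'n) measure"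
  assumes \<alpha>: "0 < \<alpha>" and a: "\<And>n. 0 < a n" and rv: "regularly_varying_seq (1 / \<alpha>) a"
    and sets_m [measurable_cong, simp]: "sets m = sets borel" and AE_pos: "AE x in m. 0 < \<phi> x"
    and finite_tail: "\<And>\<epsilon>. 0 < \<epsilon> \<Longrightarrow> emeasure m {x. \<epsilon> \<le> \<phi> x} < \<infinity>"
    and nontrivial: "emeasure m UNIV \<noteq> 0"
    and vague_cc: "\<And>h. h \<in> cc \<Longrightarrow> (\<lambda>n. real n * (\<integral>x. h (x /\<^sub>R a n) \<partial>P)) \<longlonglongrightarrow> integral\<^sup>L m h"
    and vague_radial: "\<And>v s. continuous_on {0..} v \<Longrightarrow> (\<And>r. s \<le> r \<Longrightarrow> v r = 0) \<Longrightarrow> 0 < s \<Longrightarrow>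
      (\<lambda>n. real n * (\<integral>x. radial v (x /\<^sub>R a n) \<partial>P)) \<longlonglongrightarrow> integral\<^sup>L m (radial v)"
begin

lemma space_m [simp]: "space m = UNIV"
  using sets_eq_imp_space_eq[OF sets_m] by simp

lemma integrable_tail_indicator: "0 < \<epsilon> \<Longrightarrow> integrable m (indicator {x. \<epsilon> \<le> \<phi> x} :: _ \<Rightarrow> real)"
  using finite_tail by (intro integrable_real_indicator) auto

lemma integrable_bs:
  assumes "h \<in> bs"
  shows "integrable m h"
proof -
  obtain B where B: "0 < B" "\<And>x. \<bar>h x\<bar> \<le> B" using bs_bound[OF assms] by auto
  obtain \<epsilon> where \<epsilon>: "0 < \<epsilon>" "\<And>x. h x \<noteq> 0 \<Longrightarrow> \<epsilon> \<le> \<phi> x" using assms unfolding bs_def by auto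
  note [measurable] = bs_measurable[OF assms]
  show ?thesis
  proof (rule Bochner_Integration.integrable_bound)
    show "integrable m (\<lambda>x. B * indicator {x. \<epsilon> \<le> \<phi> x} x)"
      using integrable_tail_indicator[OF \<epsilon>(1)] by simp
    show "AE x in m. norm (h x) \<le> norm (B * indicator {x. \<epsilon> \<le> \<phi> x} x)"
    proof (rule AE_I2)
      fix x show "norm (h x) \<le> norm (B * indicator {x. \<epsilon> \<le> \<phi> x} x)"
        using B(1) B(2)[of x] \<epsilon>(2)[of x] by (cases "h x = 0") auto
    qed
  qed measurable
qed

lemma integrable_rescaled: "h \<in> bs \<Longrightarrow> integrable P (\<lambda>x. h (x /\<^sub>R r))"
proof -
  assume h: "h \<in> bs"
  obtain B where B: "0 < B" "\<And>x. \<bar>h x\<bar> \<le> B" using bs_bound[OF h] by auto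
  note [measurable] = bs_measurable[OF h]
  show ?thesis by (rule integrable_const_bound[of _ B]) (auto simp: B)
qed

text \<open>One limit evaluated twice. With \<open>k n\<close> about
  \<open>l powr \<alpha> * n\<close>, the ratio \<open>a (k n) / a n\<close> tends to
  \<open>l\<close>. Passing to the subsequence turns n E h(X / a (k n)) into
  \<open>l powr (- \<alpha>)\<close> times the integral of \<open>h\<close>; replacing
  \<open>a (k n)\<close> by \<open>l * a n\<close>, which \<open>cc_scale_uniform\<close> justifies,
  turns it into the integral of h(x / l).\<close>

lemma homogeneous_cc:
  assumes h: "h \<in> cc" and l: "0 < l"
  shows "(\<integral>x. h (x /\<^sub>R l) \<partial>m) = l powr (- \<alpha>) * integral\<^sup>L m h"
proof -
  define b where "b = l powr \<alpha>"
  have b: "0 < b" "b powr (1 / \<alpha>) = l" using l \<alpha> by (auto simp: b_def powr_powr)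
  define k where "k n = nat \<lfloor>b * real n\<rfloor>" for n
  have k: "filterlim k at_top sequentially" "eventually (\<lambda>n. 0 < k n \<and> 0 < n) sequentially"
    "(\<lambda>n. real n / real (k n)) \<longlonglongrightarrow> 1 / b"
    unfolding k_def by (rule nat_floor_mult_sequence[OF b(1)])+
  have r: "(\<lambda>n. a (k n) / a n) \<longlonglongrightarrow> l"
    using rv b unfolding regularly_varying_seq_def k_def by metis
  have hb: "h \<in> bs" using h cc_subset_bs by blast
  have "(\<lambda>n. real (k n) * (\<integral>x. h (x /\<^sub>R a (k n)) \<partial>P)) \<longlonglongrightarrow> integral\<^sup>L m h"
    by (rule filterlim_compose[OF vague_cc[OF h] k(1)])
  from tendsto_mult[OF k(3) this]
  have "(\<lambda>n. real n / real (k n) * (real (k n) * (\<integral>x. h (x /\<^sub>R a (k n)) \<partial>P))) \<longlonglongrightarrow> 1 / b * integral\<^sup>L m h" .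
  then have L1: "(\<lambda>n. real n * (\<integral>x. h (x /\<^sub>R a (k n)) \<partial>P)) \<longlonglongrightarrow> 1 / b * integral\<^sup>L m h"
    by (rule Lim_transform_eventually) (use k(2) in eventually_elim, simp)
  have L2: "(\<lambda>n. real n * (\<integral>x. h ((x /\<^sub>R a n) /\<^sub>R l) \<partial>P)) \<longlonglongrightarrow> (\<integral>x. h (x /\<^sub>R l) \<partial>m)"
    by (rule vague_cc[OF cc_scale[OF h l]])
  obtain \<psi> where \<psi>: "\<psi> \<in> cc" "\<And>x. 0 \<le> \<psi> x"
    "\<And>e. 0 < e \<Longrightarrow> \<exists>d>0. \<forall>r. \<bar>r - l\<bar> < d \<longrightarrow> (\<forall>x. \<bar>h (x /\<^sub>R r) - h (x /\<^sub>R l)\<bar> \<le> e * \<psi> x)"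
    using cc_scale_uniform[OF h l] by metis
  have \<psi>b: "\<psi> \<in> bs" using \<psi>(1) cc_subset_bs by blast
  have I0: "0 \<le> integral\<^sup>L m \<psi>" using \<psi>(2) by simp
  have L3: "(\<lambda>n. real n * (\<integral>x. h (x /\<^sub>R a (k n)) \<partial>P) - real n * (\<integral>x. h ((x /\<^sub>R a n) /\<^sub>R l) \<partial>P)) \<longlonglongrightarrow> 0"
  proof (rule tendstoI)
    fix e :: real assume e: "0 < e"
    define e' where "e' = e / (2 * (integral\<^sup>L m \<psi> + 1))"
    have e': "0 < e'" using e I0 by (simp add: e'_def)
    obtain d where d: "0 < d" "\<And>r x. \<bar>r - l\<bar> < d \<Longrightarrow> \<bar>h (x /\<^sub>R r) - h (x /\<^sub>R l)\<bar> \<le> e' * \<psi> x"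
      using \<psi>(3)[OF e'] by blast
    have "eventually (\<lambda>n. \<bar>a (k n) / a n - l\<bar> < d) sequentially"
      using tendstoD[OF r d(1)] by (simp add: dist_real_def)
    moreover have "eventually (\<lambda>n. real n * (\<integral>x. \<psi> (x /\<^sub>R a n) \<partial>P) < integral\<^sup>L m \<psi> + 1) sequentially"
      by (rule order_tendstoD(2)[OF vague_cc[OF \<psi>(1)]]) simp
    ultimately show "eventually (\<lambda>n. dist (real n * (\<integral>x. h (x /\<^sub>R a (k n)) \<partial>P) - real n * (\<integral>x. h ((x /\<^sub>R a n) /\<^sub>R l) \<partial>P)) 0 < e) sequentially"
    proof eventually_elim
      case (elim n)
      have eq: "x /\<^sub>R a (k n) = (x /\<^sub>R a n) /\<^sub>R (a (k n) / a n)" for x :: "real ^ 'n"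
        using a[of n] a[of "k n"] by (simp add: divide_inverse)
      have i1: "integrable P (\<lambda>x. h (x /\<^sub>R a (k n)))" by (rule integrable_rescaled[OF hb])
      have i2: "integrable P (\<lambda>x. h ((x /\<^sub>R a n) /\<^sub>R l))"
        using integrable_rescaled[of "\<lambda>x. h (x /\<^sub>R l)" "a n"] cc_scale[OF h l] cc_subset_bs by blast
      have i3: "integrable P (\<lambda>x. \<psi> (x /\<^sub>R a n))" by (rule integrable_rescaled[OF \<psi>b])
      have "\<bar>(\<integral>x. h (x /\<^sub>R a (k n)) \<partial>P) - (\<integral>x. h ((x /\<^sub>R a n) /\<^sub>R l) \<partial>P)\<bar>
        = \<bar>\<integral>x. h (x /\<^sub>R a (k n)) - h ((x /\<^sub>R a n) /\<^sub>R l) \<partial>P\<bar>"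
        using i1 i2 by simp
      also have "\<dots> \<le> (\<integral>x. \<bar>h (x /\<^sub>R a (k n)) - h ((x /\<^sub>R a n) /\<^sub>R l)\<bar> \<partial>P)" by (rule integral_abs_bound)
      also have "\<dots> \<le> (\<integral>x. e' * \<psi> (x /\<^sub>R a n) \<partial>P)"
      proof (rule integral_mono)
        show "\<bar>h (x /\<^sub>R a (k n)) - h ((x /\<^sub>R a n) /\<^sub>R l)\<bar> \<le> e' * \<psi> (x /\<^sub>R a n)" for x
          unfolding eq by (rule d(2)[OF elim(1)])
      qed (use i1 i2 i3 in auto)
      finally have "\<bar>(\<integral>x. h (x /\<^sub>R a (k n)) \<partial>P) - (\<integral>x. h ((x /\<^sub>R a n) /\<^sub>R l) \<partial>P)\<bar> \<le> e' * (\<integral>x. \<psi> (x /\<^sub>R a n) \<partial>P)"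
        by simp
      then have "real n * \<bar>(\<integral>x. h (x /\<^sub>R a (k n)) \<partial>P) - (\<integral>x. h ((x /\<^sub>R a n) /\<^sub>R l) \<partial>P)\<bar>
          \<le> real n * (e' * (\<integral>x. \<psi> (x /\<^sub>R a n) \<partial>P))" by (rule mult_left_mono) simp
      also have "\<dots> = e' * (real n * (\<integral>x. \<psi> (x /\<^sub>R a n) \<partial>P))" by simp
      also have "\<dots> \<le> e' * (integral\<^sup>L m \<psi> + 1)" using elim(2) e' by (intro mult_left_mono) auto
      also have "\<dots> = e / 2" using I0 by (simp add: e'_def field_simps)
      also have "\<dots> < e" using e by simp
      finally show ?case unfolding dist_real_def diff_0_right right_diff_distrib[symmetric] abs_mult by simp
    qed
  qed
  from tendsto_diff[OF L1 L3] have "(\<lambda>n. real n * (\<integral>x. h ((x /\<^sub>R a n) /\<^sub>R l) \<partial>P)) \<longlonglongrightarrow> 1 / b * integral\<^sup>L m h" by simp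
  from LIMSEQ_unique[OF L2 this] show ?thesis by (simp add: b_def powr_minus inverse_eq_divide)
qed

lemma bs_scale:
  assumes h: "h \<in> bs" and l: "0 < l"
  shows "(\<lambda>x. h (x /\<^sub>R l)) \<in> bs"
proof -
  obtain \<epsilon> where \<epsilon>: "continuous_on UNIV h" "bounded (range h)" "0 < \<epsilon>" "\<And>x. h x \<noteq> 0 \<Longrightarrow> \<epsilon> \<le> \<phi> x"
    using h unfolding bs_def by auto
  have "continuous_on UNIV (\<lambda>x. h (x /\<^sub>R l))"
    by (rule continuous_on_compose2[OF \<epsilon>(1)]) (auto intro: continuous_intros)
  moreover have "bounded (range (\<lambda>x. h (x /\<^sub>R l)))" by (rule bounded_subset[OF \<epsilon>(2)]) auto
  moreover have "\<epsilon> * l \<le> \<phi> x" if "h (x /\<^sub>R l) \<noteq> 0" for x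
  proof -
    have "\<epsilon> \<le> \<phi> x / l" using \<epsilon>(4)[OF that] unfolding \<phi>_divide[OF l] .
    then show ?thesis using l by (simp add: pos_le_divide_eq)
  qed
  moreover have "0 < \<epsilon> * l" using \<epsilon> l by simp
  ultimately show ?thesis unfolding bs_def by blast
qed

text \<open>Ramps in the gauge need not have bounded support, so homogeneity has to go beyond
  \<open>cc\<close>; dominated convergence along an exhaustion extends it.\<close>

lemma homogeneous_bs:
  assumes h: "h \<in> bs" and l: "0 < l"
  shows "(\<integral>x. h (x /\<^sub>R l) \<partial>m) = l powr (- \<alpha>) * integral\<^sup>L m h"
proof -
  obtain \<psi> where \<psi>: "\<And>k. \<psi> k \<in> cc" "\<And>k x. 0 \<le> \<psi> k x" "\<And>k x. \<psi> k x \<le> 1"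
    "\<And>x. 0 < \<phi> x \<Longrightarrow> (\<lambda>k. \<psi> k x) \<longlonglongrightarrow> 1" using cc_exhaustion by metis
  have \<psi>h: "(\<lambda>x. \<psi> k x * h x) \<in> cc" for k
    using h by (intro cc_mult[OF \<psi>(1)]) (auto simp: bs_def intro: continuous_on_subset)
  have ptw: "(\<lambda>k. \<psi> k x * h x) \<longlonglongrightarrow> h x" for x
  proof (cases "h x = 0")
    case False
    then have "0 < \<phi> x" using h unfolding bs_def by force
    from tendsto_mult[OF \<psi>(4)[OF this] tendsto_const[of "h x"]] show ?thesis by simp
  qed simp
  have le: "norm (\<psi> k x * h x) \<le> \<bar>h x\<bar>" for k x
    using mult_right_mono[OF \<psi>(3)[of k x], of "\<bar>h x\<bar>"] \<psi>(2)[of k x] by (simp add: abs_mult)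
  have dom: "(\<lambda>k. \<integral>x. \<psi> k (x /\<^sub>R r) * h (x /\<^sub>R r) \<partial>m) \<longlonglongrightarrow> (\<integral>x. h (x /\<^sub>R r) \<partial>m)" if r: "0 < r" for r
  proof (rule integral_dominated_convergence)
    have hr: "(\<lambda>x. h (x /\<^sub>R r)) \<in> bs" by (rule bs_scale[OF h r])
    show "integrable m (\<lambda>x. \<bar>h (x /\<^sub>R r)\<bar>)" using integrable_bs[OF hr] by simp
    then show "(\<lambda>x. h (x /\<^sub>R r)) \<in> borel_measurable m" using integrable_bs[OF hr] by (blast intro: borel_measurable_integrable)
    show "(\<lambda>x. \<psi> k (x /\<^sub>R r) * h (x /\<^sub>R r)) \<in> borel_measurable m" for k
      using integrable_bs[of "\<lambda>x. \<psi> k (x /\<^sub>R r) * h (x /\<^sub>R r)"] cc_scale[OF \<psi>h r] cc_subset_bs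
      by (blast intro: borel_measurable_integrable)
    show "AE x in m. (\<lambda>k. \<psi> k (x /\<^sub>R r) * h (x /\<^sub>R r)) \<longlonglongrightarrow> h (x /\<^sub>R r)" by (intro AE_I2 ptw)
    show "AE x in m. norm (\<psi> k (x /\<^sub>R r) * h (x /\<^sub>R r)) \<le> \<bar>h (x /\<^sub>R r)\<bar>" for k by (intro AE_I2 le)
  qed
  have 1: "(\<lambda>k. l powr (- \<alpha>) * (\<integral>x. \<psi> k x * h x \<partial>m)) \<longlonglongrightarrow> (\<integral>x. h (x /\<^sub>R l) \<partial>m)"
    using dom[OF l] unfolding homogeneous_cc[OF \<psi>h l] .
  have 2: "(\<lambda>k. l powr (- \<alpha>) * (\<integral>x. \<psi> k x * h x \<partial>m)) \<longlonglongrightarrow> l powr (- \<alpha>) * integral\<^sup>L m h"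
    using dom[of 1] by (intro tendsto_mult tendsto_const) simp
  show ?thesis by (rule LIMSEQ_unique[OF 1 2])
qed

definition tail_const :: real where "tail_const = measure m {x. 1 \<le> \<phi> x}"

lemma measure_tail:
  assumes z: "0 < z"
  shows "measure m {x. z \<le> \<phi> x} = tail_const * z powr (- \<alpha>)"
proof -
  \<comment> \<open>Ramps decreasing to the indicator of \<phi> \<ge> 1. Their lower level 1 / (1 +
    1 / (k + 1)) is at least 1 / 2, whence the dominating indicator of \<phi> \<ge> r / 2 after
    rescaling by r.\<close>
  define v where "v k = ramp (1 + 1 / real (Suc k)) 1" for k
  have vbs: "radial (v k) \<in> bs" for k unfolding v_def by (rule radial_ramp_bs) auto
  have dom: "(\<lambda>k. \<integral>x. radial (v k) (x /\<^sub>R r) \<partial>m) \<longlonglongrightarrow> measure m {x. r \<le> \<phi> x}" if r: "0 < r" for r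
  proof -
    have "(\<lambda>k. \<integral>x. radial (v k) (x /\<^sub>R r) \<partial>m) \<longlonglongrightarrow> (\<integral>x. indicator {x. r \<le> \<phi> x} x \<partial>m)"
    proof (rule integral_dominated_convergence)
      show "integrable m (indicator {x. r / 2 \<le> \<phi> x} :: _ \<Rightarrow> real)" by (rule integrable_tail_indicator) (use r in simp)
      show "(\<lambda>x. radial (v k) (x /\<^sub>R r)) \<in> borel_measurable m" for k
        using integrable_bs[OF bs_scale[OF vbs r]] by (rule borel_measurable_integrable)
      show "AE x in m. (\<lambda>k. radial (v k) (x /\<^sub>R r)) \<longlonglongrightarrow> indicator {x. r \<le> \<phi> x} x"
      proof (rule AE_I2)
        fix x
        show "(\<lambda>k. radial (v k) (x /\<^sub>R r)) \<longlonglongrightarrow> indicator {x. r \<le> \<phi> x} x"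
        proof (cases "r \<le> \<phi> x")
          case True
          have "1 \<le> radial (v k) (x /\<^sub>R r)" for k
            using radial_ramp_bounds(1)[of 1 "1 + 1 / real (Suc k)" "x /\<^sub>R r"] True r
            by (simp add: v_def \<phi>_divide[OF r] del: of_nat_Suc inverse_eq_divide)
          moreover have "radial (v k) (x /\<^sub>R r) \<le> 1" for k by (simp add: radial_def v_def)
          ultimately have "radial (v k) (x /\<^sub>R r) = 1" for k by (meson antisym)
          then show ?thesis using True by simp
        next
          case False
          show ?thesis
          proof (cases "\<phi> x = 0")
            case True
            then have "\<phi> (x /\<^sub>R r) = 0" unfolding \<phi>_divide[OF r] by simp
            then show ?thesis using False by (simp add: radial_def)
          next
            case nz: False
            then have p: "0 < \<phi> x" using \<phi>_nonneg[of x] by linarith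
            have "0 < r / \<phi> x - 1" using False p by (simp add: field_simps)
            then obtain k0 where k0: "1 / real (Suc k0) < r / \<phi> x - 1" using nat_approx_posE by blast
            have "radial (v k) (x /\<^sub>R r) = 0" if "k0 \<le> k" for k
            proof -
              have "1 / real (Suc k) \<le> 1 / real (Suc k0)" using that by (intro divide_left_mono) auto
              then have "1 + 1 / real (Suc k) \<le> 1 / (\<phi> x / r)" using k0 by simp
              then show ?thesis unfolding radial_def \<phi>_divide[OF r] v_def by simp
            qed
            then show ?thesis using False by (intro tendsto_eventually eventually_sequentiallyI[of k0]) auto
          qed
        qed
      qed
      show "AE x in m. norm (radial (v k) (x /\<^sub>R r)) \<le> indicator {x. r / 2 \<le> \<phi> x} x" for k
      proof (rule AE_I2)
        fix x
        have "radial (v k) (x /\<^sub>R r) \<le> indicator {x. 1 / (1 + 1 / real (Suc k)) < \<phi> x} (x /\<^sub>R r)"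
          unfolding v_def by (rule radial_ramp_bounds) auto
        also have "\<dots> \<le> indicator {x. r / 2 \<le> \<phi> x} x"
        proof (cases "1 / (1 + 1 / real (Suc k)) < \<phi> (x /\<^sub>R r)")
          case True
          have "1 / real (Suc k) \<le> 1" by simp
          then have "1 / 2 \<le> 1 / (1 + 1 / real (Suc k))"
            by (intro divide_left_mono mult_pos_pos add_pos_pos) auto
          then have "1 / 2 \<le> \<phi> x / r" using True unfolding \<phi>_divide[OF r] by linarith
          then show ?thesis using r by (simp add: field_simps)
        qed simp
        finally show "norm (radial (v k) (x /\<^sub>R r)) \<le> indicator {x. r / 2 \<le> \<phi> x} x"
          by (simp add: radial_def v_def)
      qed
    qed measurable
    then show ?thesis by simp
  qed
  have 1: "(\<lambda>k. z powr (- \<alpha>) * integral\<^sup>L m (radial (v k))) \<longlonglongrightarrow> measure m {x. z \<le> \<phi> x}"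
    using dom[OF z] unfolding homogeneous_bs[OF vbs z] .
  have "(\<lambda>k. integral\<^sup>L m (radial (v k))) \<longlonglongrightarrow> tail_const" using dom[of 1] by (simp add: tail_const_def)
  from LIMSEQ_unique[OF 1 tendsto_mult[OF tendsto_const this]] show ?thesis by simp
qed

text \<open>By homogeneity one null tail makes every tail null, and the tails exhaust the set \<phi>
  > 0 that carries the nonzero measure \<open>m\<close>.\<close>

lemma tail_const_pos: "0 < tail_const"
proof (rule ccontr)
  assume "\<not> 0 < tail_const"
  then have c0: "tail_const = 0" using measure_nonneg[of m "{x. 1 \<le> \<phi> x}"] unfolding tail_const_def by linarith
  have null: "AE x in m. \<not> 1 / real (Suc k) \<le> \<phi> x" for k
  proof (rule AE_I')
    have "emeasure m {x. 1 / real (Suc k) \<le> \<phi> x} = ennreal (measure m {x. 1 / real (Suc k) \<le> \<phi> x})"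
      using finite_tail[of "1 / real (Suc k)"] by (intro emeasure_eq_ennreal_measure) auto
    also have "\<dots> = 0" using measure_tail[of "1 / real (Suc k)"] c0 by simp
    finally show "{x. 1 / real (Suc k) \<le> \<phi> x} \<in> null_sets m" by (intro null_setsI) auto
  qed auto
  then have "AE x in m. \<forall>k. \<not> 1 / real (Suc k) \<le> \<phi> x" unfolding AE_all_countable by blast
  then have "AE x in m. False" using AE_pos
  proof eventually_elim
    case (elim x)
    obtain k where "1 / real (Suc k) < \<phi> x" using elim(2) nat_approx_posE by blast
    then show ?case using spec[OF elim(1), of k] by simp
  qed
  then have "emeasure m (space m) = 0" using AE_iff_null_sets[of UNIV m] by (auto simp: eventually_ae_filter dest: emeasure_mono)
  then show False using nontrivial by simp
qed

lemma radial_ramp_integral_bounds: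
  assumes t: "0 < t" "t < s"
  shows "measure m {x. 1 / t \<le> \<phi> x} \<le> integral\<^sup>L m (radial (ramp s t))"
    and "integral\<^sup>L m (radial (ramp s t)) \<le> measure m {x. 1 / s \<le> \<phi> x}"
proof -
  have i: "integrable m (radial (ramp s t))" by (rule integrable_bs[OF radial_ramp_bs[OF t]])
  have "integral\<^sup>L m (indicator {x. 1 / t \<le> \<phi> x}) \<le> integral\<^sup>L m (radial (ramp s t))"
    using t by (intro integral_mono integrable_tail_indicator i radial_ramp_bounds) auto
  then show "measure m {x. 1 / t \<le> \<phi> x} \<le> integral\<^sup>L m (radial (ramp s t))" by simp
  have "integral\<^sup>L m (radial (ramp s t)) \<le> integral\<^sup>L m (indicator {x. 1 / s \<le> \<phi> x})"
  proof (intro integral_mono integrable_tail_indicator i)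
    fix x show "radial (ramp s t) x \<le> indicator {x. 1 / s \<le> \<phi> x} x"
      by (rule order_trans[OF radial_ramp_bounds(2)[OF t]]) (auto simp: indicator_def)
  qed (use t in simp)
  then show "integral\<^sup>L m (radial (ramp s t)) \<le> measure m {x. 1 / s \<le> \<phi> x}" by simp
qed

lemma radial_ramp_prob_bounds:
  assumes t: "0 < t" "t < s"
  shows "prob {x. 1 / t \<le> \<phi> (x /\<^sub>R a n)} \<le> (\<integral>x. radial (ramp s t) (x /\<^sub>R a n) \<partial>P)"
    and "(\<integral>x. radial (ramp s t) (x /\<^sub>R a n) \<partial>P) \<le> prob {x. 1 / s < \<phi> (x /\<^sub>R a n)}"
proof -
  have i: "integrable P (\<lambda>x. radial (ramp s t) (x /\<^sub>R a n))" by (rule integrable_rescaled[OF radial_ramp_bs[OF t]])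
  have ii: "integrable P (indicator A :: _ \<Rightarrow> real)" if "A \<in> sets borel" for A
    using that by (intro integrable_real_indicator) (auto simp: emeasure_eq_measure)
  have "integral\<^sup>L P (indicator {x. 1 / t \<le> \<phi> (x /\<^sub>R a n)}) \<le> (\<integral>x. radial (ramp s t) (x /\<^sub>R a n) \<partial>P)"
  proof (intro integral_mono i ii)
    fix x show "indicator {x. 1 / t \<le> \<phi> (x /\<^sub>R a n)} x \<le> radial (ramp s t) (x /\<^sub>R a n)"
      using radial_ramp_bounds(1)[OF t, of "x /\<^sub>R a n"] by (simp add: indicator_def)
  qed measurable
  then show "prob {x. 1 / t \<le> \<phi> (x /\<^sub>R a n)} \<le> (\<integral>x. radial (ramp s t) (x /\<^sub>R a n) \<partial>P)" by simp
  have "(\<integral>x. radial (ramp s t) (x /\<^sub>R a n) \<partial>P) \<le> integral\<^sup>L P (indicator {x. 1 / s < \<phi> (x /\<^sub>R a n)})"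
  proof (intro integral_mono i ii)
    fix x show "radial (ramp s t) (x /\<^sub>R a n) \<le> indicator {x. 1 / s < \<phi> (x /\<^sub>R a n)} x"
      using radial_ramp_bounds(2)[OF t, of "x /\<^sub>R a n"] by (simp add: indicator_def)
  qed measurable
  then show "(\<integral>x. radial (ramp s t) (x /\<^sub>R a n) \<partial>P) \<le> prob {x. 1 / s < \<phi> (x /\<^sub>R a n)}" by simp
qed

text \<open>Tail probabilities are squeezed by ramps between z and a nearby level; the limiting tail
  is continuous in z, so that level can be moved to z.\<close>

lemma gauge_tail_limit:
  assumes z: "0 < z"
  shows "(\<lambda>n. real n * (1 - prob {x. \<phi> x \<le> a n * z})) \<longlonglongrightarrow> tail_const * z powr (- \<alpha>)"
proof -
  let ?T = "\<lambda>z. tail_const * z powr (- \<alpha>)"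
  have compl: "1 - prob {x. \<phi> x \<le> a n * z} = prob {x. z < \<phi> (x /\<^sub>R a n)}" for n
  proof -
    have "prob {x. z < \<phi> (x /\<^sub>R a n)} = prob (UNIV - {x. \<phi> x \<le> a n * z})"
      using a[of n] by (intro arg_cong[where f=prob]) (auto simp: \<phi>_divide[OF a] field_simps simp del: inverse_eq_divide)
    then show ?thesis using prob_compl[of "{x. \<phi> x \<le> a n * z}"] by simp
  qed
  have lim: "(\<lambda>n. real n * (\<integral>x. radial (ramp s t) (x /\<^sub>R a n) \<partial>P)) \<longlonglongrightarrow> integral\<^sup>L m (radial (ramp s t))"
    if "0 < t" "t < s" for s t
    using that by (intro vague_radial[of _ s]) (auto simp: continuous_on_ramp)
  have "isCont ?T z" using z by (intro continuous_intros) auto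
  then have lr: "(?T \<longlongrightarrow> ?T z) (at_left z)" "(?T \<longlongrightarrow> ?T z) (at_right z)"
    unfolding isCont_def filterlim_at_split by auto
  show ?thesis unfolding compl
  proof (rule order_tendstoI)
    fix y assume "y < ?T z"
    then have "eventually (\<lambda>w. y < ?T w) (at_right z)" by (rule order_tendstoD(1)[OF lr(2)])
    moreover have "eventually (\<lambda>w. z < w) (at_right z)" by (simp add: eventually_at_right_less)
    ultimately obtain w where w: "y < ?T w" "z < w"
      using eventually_conj eventually_happens[of _ "at_right z"] by (metis (no_types, lifting) trivial_limit_at_right_real)
    have ts: "0 < 1 / w" "1 / w < 1 / z" using w z by (auto simp: field_simps)
    have "y < integral\<^sup>L m (radial (ramp (1 / z) (1 / w)))"
      using radial_ramp_integral_bounds(1)[OF ts] measure_tail[of w] w z by simp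
    from order_tendstoD(1)[OF lim[OF ts] this]
    show "eventually (\<lambda>n. y < real n * prob {x. z < \<phi> (x /\<^sub>R a n)}) sequentially"
    proof eventually_elim
      case (elim n)
      have "real n * (\<integral>x. radial (ramp (1 / z) (1 / w)) (x /\<^sub>R a n) \<partial>P) \<le> real n * prob {x. 1 / (1 / z) < \<phi> (x /\<^sub>R a n)}"
        by (intro mult_left_mono radial_ramp_prob_bounds(2)[OF ts]) simp
      then show ?case using elim unfolding div_by_1 divide_divide_eq_right mult_1 by linarith
    qed
  next
    fix y assume "?T z < y"
    then have "eventually (\<lambda>w. ?T w < y) (at_left z)" by (rule order_tendstoD(2)[OF lr(1)])
    moreover have "eventually (\<lambda>w. 0 < w \<and> w < z) (at_left z)"
      using eventually_at_left_real[OF z] by eventually_elim auto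
    ultimately obtain w where w: "?T w < y" "0 < w" "w < z"
      using eventually_conj eventually_happens[of _ "at_left z"] by (metis (no_types, lifting) trivial_limit_at_left_real)
    have ts: "0 < 1 / z" "1 / z < 1 / w" using w z by (auto simp: field_simps)
    have "integral\<^sup>L m (radial (ramp (1 / w) (1 / z))) < y"
      using radial_ramp_integral_bounds(2)[OF ts] measure_tail[of w] w by simp
    from order_tendstoD(2)[OF lim[OF ts] this]
    show "eventually (\<lambda>n. real n * prob {x. z < \<phi> (x /\<^sub>R a n)} < y) sequentially"
    proof eventually_elim
      case (elim n)
      have "prob {x. z < \<phi> (x /\<^sub>R a n)} \<le> prob {x. 1 / (1 / z) \<le> \<phi> (x /\<^sub>R a n)}"
        by (intro finite_measure_mono) auto
      also have "\<dots> \<le> (\<integral>x. radial (ramp (1 / w) (1 / z)) (x /\<^sub>R a n) \<partial>P)"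
        by (rule radial_ramp_prob_bounds(1)[OF ts])
      finally have "real n * prob {x. z < \<phi> (x /\<^sub>R a n)} \<le> real n * (\<integral>x. radial (ramp (1 / w) (1 / z)) (x /\<^sub>R a n) \<partial>P)"
        by (intro mult_left_mono) auto
      then show ?case using elim by linarith
    qed
  qed
qed

section \<open>The limit law and its max-stability\<close>

abbreviation G :: "real \<Rightarrow> real" where "G \<equiv> frechet tail_const \<alpha>"

lemma max_cdf_limit: "0 < z \<Longrightarrow> (\<lambda>n. prob {x. \<phi> x \<le> a n * z} ^ n) \<longlonglongrightarrow> G z"
  using power_tendsto_exp[OF _ _ gauge_tail_limit, of z] by (simp add: frechet_def)

text \<open>The first limit serves only to bound the rescaled means of |h|. Stated with both limits
  as hypotheses, the lemma covers compactly supported functions and ramps alike.\<close>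

lemma max_law_limit_G:
  assumes h: "h \<in> bs"
    and 1: "(\<lambda>n. real n * (\<integral>x. \<bar>h (x /\<^sub>R a n)\<bar> \<partial>P)) \<longlonglongrightarrow> l"
    and 2: "(\<lambda>n. real n * (\<integral>x. h (x /\<^sub>R a n) * G (\<phi> (x /\<^sub>R a n)) \<partial>P)) \<longlonglongrightarrow> (\<integral>x. h x * G (\<phi> x) \<partial>m)"
  shows "(\<lambda>n. integral\<^sup>L (implicit_max_law f n (a n) P) h) \<longlonglongrightarrow> (\<integral>x. h x * G (\<phi> x) \<partial>m)"
proof -
  have "eventually (\<lambda>n. real n * (\<integral>x. \<bar>h (x /\<^sub>R a n)\<bar> \<partial>P) < l + 1) sequentially"
    by (rule order_tendstoD(2)[OF 1]) simp
  then have C: "eventually (\<lambda>n. real n * (\<integral>x. \<bar>h (x /\<^sub>R a n)\<bar> \<partial>P) \<le> l + 1) sequentially"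
    by eventually_elim simp
  have "(\<lambda>n. integral\<^sup>L (implicit_max_law f n (a n) P) h
      - real n * (\<integral>x. h (x /\<^sub>R a n) * G (\<phi> (x /\<^sub>R a n)) \<partial>P)) \<longlonglongrightarrow> 0"
    by (rule implicit_max_law_limit[OF tail_const_pos \<alpha> a h max_cdf_limit C])
  from tendsto_add[OF this 2] show ?thesis by simp
qed

lemma max_law_limit_cc:
  assumes h: "h \<in> cc"
  shows "(\<lambda>n. integral\<^sup>L (implicit_max_law f n (a n) P) h) \<longlonglongrightarrow> (\<integral>x. h x * G (\<phi> x) \<partial>m)"
  using h cc_subset_bs
  by (intro max_law_limit_G[OF _ vague_cc[OF cc_abs[OF h]] vague_cc[OF cc_mult[OF h continuous_on_frechet_\<phi>]]]) auto

lemma max_law_limit_ramp: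
  assumes t: "0 < t" "t < s"
  shows "(\<lambda>n. integral\<^sup>L (implicit_max_law f n (a n) P) (radial (ramp s t)))
    \<longlonglongrightarrow> (\<integral>x. radial (ramp s t) x * G (\<phi> x) \<partial>m)"
proof (rule max_law_limit_G[OF radial_ramp_bs[OF t]])
  have nn: "\<bar>radial (ramp s t) x\<bar> = radial (ramp s t) x" for x by (simp add: radial_def)
  show "(\<lambda>n. real n * (\<integral>x. \<bar>radial (ramp s t) (x /\<^sub>R a n)\<bar> \<partial>P)) \<longlonglongrightarrow> integral\<^sup>L m (radial (ramp s t))"
    unfolding nn using t by (intro vague_radial[of _ s]) (auto simp: continuous_on_ramp)
  show "(\<lambda>n. real n * (\<integral>x. radial (ramp s t) (x /\<^sub>R a n) * G (\<phi> (x /\<^sub>R a n)) \<partial>P))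
    \<longlonglongrightarrow> (\<integral>x. radial (ramp s t) x * G (\<phi> x) \<partial>m)"
    unfolding radial_mult_frechet
  proof (rule vague_radial[of _ s])
    show "continuous_on {0..} (\<lambda>r. ramp s t r * exp (- tail_const * r powr \<alpha>))"
      using t \<alpha> by (intro continuous_intros continuous_on_ramp continuous_on_powr') auto
  qed (use t in auto)
qed

definition Q :: "(real ^ 'n) measure" where "Q = density m (\<lambda>x. ennreal (G (\<phi> x)))"

lemma sets_Q [measurable_cong, simp]: "sets Q = sets borel"
  by (simp add: Q_def)

lemma space_Q [simp]: "space Q = UNIV"
  by (simp add: Q_def)

lemma AE_Q_pos: "AE x in Q. 0 < \<phi> x"
  unfolding Q_def by (subst AE_density) (use AE_pos in auto)

lemma integral_Q: "h \<in> borel_measurable borel \<Longrightarrow> integral\<^sup>L Q h = (\<integral>x. h x * G (\<phi> x) \<partial>m)"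
  unfolding Q_def by (subst integral_density) (auto simp: less_imp_le mult.commute)

text \<open>The exact distribution function of the gauge of the maximum passes to the limit through
  the ramp. Thus tails of \<open>Q\<close> are bounded on both sides without integrating against the
  law of \<phi> under \<open>m\<close>. \<open>Q\<close> is not yet known to be finite, hence
  \<open>emeasure\<close>.\<close>

lemma ramp_mass_bounds:
  assumes t: "0 < t" "t < s"
  defines "I \<equiv> (\<integral>x. radial (ramp s t) x * G (\<phi> x) \<partial>m)"
  shows "1 - G (1 / t) \<le> I" "I \<le> 1 - G (1 / s)"
    and "emeasure Q {x. 1 / t \<le> \<phi> x} \<le> ennreal I" "ennreal I \<le> emeasure Q {x. 1 / s < \<phi> x}"
proof -
  have rbs: "radial (ramp s t) \<in> bs" by (rule radial_ramp_bs[OF t])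
  note [measurable] = bs_measurable[OF rbs]
  have ev: "eventually (\<lambda>n. 1 - prob {x. \<phi> x \<le> a n * (1 / t)} ^ n \<le> integral\<^sup>L (implicit_max_law f n (a n) P) (radial (ramp s t))
      \<and> integral\<^sup>L (implicit_max_law f n (a n) P) (radial (ramp s t)) \<le> 1 - prob {x. \<phi> x \<le> a n * (1 / s)} ^ n) sequentially"
    using eventually_ge_at_top[of 1]
  proof eventually_elim
    case (elim n)
    let ?L = "implicit_max_law f n (a n) P"
    interpret L: prob_space ?L by (rule prob_space_implicit_max_law[OF elim])
    have sL [measurable_cong, simp]: "sets ?L = sets borel" by (simp add: implicit_max_law_def)
    have spL: "space ?L = UNIV" by (simp add: implicit_max_law_def)
    have i: "integrable ?L (radial (ramp s t))"
      by (rule L.integrable_const_bound[of _ 1]) (auto simp: radial_def)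
    have ii: "integrable ?L (indicator A :: _ \<Rightarrow> real)" if "A \<in> sets borel" for A
      using that by (intro integrable_real_indicator) (auto simp: L.emeasure_eq_measure)
    have cdf: "measure ?L {x. z < \<phi> x} = 1 - prob {x. \<phi> x \<le> a n * z} ^ n" for z
    proof -
      have "measure ?L {x. z < \<phi> x} = measure ?L (space ?L - {x. \<phi> x \<le> z})"
        by (intro arg_cong[where f="measure ?L"]) (auto simp: spL)
      also have "\<dots> = 1 - measure ?L {x. \<phi> x \<le> z}" by (rule L.prob_compl) measurable
      finally show ?thesis using measure_implicit_max_law_le[OF elim a[of n]] by simp
    qed
    have "measure ?L {x. 1 / t < \<phi> x} \<le> measure ?L {x. 1 / t \<le> \<phi> x}"
      by (intro L.finite_measure_mono) auto
    also have "\<dots> = integral\<^sup>L ?L (indicator {x. 1 / t \<le> \<phi> x})" by simp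
    also have "\<dots> \<le> integral\<^sup>L ?L (radial (ramp s t))"
      by (intro integral_mono i ii radial_ramp_bounds[OF t]) measurable
    finally have 1: "1 - prob {x. \<phi> x \<le> a n * (1 / t)} ^ n \<le> integral\<^sup>L ?L (radial (ramp s t))" unfolding cdf .
    have "integral\<^sup>L ?L (radial (ramp s t)) \<le> integral\<^sup>L ?L (indicator {x. 1 / s < \<phi> x})"
      by (intro integral_mono i ii radial_ramp_bounds[OF t]) measurable
    then have "integral\<^sup>L ?L (radial (ramp s t)) \<le> measure ?L {x. 1 / s < \<phi> x}" by simp
    with 1 show ?case unfolding cdf by simp
  qed
  have lim: "(\<lambda>n. integral\<^sup>L (implicit_max_law f n (a n) P) (radial (ramp s t))) \<longlonglongrightarrow> I"
    unfolding I_def by (rule max_law_limit_ramp[OF t])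
  have "(\<lambda>n. 1 - prob {x. \<phi> x \<le> a n * (1 / t)} ^ n) \<longlonglongrightarrow> 1 - G (1 / t)"
    using t by (intro tendsto_diff tendsto_const max_cdf_limit) simp
  then show "1 - G (1 / t) \<le> I"
    by (rule tendsto_le[OF sequentially_bot lim]) (use ev in eventually_elim, simp)
  have "(\<lambda>n. 1 - prob {x. \<phi> x \<le> a n * (1 / s)} ^ n) \<longlonglongrightarrow> 1 - G (1 / s)"
    using t by (intro tendsto_diff tendsto_const max_cdf_limit) simp
  then show "I \<le> 1 - G (1 / s)"
    by (rule tendsto_le[OF sequentially_bot _ lim]) (use ev in eventually_elim, simp)
  have rG: "(\<lambda>x. radial (ramp s t) x * G (\<phi> x)) \<in> bs"
    unfolding radial_mult_frechet
    by (rule radial_bs[of _ s]) (use t \<alpha> in \<open>auto intro!: continuous_intros continuous_on_ramp continuous_on_powr'\<close>)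
  have nnI: "(\<integral>\<^sup>+x. ennreal (radial (ramp s t) x * G (\<phi> x)) \<partial>m) = ennreal I"
    unfolding I_def by (rule nn_integral_eq_integral[OF integrable_bs[OF rG]]) (auto simp: radial_def less_imp_le)
  have em: "emeasure Q A = (\<integral>\<^sup>+x. ennreal (indicator A x * G (\<phi> x)) \<partial>m)" if [measurable]: "A \<in> sets borel" for A
    unfolding Q_def by (subst emeasure_density) (auto simp: indicator_def intro!: nn_integral_cong)
  show "emeasure Q {x. 1 / t \<le> \<phi> x} \<le> ennreal I"
    by (subst em, measurable, subst nnI[symmetric])
      (intro nn_integral_mono ennreal_leI mult_right_mono radial_ramp_bounds[OF t], auto simp: less_imp_le)
  show "ennreal I \<le> emeasure Q {x. 1 / s < \<phi> x}"
    by (subst em, measurable, subst nnI[symmetric])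
      (intro nn_integral_mono ennreal_leI mult_right_mono radial_ramp_bounds[OF t], auto simp: less_imp_le)
qed

lemma G_small: "0 < p \<Longrightarrow> \<exists>z>0. G z < p"
proof -
  assume p: "0 < p"
  have "0 < min p 1 / 2" "min p 1 / 2 < 1" "min p 1 / 2 < p" using p by auto
  then show ?thesis using frechet_surj[OF tail_const_pos \<alpha>] by metis
qed

text \<open>Here a vague limit could lose mass. The tails exhaust \<open>Q\<close> and each has mass
  at most 1, while tails above small levels have mass arbitrarily close to 1 because
  \<open>G\<close> tends to 0 at 0.\<close>

sublocale Q: prob_space Q
proof
  have "emeasure Q UNIV = (SUP k. emeasure Q {x. 1 / real (Suc k) \<le> \<phi> x})"
  proof -
    have "emeasure Q UNIV = emeasure Q (\<Union>k. {x. 1 / real (Suc k) \<le> \<phi> x})"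
    proof (rule emeasure_eq_AE)
      show "AE x in Q. (x \<in> UNIV) = (x \<in> (\<Union>k. {x. 1 / real (Suc k) \<le> \<phi> x}))"
        using AE_Q_pos
      proof eventually_elim
        case (elim x)
        obtain k where "1 / real (Suc k) < \<phi> x" using elim nat_approx_posE by blast
        then have "x \<in> (\<Union>k. {x. 1 / real (Suc k) \<le> \<phi> x})" by (auto intro: less_imp_le)
        then show ?case by simp
      qed
    qed auto
    also have "\<dots> = (SUP k. emeasure Q {x. 1 / real (Suc k) \<le> \<phi> x})"
    proof (rule SUP_emeasure_incseq[symmetric])
      show "incseq (\<lambda>k. {x. 1 / real (Suc k) \<le> \<phi> x})"
      proof (rule incseq_SucI, safe)
        fix k x assume "1 / real (Suc k) \<le> \<phi> x"
        moreover have "1 / real (Suc (Suc k)) \<le> 1 / real (Suc k)" by (intro divide_left_mono) auto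
        ultimately show "1 / real (Suc (Suc k)) \<le> \<phi> x" by linarith
      qed
    qed auto
    finally show ?thesis .
  qed
  also have "\<dots> \<le> 1"
  proof (rule SUP_least)
    fix k
    have ts: "0 < real (Suc k)" "real (Suc k) < real (Suc (Suc k))" by auto
    have "emeasure Q {x. 1 / real (Suc k) \<le> \<phi> x} \<le> ennreal (\<integral>x. radial (ramp (real (Suc (Suc k))) (real (Suc k))) x * G (\<phi> x) \<partial>m)"
      by (rule ramp_mass_bounds(3)[OF ts])
    also have "\<dots> \<le> ennreal 1"
      using ramp_mass_bounds(2)[OF ts] frechet_pos[of tail_const \<alpha> "1 / real (Suc (Suc k))"] by (intro ennreal_leI) linarith
    finally show "emeasure Q {x. 1 / real (Suc k) \<le> \<phi> x} \<le> 1" by simp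
  qed
  finally have le: "emeasure Q UNIV \<le> 1" .
  have "1 \<le> emeasure Q UNIV"
  proof (rule ennreal_le_epsilon)
    fix e :: real assume e: "0 < e"
    obtain z where z: "0 < z" "G z < e" using G_small[OF e] by blast
    have ts: "0 < 1 / z" "1 / z < 1 / z + 1" using z by auto
    let ?I = "\<integral>x. radial (ramp (1 / z + 1) (1 / z)) x * G (\<phi> x) \<partial>m"
    have I: "1 - e \<le> ?I" using ramp_mass_bounds(1)[OF ts] z by simp
    have "ennreal ?I \<le> emeasure Q UNIV"
      by (rule order_trans[OF ramp_mass_bounds(4)[OF ts] emeasure_mono]) auto
    moreover have "1 \<le> ennreal ?I + ennreal e"
    proof -
      have "0 \<le> ?I" by (intro Bochner_Integration.integral_nonneg) (auto simp: radial_def less_imp_le)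
      then have "ennreal ?I + ennreal e = ennreal (?I + e)" using e by (intro ennreal_plus[symmetric]) auto
      moreover have "ennreal 1 \<le> ennreal (?I + e)" using I by (intro ennreal_leI) linarith
      ultimately show ?thesis by simp
    qed
    ultimately show "1 \<le> emeasure Q UNIV + ennreal e" by (meson add_right_mono order_trans)
  qed
  with le show "emeasure Q (space Q) = 1" by (simp add: antisym)
qed

text \<open>Continuity of \<open>G\<close> closes the gap between the two levels of a ramp. Equality
  of the strict and the weak version excludes atoms of the gauge at positive levels, so that the
  density of the maximum becomes exact for copies of \<open>Q\<close>.\<close>

lemma Q_cdf:
  assumes z: "0 < z"
  shows "measure Q {x. \<phi> x \<le> z} = G z" "measure Q {x. \<phi> x < z} = G z"
proof -
  have lr: "(G \<longlongrightarrow> G z) (at_left z)" "(G \<longlongrightarrow> G z) (at_right z)"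
    using isCont_frechet[OF z, of tail_const \<alpha>] unfolding isCont_def filterlim_at_split by auto
  have le: "measure Q {x. \<phi> x \<le> w} \<le> G w'" "G w \<le> measure Q {x. \<phi> x < w'}" if w: "0 < w" "w < w'" for w w'
  proof -
    have ts: "0 < 1 / w'" "1 / w' < 1 / w" using w by (auto simp: field_simps)
    let ?I = "\<integral>x. radial (ramp (1 / w) (1 / w')) x * G (\<phi> x) \<partial>m"
    have I: "1 - G w' \<le> ?I" "?I \<le> 1 - G w" "emeasure Q {x. w' \<le> \<phi> x} \<le> ennreal ?I" "ennreal ?I \<le> emeasure Q {x. w < \<phi> x}"
      using ramp_mass_bounds[OF ts] by simp_all
    have I0: "0 \<le> ?I" by (intro Bochner_Integration.integral_nonneg) (auto simp: radial_def less_imp_le)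
    have "measure Q {x. w' \<le> \<phi> x} \<le> ?I" using I(3) I0 by (simp add: Q.emeasure_eq_measure)
    moreover have "measure Q {x. w' \<le> \<phi> x} = 1 - measure Q {x. \<phi> x < w'}"
    proof -
      have "{x. w' \<le> \<phi> x} = space Q - {x. \<phi> x < w'}" by auto
      then show ?thesis using Q.prob_compl[of "{x. \<phi> x < w'}"] by simp
    qed
    ultimately show "G w \<le> measure Q {x. \<phi> x < w'}" using I(2) by linarith
    have "?I \<le> measure Q {x. w < \<phi> x}" using I(4) I0 by (simp add: Q.emeasure_eq_measure)
    moreover have "measure Q {x. w < \<phi> x} = 1 - measure Q {x. \<phi> x \<le> w}"
    proof -
      have "{x. w < \<phi> x} = space Q - {x. \<phi> x \<le> w}" by auto
      then show ?thesis using Q.prob_compl[of "{x. \<phi> x \<le> w}"] by simp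
    qed
    ultimately show "measure Q {x. \<phi> x \<le> w} \<le> G w'" using I(1) by linarith
  qed
  have "measure Q {x. \<phi> x \<le> z} \<le> G z"
    by (rule tendsto_lowerbound[OF lr(2)])
      (use eventually_at_right_less[of z] in \<open>eventually_elim, auto intro!: le z\<close>)
  moreover have "G z \<le> measure Q {x. \<phi> x < z}"
    by (rule tendsto_upperbound[OF lr(1)])
      (use eventually_at_left_real[OF z] in \<open>eventually_elim, auto intro!: le\<close>)
  moreover have "measure Q {x. \<phi> x < z} \<le> measure Q {x. \<phi> x \<le> z}" by (intro Q.finite_measure_mono) auto
  ultimately show "measure Q {x. \<phi> x \<le> z} = G z" "measure Q {x. \<phi> x < z} = G z" by linarith+
qed

lemma weak_conv_Q: "weak_conv_vec (\<lambda>n. implicit_max_law f n (a n) P) Q"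
proof (rule weak_conv_vec_ccI)
  show "eventually (\<lambda>n. prob_space (implicit_max_law f n (a n) P)) sequentially"
    using eventually_ge_at_top[of 1] by eventually_elim (rule prob_space_implicit_max_law)
  show "sets (implicit_max_law f n (a n) P) = sets borel" for n by (simp add: implicit_max_law_def)
  show "prob_space Q" by (rule Q.prob_space_axioms)
  show "(\<lambda>n. integral\<^sup>L (implicit_max_law f n (a n) P) h) \<longlonglongrightarrow> integral\<^sup>L Q h" if "h \<in> cc" for h
    using max_law_limit_cc[OF that] that cc_subset_bs bs_measurable by (subst integral_Q) auto
qed (auto intro: AE_Q_pos)

sublocale Q: gauge_law f Q
  by unfold_locales simp

text \<open>Without atoms the maximum of n copies has density n G(\<phi>)^(n - 1) with respect to
  \<open>Q\<close>, thus n G(\<phi>)^n = n G(\<phi> / b) with respect to \<open>m\<close>.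
  Homogeneity of \<open>m\<close> turns the rescaling by b into the factor
  \<open>b powr (- \<alpha>)\<close>, which is 1 / n and cancels n.\<close>

lemma stable_Q:
  assumes n: "1 \<le> n"
  shows "implicit_max_law f n (real n powr (1 / \<alpha>)) Q = Q"
proof -
  define b where "b = real n powr (1 / \<alpha>)"
  have b: "0 < b" using n by (simp add: b_def)
  have bn: "b powr (- \<alpha>) = 1 / real n" using n \<alpha> by (simp add: b_def powr_powr powr_minus inverse_eq_divide)
  have mw: "max_weight Q n z = real n * G z ^ (n - 1)" if "0 < z" for z
  proof -
    have "max_weight Q n z = (\<Sum>k\<in>{1..n}. G z ^ (n - 1))"
      unfolding max_weight_def Q_cdf[OF that]
    proof (rule sum.cong[OF refl])
      fix k assume "k \<in> {1..n}"
      then have "n - 1 = (k - 1) + (n - k)" by auto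
      then show "G z ^ (k - 1) * G z ^ (n - k) = G z ^ (n - 1)" by (simp add: power_add)
    qed
    then show ?thesis by simp
  qed
  show ?thesis unfolding b_def[symmetric]
  proof (rule prob_space_eqI_cc)
    show "prob_space (implicit_max_law f n b Q)" by (rule Q.prob_space_implicit_max_law[OF n])
    show "sets (implicit_max_law f n b Q) = sets borel" by (simp add: implicit_max_law_def)
    show "prob_space Q" by (rule Q.prob_space_axioms)
    fix h assume h: "h \<in> cc"
    then have hm [measurable]: "h \<in> borel_measurable borel" using cc_subset_bs bs_measurable by blast
    have hG: "(\<lambda>x. h x * G (\<phi> x)) \<in> cc" by (rule cc_mult[OF h continuous_on_frechet_\<phi>])
    have pt: "max_weight Q n (\<phi> x) * h (x /\<^sub>R b) * G (\<phi> x) = real n * (h (x /\<^sub>R b) * G (\<phi> (x /\<^sub>R b)))" for x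
    proof (cases "\<phi> x = 0")
      case True
      then have "\<phi> (x /\<^sub>R b) = 0" unfolding \<phi>_divide[OF b] by simp
      then have "h (x /\<^sub>R b) = 0" using h unfolding cc_def by force
      then show ?thesis by simp
    next
      case False
      then have p: "0 < \<phi> x" using \<phi>_nonneg[of x] by linarith
      have "G (\<phi> x) ^ (n - 1) * G (\<phi> x) = G (\<phi> x) ^ n" using n by (metis power_minus_mult zero_less_one order_less_le_trans)
      also have "\<dots> = G (\<phi> x / b)"
        unfolding b_def using n by (intro frechet_power \<alpha> p) simp
      also have "\<dots> = G (\<phi> (x /\<^sub>R b))" by (simp only: \<phi>_divide[OF b])
      finally show ?thesis by (simp add: mw[OF p] algebra_simps)
    qed
    have "integral\<^sup>L (implicit_max_law f n b Q) h = (\<integral>x. max_weight Q n (\<phi> x) * h (x /\<^sub>R b) \<partial>Q)"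
      by (rule Q.integral_implicit_max_law[OF n hm])
    also have "\<dots> = (\<integral>x. max_weight Q n (\<phi> x) * h (x /\<^sub>R b) * G (\<phi> x) \<partial>m)"
      by (rule integral_Q) measurable
    also have "\<dots> = real n * (\<integral>x. h (x /\<^sub>R b) * G (\<phi> (x /\<^sub>R b)) \<partial>m)" unfolding pt by simp
    also have "\<dots> = (\<integral>x. h x * G (\<phi> x) \<partial>m)"
      using homogeneous_cc[OF hG b] n by (simp add: bn)
    also have "\<dots> = integral\<^sup>L Q h" by (rule integral_Q[symmetric, OF hm])
    finally show "integral\<^sup>L (implicit_max_law f n b Q) h = integral\<^sup>L Q h" .
  qed (auto intro: AE_Q_pos)
qed

text \<open>For an almost surely constant gauge the distribution function takes only the values 0
  and 1, whereas \<open>G\<close> attains 1 / 2.\<close>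

lemma nondegenerate_Q: "\<not> (\<exists>c. AE x in Q. f (to_ext x) = c)"
proof
  assume "\<exists>c. AE x in Q. f (to_ext x) = c"
  then obtain c where "AE x in Q. f (to_ext x) = c" by blast
  then have ae: "AE x in Q. \<phi> x = enn2real c"
    by eventually_elim (simp add: \<phi>_def)
  obtain z where z: "0 < z" "G z = 1 / 2" using frechet_surj[OF tail_const_pos \<alpha>, of "1 / 2"] by auto
  have "measure Q {x. \<phi> x \<le> z} = 0 \<or> measure Q {x. \<phi> x \<le> z} = 1"
  proof (cases "enn2real c \<le> z")
    case True
    have "AE x in Q. x \<in> {x. \<phi> x \<le> z}" using ae by eventually_elim (simp add: True)
    then show ?thesis using Q.prob_eq_1[of "{x. \<phi> x \<le> z}"] by simp
  next
    case False
    have "AE x in Q. x \<notin> {x. \<phi> x \<le> z}" using ae by eventually_elim (simp add: False)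
    then show ?thesis using Q.prob_eq_0[of "{x. \<phi> x \<le> z}"] by simp
  qed
  then show False using Q_cdf(1)[OF z(1)] z(2) by simp
qed

end

section \<open>From regular variation to the domain of attraction\<close>

context gauge_law
begin

lemma RV_imp_DOA:
  assumes \<alpha>: "0 < \<alpha>" and radon: "radon_measure_off Z \<mu>" and nontriv: "emeasure \<mu> (space \<mu>) \<noteq> 0"
    and AE: "AE x in \<mu>. x \<in> range to_ext" and a: "\<And>n. 0 < a n" and rv: "regularly_varying_seq (1 / \<alpha>) a"
    and vague: "vague_conv_off Z (\<lambda>n. rescaled_ext n (a n)) \<mu>"
  obtains Q where "prob_space Q" "sets Q = sets borel"
    "weak_conv_vec (\<lambda>n. implicit_max_law f n (a n) P) Q"
    "\<And>n. 1 \<le> n \<Longrightarrow> \<exists>b>0. implicit_max_law f n b Q = Q"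
    "\<not> (\<exists>c. AE x in Q. f (to_ext x) = c)"
proof -
  have s\<mu>: "sets \<mu> = sets (restrict_space borel (- Z))" using radon by (simp add: radon_measure_off_def)
  have sp: "space \<mu> = - Z" using sets_eq_imp_space_eq[OF s\<mu>] by (simp add: space_restrict_space)
  \<comment> \<open>The value 0 at points with an infinite coordinate is harmless, since
    \<open>\<mu>\<close> gives these points no mass.\<close>
  define g where "g y = (if y \<in> range to_ext then of_ext y else 0)" for y :: "ereal ^ 'n"
  have gto: "g (to_ext x) = x" for x by (simp add: g_def)
  have gm0: "g \<in> borel_measurable borel"
    unfolding g_def by (intro borel_measurable_continuous_on_if borel_open open_range_to_ext continuous_on_of_ext continuous_on_const)
  have sub: "h \<in> \<mu> \<rightarrow>\<^sub>M N" if "h \<in> borel \<rightarrow>\<^sub>M N" for h :: "ereal ^ 'n \<Rightarrow> 'z" and N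
    using measurable_restrict_space1[OF that, of "- Z"] measurable_cong_sets[OF s\<mu> refl] by blast
  have gm [measurable]: "g \<in> \<mu> \<rightarrow>\<^sub>M borel" by (rule sub[OF gm0])
  define m where "m = distr \<mu> borel g"
  have AE': "AE y in \<mu>. y \<in> - Z \<and> (\<exists>x. y = to_ext x)"
    using AE AE_space[of \<mu>] by eventually_elim (auto simp: sp)
  have intm: "integral\<^sup>L m h = integral\<^sup>L \<mu> k"
    if k: "test_off k" "\<And>x. indicator (- Z) (to_ext x) *\<^sub>R k (to_ext x) = h x" and hm: "h \<in> borel_measurable borel" for h k
  proof -
    have km: "k \<in> borel_measurable \<mu>"
    proof -
      have "k \<in> borel_measurable (restrict_space borel (- Z))"
        using k(1) by (intro borel_measurable_continuous_on_restrict) (simp add: test_off_def)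
      then show ?thesis using measurable_cong_sets[OF s\<mu> refl] by blast
    qed
    have "integral\<^sup>L m h = (\<integral>y. h (g y) \<partial>\<mu>)" unfolding m_def by (rule integral_distr[OF gm hm])
    also have "\<dots> = integral\<^sup>L \<mu> k"
    proof (rule integral_cong_AE)
      show "(\<lambda>y. h (g y)) \<in> borel_measurable \<mu>" using hm by measurable
      show "AE y in \<mu>. h (g y) = k y" using AE'
      proof eventually_elim
        case (elim y)
        then obtain x where "y = to_ext x" "to_ext x \<in> - Z" by blast
        then show ?case using k(2)[of x] by (simp add: gto)
      qed
    qed (rule km)
    finally show ?thesis .
  qed
  have lim: "(\<lambda>n. real n * (\<integral>x. h (x /\<^sub>R a n) \<partial>P)) \<longlonglongrightarrow> integral\<^sup>L m h"
    if k: "test_off k" "\<And>x. indicator (- Z) (to_ext x) *\<^sub>R k (to_ext x) = h x" for h k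
  proof -
    have hm: "h \<in> borel_measurable borel"
      using bs_measurable[OF test_off_extend(2)[OF k(1)]] unfolding k(2) .
    have "(\<lambda>n. integral\<^sup>L (rescaled_ext n (a n)) k) \<longlonglongrightarrow> integral\<^sup>L \<mu> k"
      using vague k(1) unfolding vague_conv_off_def test_off_def[symmetric] by blast
    then show ?thesis unfolding integral_rescaled_ext[OF k(1)] k(2) intm[OF k hm] .
  qed
  interpret V: vague_limit f P a \<alpha> m
  proof
    show "sets m = sets borel" by (simp add: m_def)
    show "AE x in m. 0 < \<phi> x"
      unfolding m_def
    proof (subst AE_distr_iff[OF gm])
      show "AE y in \<mu>. 0 < \<phi> (g y)" using AE'
      proof eventually_elim
        case (elim y)
        then obtain x where "y = to_ext x" "to_ext x \<in> - Z" by blast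
        then show ?case using \<phi>_nonneg[of x] by (auto simp: gto f_to_ext less_le)
      qed
    qed measurable
    show "emeasure m {x. \<epsilon> \<le> \<phi> x} < \<infinity>" if \<epsilon>: "0 < \<epsilon>" for \<epsilon>
    proof -
      \<comment> \<open>This superlevel set may contain points at infinity, yet it is compact and
        disjoint from \<open>Z\<close>, so the Radon property bounds the tail of
        \<open>m\<close>.\<close>
      let ?K = "{y. ennreal \<epsilon> \<le> f y}"
      have cK: "closed ?K" by (intro closed_Collect_le cont continuous_on_const)
      have K: "compact ?K" "?K \<subseteq> - Z" using closed_imp_compact_ext[OF cK] \<epsilon> by auto
      have Ks: "?K \<in> sets \<mu>"
        unfolding s\<mu> using K(2) borel_closed[OF cK] Z_borel by (subst sets_restrict_space_iff) auto
      have "emeasure m {x. \<epsilon> \<le> \<phi> x} = emeasure \<mu> (g -` {x. \<epsilon> \<le> \<phi> x} \<inter> space \<mu>)"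
        unfolding m_def by (rule emeasure_distr[OF gm]) measurable
      also have "\<dots> \<le> emeasure \<mu> ?K"
      proof (rule emeasure_mono_AE[OF _ Ks])
        show "AE y in \<mu>. y \<in> g -` {x. \<epsilon> \<le> \<phi> x} \<inter> space \<mu> \<longrightarrow> y \<in> ?K" using AE'
          by eventually_elim (auto simp: gto f_to_ext intro: ennreal_leI)
      qed
      also have "\<dots> < \<infinity>" using radon K unfolding radon_measure_off_def by blast
      finally show ?thesis .
    qed
    show "emeasure m UNIV \<noteq> 0"
      using nontriv unfolding m_def by (subst emeasure_distr[OF gm]) auto
    show "(\<lambda>n. real n * (\<integral>x. h (x /\<^sub>R a n) \<partial>P)) \<longlonglongrightarrow> integral\<^sup>L m h" if "h \<in> cc" for h
      by (rule cc_test_off[OF that]) (rule lim)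
    show "(\<lambda>n. real n * (\<integral>x. radial v (x /\<^sub>R a n) \<partial>P)) \<longlonglongrightarrow> integral\<^sup>L m (radial v)"
      if "continuous_on {0..} v" "\<And>r. s \<le> r \<Longrightarrow> v r = 0" "0 < s" for v s
      by (rule radial_test_off[OF that]) (assumption | rule lim)+
  qed (fact \<alpha> a rv)+
  show ?thesis
  proof (rule that[of V.Q])
    show "prob_space V.Q" by (rule V.Q.prob_space_axioms)
    show "\<exists>b>0. implicit_max_law f n b V.Q = V.Q" if "1 \<le> n" for n
      using V.stable_Q[OF that] that by (intro exI[of _ "real n powr (1 / \<alpha>)"]) auto
  qed (simp_all add: V.weak_conv_Q V.nondegenerate_Q)
qed

end

theorem theorem4p4:
  fixes f :: "ereal ^ 'n \<Rightarrow> ennreal"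
    and M :: "'a measure" and X :: "'a \<Rightarrow> real ^ 'n"
  assumes "continuous_on UNIV f"
    and "homogeneous1 f"
    and "\<And>x. f (to_ext x) < \<infinity>"
    and "prob_space M"
    and "X \<in> borel_measurable M"
  shows "(\<exists>(N :: (real ^ 'n) measure) Y. prob_space N \<and> Y \<in> borel_measurable N \<and>
            \<not> (\<exists>c. AE \<omega> in N. f (to_ext (Y \<omega>)) = c) \<and>
            implicit_DOA f M X N Y)
     \<longleftrightarrow> (\<exists>\<alpha>>0. \<exists>\<mu>. RV \<alpha> {x. f x = 0} \<mu> M X)"
proof -
  interpret M: prob_space M by fact
  \<comment> \<open>Both sides of the equivalence depend on \<open>X\<close> through its law
    only.\<close>
  define P where "P = distr M borel X"
  have P: "prob_space P" unfolding P_def by (rule M.prob_space_distr) fact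
  interpret gauge_law f P
    by (intro gauge_law.intro homogeneous_gauge.intro gauge_law_axioms.intro assms P) (simp add: P_def)
  have resc: "rescaled_ext n c = scale_measure (of_nat n)
      (restrict_space (distr M borel (\<lambda>\<omega>. to_ext (X \<omega> /\<^sub>R c))) (- {x. f x = 0}))" for n c
  proof -
    have "(\<lambda>x :: real ^ 'n. to_ext (x /\<^sub>R c)) \<in> borel_measurable borel" by measurable
    from distr_distr[OF this assms(5)] show ?thesis
      unfolding rescaled_ext_def by (simp add: P_def comp_def)
  qed
  show ?thesis
  proof
    assume "\<exists>(N :: (real ^ 'n) measure) Y. prob_space N \<and> Y \<in> borel_measurable N \<and>
            \<not> (\<exists>c. AE \<omega> in N. f (to_ext (Y \<omega>)) = c) \<and> implicit_DOA f M X N Y"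
    then obtain N :: "(real ^ 'n) measure" and Y where N: "prob_space N" and Y: "Y \<in> borel_measurable N"
      and nd: "\<not> (\<exists>c. AE \<omega> in N. f (to_ext (Y \<omega>)) = c)" and doa: "implicit_DOA f M X N Y"
      by blast
    let ?Q = "distr N borel Y"
    obtain a where a: "\<And>n. 0 < a n" and w: "weak_conv_vec (\<lambda>n. implicit_max_law f n (a n) P) ?Q"
      using doa unfolding implicit_DOA_def P_def by blast
    have "\<not> (\<exists>c. AE x in ?Q. f (to_ext x) = c)"
      using nd by (subst AE_distr_iff[OF Y]) auto
    moreover have "\<exists>b>0. implicit_max_law f n b ?Q = ?Q" if "1 \<le> n" for n
      using doa that unfolding implicit_DOA_def implicit_max_stable_def by blast
    ultimately obtain \<alpha> \<mu> where "0 < \<alpha>" "radon_measure_off {x. f x = 0} \<mu>" "emeasure \<mu> (space \<mu>) \<noteq> 0"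
      "AE x in \<mu>. x \<in> range to_ext" "regularly_varying_seq (1 / \<alpha>) a"
      "vague_conv_off {x. f x = 0} (\<lambda>n. rescaled_ext n (a n)) \<mu>"
      using DOA_imp_RV[OF a prob_space.prob_space_distr[OF N Y] sets_distr w] by blast
    with a show "\<exists>\<alpha>>0. \<exists>\<mu>. RV \<alpha> {x. f x = 0} \<mu> M X"
      unfolding RV_def resc by blast
  next
    assume "\<exists>\<alpha>>0. \<exists>\<mu>. RV \<alpha> {x. f x = 0} \<mu> M X"
    then obtain \<alpha> \<mu> a where "0 < \<alpha>" "radon_measure_off {x. f x = 0} \<mu>" "emeasure \<mu> (space \<mu>) \<noteq> 0"
      "AE x in \<mu>. x \<in> range to_ext" and a: "\<And>n. 0 < a n" and "regularly_varying_seq (1 / \<alpha>) a"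
      "vague_conv_off {x. f x = 0} (\<lambda>n. rescaled_ext n (a n)) \<mu>"
      unfolding RV_def resc by blast
    then obtain Q where Q: "prob_space Q" "sets Q = sets borel"
      "weak_conv_vec (\<lambda>n. implicit_max_law f n (a n) P) Q"
      "\<And>n. 1 \<le> n \<Longrightarrow> \<exists>b>0. implicit_max_law f n b Q = Q"
      "\<not> (\<exists>c. AE x in Q. f (to_ext x) = c)"
      by (rule RV_imp_DOA) blast
    \<comment> \<open>The limit vector is realised as the identity on its own law.\<close>
    have "distr Q borel (\<lambda>x. x) = Q" by (rule distr_id2) (simp add: Q)
    then have "implicit_DOA f M X Q (\<lambda>x. x)"
      unfolding implicit_DOA_def implicit_max_stable_def P_def[symmetric] using Q a by auto
    moreover have "(\<lambda>x. x) \<in> borel_measurable Q" by (rule measurable_ident_sets[OF Q(2)])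
    ultimately show "\<exists>(N :: (real ^ 'n) measure) Y. prob_space N \<and> Y \<in> borel_measurable N \<and>
            \<not> (\<exists>c. AE \<omega> in N. f (to_ext (Y \<omega>)) = c) \<and> implicit_DOA f M X N Y"
      using Q by blast
  qed
qed

end
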